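(* Let $S\subset\mathbb{R}^n$ be a $d$-set with $n-1<d<n$. Let $1<p<\infty$, $1\le q\le\infty$, $\alpha>(n-d)/p$ and let $k>\alpha$ be an integer. Then there is a constant $c$, depending on $n,S,p$ and $\alpha$ (and on the integer fixed in the definition of the Triebel--Lizorkin norm), such that for every $f\in F^{\alpha}_{pq}(\mathbb{R}^n)$ $$\bigg(\sum_{i=0}^\infty\big(2^{i(\alpha-(n-d)/p)}\|\mathcal{E}_k(f|_S,Q(\cdot,2^{-i}))_{L^1(S)}\|_{L^p(S)}\big)^p\bigg)^{1/p}+\|f|_S\|_{L^p(S)}\le c\,\|f\|_{F^{\alpha}_{pq}(\mathbb{R}^n)}.$$
   Context: $Q(x,r)=\{y\in\mathbb{R}^n:\|y-x\|_\infty\le r\}$ is the closed cube with center $x$ and side length $2r$. $\mathcal{H}^d$ is the $d$-dimensional Hausdorff measure. A (nonempty) closed set $S\subset\mathbb{R}^n$ is a $d$-set if there are constants $c_1,c_2>0$ such that $c_1r^d\le\mathcal{H}^d(Q(w,r)\cap S)\le c_2r^d$ for all $w\in S$, $0<r\le1$. $L^p(S)$ is taken with respect to $\mathcal{H}^d|_S$. $\mathcal{P}_m$ is the space of polynomials on $\mathbb{R}^n$ of degree at most $m$ ($\mathcal{P}_{-1}=\{0\}$). For a cube $Q$, $$\mathcal{E}_m(f,Q)_{L^1(\mathbb{R}^n)}:=\inf_{P\in\mathcal{P}_{m-1}}\frac1{|Q|}\int_Q|f-P|\,dx,$$ and for a cube $Q$ centered in $S$ and a function $g$ on $S$, $$\mathcal{E}_m(g,Q)_{L^1(S)}:=\inf_{P\in\mathcal{P}_{m-1}}\frac{1}{\mathcal{H}^d(Q\cap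 S)}\int_{Q\cap S}|g-P|\,d\mathcal{H}^d .$$ The $L^p(S)$-norm of $\mathcal{E}_k(g,Q(\cdot,t))_{L^1(S)}$ is taken with respect to the center of the cube. Triebel--Lizorkin spaces: fix an integer $m>\alpha$. For $f\in L^1_{\mathrm{loc}}(\mathbb{R}^n)$ put $g(x):=\big(\int_0^1(t^{-\alpha}\mathcal{E}_m(f,Q(x,t))_{L^1(\mathbb{R}^n)})^q\frac{dt}{t}\big)^{1/q}$ if $q<\infty$ and $g(x):=\sup_{0<t\le1}t^{-\alpha}\mathcal{E}_m(f,Q(x,t))_{L^1(\mathbb{R}^n)}$ if $q=\infty$. Then $f\in F^\alpha_{pq}(\mathbb{R}^n)$ iff $f,g\in L^p(\mathbb{R}^n)$, and $\|f\|_{F^\alpha_{pq}(\mathbb{R}^n)}:=\|f\|_{L^p(\mathbb{R}^n)}+\|g\|_{L^p(\mathbb{R}^n)}$; different integers $m>\alpha$ give equivalent norms. Trace: for $f\in L^1_{\mathrm{loc}}(\mathbb{R}^n)$ put $\bar f(x)=\lim_{r\to0+}\frac{1}{|Q(x,r)|}\int_{Q(x,r)}f(y)\,dy$ wherever the limit exists, and $f|_S(x):=\bar f(x)$ at those $x\in S$ where it exists. For $f\in F^\alpha_{pq}(\mathbb{R}^n)$ with $d>n-\alpha p$ it is known that $\mathcal{H}^d$-almost every point is a Lebesgue point of $\bar f$; in particular $f|_S$ is defined $\mathcal{H}^d$-a.e. on $S$. *)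

theory Defs
  imports "HOL-Analysis.Analysis"
begin

(* Real powers of extended nonnegative numbers; only used for a > 0. *)
definition ennpowr :: "ennreal \<Rightarrow> real \<Rightarrow> ennreal" (infixr \<open>ennpowr\<close> 80) where
  "x ennpowr a = (if x = \<infinity> then \<infinity> else ennreal (enn2real x powr a))"

definition cube :: "real^'n \<Rightarrow> real \<Rightarrow> (real^'n) set" where
  "cube x r = {y. infnorm (y - x) \<le> r}"


(* Hausdorff measure for d > 0, without a normalising constant.  (For d = 0 the
   convention 0 powr 0 = 0 would give the zero measure instead of counting measure.)
   As diameter is only meaningful for bounded sets, boundedness is required separately. *)

definition hausdorff_content :: "real \<Rightarrow> real \<Rightarrow> 'a::metric_space set \<Rightarrow> ennreal" where
  "hausdorff_content d \<delta> A =
     (INF U \<in> {U :: nat \<Rightarrow> 'a set. A \<subseteq> (\<Union>i. U i) \<and> (\<forall>i. bounded (U i) \<and> diameter (U i) \<le> \<delta>)}.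
        \<Sum>i. ennreal (diameter (U i) powr d))"

definition hausdorff_outer :: "real \<Rightarrow> 'a::metric_space set \<Rightarrow> ennreal" where
  "hausdorff_outer d A = (SUP \<delta>\<in>{0<..}. hausdorff_content d \<delta> A)"

definition hausdorff_measure :: "real \<Rightarrow> 'a::metric_space measure" where
  "hausdorff_measure d =
     measure_of UNIV (lambda_system UNIV UNIV (hausdorff_outer d)) (hausdorff_outer d)"

lemma hausdorff_content_mono:
  "A \<subseteq> B \<Longrightarrow> hausdorff_content d \<delta> A \<le> hausdorff_content d \<delta> B"
  unfolding hausdorff_content_def by (rule INF_superset_mono) auto

lemma hausdorff_content_empty:
  assumes "\<delta> > 0"
  shows "hausdorff_content d \<delta> ({} :: 'a::metric_space set) = 0"
proof -
  have "hausdorff_content d \<delta> ({} :: 'a set) \<le> (\<Sum>i::nat. ennreal (diameter ({} :: 'a set) powr d))"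
    unfolding hausdorff_content_def using assms by (intro INF_lower2[of "\<lambda>_. {}"]) auto
  then show ?thesis by simp
qed

lemma hausdorff_content_UN:
  fixes A :: "nat \<Rightarrow> 'a::metric_space set"
  shows "hausdorff_content d \<delta> (\<Union>i. A i) \<le> (\<Sum>i. hausdorff_content d \<delta> (A i))"
proof (rule ennreal_le_epsilon)
  fix e :: real
  assume fin: "(\<Sum>i. hausdorff_content d \<delta> (A i)) < top" and e: "0 < e"
  let ?C = "\<lambda>B. {U :: nat \<Rightarrow> 'a set. B \<subseteq> (\<Union>i. U i) \<and> (\<forall>i. bounded (U i) \<and> diameter (U i) \<le> \<delta>)}"
  have "\<forall>i. \<exists>U. U \<in> ?C (A i) \<and> (\<Sum>j. ennreal (diameter (U j) powr d))
          < hausdorff_content d \<delta> (A i) + ennreal (e * (1/2) ^ Suc i)"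
  proof
    fix i
    have "hausdorff_content d \<delta> (A i) < top"
      using fin by (metis ennreal_suminf_lessD)
    then have "hausdorff_content d \<delta> (A i)
        < hausdorff_content d \<delta> (A i) + ennreal (e * (1/2) ^ Suc i)"
      using e by (simp add: ennreal_add_left_cancel_less)
    then show "\<exists>U. U \<in> ?C (A i) \<and> (\<Sum>j. ennreal (diameter (U j) powr d))
          < hausdorff_content d \<delta> (A i) + ennreal (e * (1/2) ^ Suc i)"
      unfolding hausdorff_content_def INF_less_iff Bex_def .
  qed
  from choice[OF this] obtain U where U: "\<And>i. U i \<in> ?C (A i)"
    and le: "\<And>i. (\<Sum>j. ennreal (diameter (U i j) powr d))
          < hausdorff_content d \<delta> (A i) + ennreal (e * (1/2) ^ Suc i)"
    by blast
  let ?V = "\<lambda>n. case prod_decode n of (i, j) \<Rightarrow> U i j"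
  have "?V \<in> ?C (\<Union>i. A i)"
  proof -
    have "x \<in> (\<Union>n. ?V n)" if x: "x \<in> A i" for x i
    proof -
      obtain j where "x \<in> U i j" using U[of i] x by blast
      then show ?thesis by (intro UN_I[of "prod_encode (i, j)"]) auto
    qed
    then show ?thesis using U by (auto split: prod.split)
  qed
  then have "hausdorff_content d \<delta> (\<Union>i. A i) \<le> (\<Sum>n. ennreal (diameter (?V n) powr d))"
    unfolding hausdorff_content_def by (rule INF_lower)
  also have "\<dots> = (\<Sum>i. \<Sum>j. ennreal (diameter (U i j) powr d))"
    by (subst suminf_ennreal_2dimen[where f = "\<lambda>(i, j). ennreal (diameter (U i j) powr d)", symmetric])
       (auto simp: case_prod_unfold intro!: suminf_cong)
  also have "\<dots> \<le> (\<Sum>i. hausdorff_content d \<delta> (A i) + ennreal (e * (1/2) ^ Suc i))"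
    using le by (intro suminf_le) (auto simp: less_imp_le)
  also have "\<dots> = (\<Sum>i. hausdorff_content d \<delta> (A i)) + (\<Sum>i. ennreal (e * (1/2) ^ Suc i))"
    by (intro suminf_add[symmetric]) auto
  also have "(\<Sum>i. ennreal (e * (1/2) ^ Suc i)) = ennreal e"
    using sums_mult[OF power_half_series, of e] e
    by (intro suminf_ennreal_eq) auto
  finally show "hausdorff_content d \<delta> (\<Union>i. A i) \<le> (\<Sum>i. hausdorff_content d \<delta> (A i)) + ennreal e" .
qed

lemma outer_measure_space_hausdorff_outer:
  "outer_measure_space UNIV (hausdorff_outer d :: 'a::metric_space set \<Rightarrow> ennreal)"
  unfolding outer_measure_space_def
proof (intro conjI)
  show "positive UNIV (hausdorff_outer d :: 'a set \<Rightarrow> ennreal)"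
    by (auto simp: positive_def hausdorff_outer_def hausdorff_content_empty)
  show "increasing UNIV (hausdorff_outer d :: 'a set \<Rightarrow> ennreal)"
    by (auto simp: increasing_def hausdorff_outer_def intro!: SUP_mono hausdorff_content_mono)
  show "countably_subadditive UNIV (hausdorff_outer d :: 'a set \<Rightarrow> ennreal)"
    unfolding countably_subadditive_def
  proof (intro allI impI)
    fix A :: "nat \<Rightarrow> 'a set"
    show "hausdorff_outer d (\<Union>i. A i) \<le> (\<Sum>i. hausdorff_outer d (A i))"
      unfolding hausdorff_outer_def[of d "\<Union>i. A i"]
    proof (rule SUP_least)
      fix \<delta> :: real assume "\<delta> \<in> {0<..}"
      then have "(\<Sum>i. hausdorff_content d \<delta> (A i)) \<le> (\<Sum>i. hausdorff_outer d (A i))"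
        unfolding hausdorff_outer_def by (intro suminf_le) (auto intro: SUP_upper)
      then show "hausdorff_content d \<delta> (\<Union>i. A i) \<le> (\<Sum>i. hausdorff_outer d (A i))"
        using hausdorff_content_UN order_trans by blast
    qed
  qed
qed

lemma measure_space_hausdorff_outer:
  "measure_space UNIV (lambda_system UNIV UNIV (hausdorff_outer d))
     (hausdorff_outer d :: 'a::metric_space set \<Rightarrow> ennreal)"
proof -
  have "sigma_algebra UNIV (UNIV :: 'a set set)"
    using sigma_algebra_Pow[of "UNIV :: 'a set"] by simp
  from sigma_algebra.caratheodory_lemma[OF this outer_measure_space_hausdorff_outer]
  show ?thesis by simp
qed

lemma sets_hausdorff_measure:
  "sets (hausdorff_measure d :: 'a::metric_space measure) = lambda_system UNIV UNIV (hausdorff_outer d)"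
  using measure_space_hausdorff_outer[of d, where ?'a = 'a]
  by (auto simp: hausdorff_measure_def measure_space_def sigma_algebra.sigma_sets_eq)

lemma emeasure_hausdorff_measure:
  assumes "A \<in> sets (hausdorff_measure d :: 'a::metric_space measure)"
  shows "emeasure (hausdorff_measure d) A = hausdorff_outer d A"
  using measure_space_hausdorff_outer[of d, where ?'a = 'a] assms unfolding sets_hausdorff_measure
  by (intro emeasure_measure_of[OF hausdorff_measure_def])
     (auto simp: measure_space_def sets_hausdorff_measure)


definition d_set :: "real \<Rightarrow> (real^'n) set \<Rightarrow> bool" where
  "d_set d S \<longleftrightarrow> S \<noteq> {} \<and> closed S \<and>
     (\<exists>c1 > 0. \<exists>c2 > 0. \<forall>w\<in>S. \<forall>r. 0 < r \<and> r \<le> 1 \<longrightarrow>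
        ennreal (c1 * r powr d) \<le> emeasure (hausdorff_measure d) (cube w r \<inter> S) \<and>
        emeasure (hausdorff_measure d) (cube w r \<inter> S) \<le> ennreal (c2 * r powr d))"

(* Polynomials of degree strictly less than m, i.e. P_(m-1); for m = 0 only the zero
   function.  The summation index b ranges over the (finitely many) multi-indices of
   order less than m. *)
definition polys_below :: "nat \<Rightarrow> (real^'n \<Rightarrow> real) set" where
  "polys_below m = {P. \<exists>c :: ('n \<Rightarrow> nat) \<Rightarrow> real.
     P = (\<lambda>x. \<Sum>b | (\<Sum>i\<in>UNIV. b i) < m. c b * (\<Prod>i\<in>UNIV. (x $ i) ^ b i))}"

lemma finite_multi_indices: "finite {b :: 'n::finite \<Rightarrow> nat. (\<Sum>i\<in>UNIV. b i) < m}"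
proof (rule finite_subset)
  show "{b :: 'n \<Rightarrow> nat. (\<Sum>i\<in>UNIV. b i) < m} \<subseteq> Pi\<^sub>E UNIV (\<lambda>_. {..<m})"
    by (auto simp: PiE_UNIV_domain)
       (metis (no_types, lifting) UNIV_I finite le_less_trans member_le_sum zero_le)
qed (auto intro: finite_PiE)

(* Used with M = lebesgue, A = Q and with M = the Hausdorff measure, A = Q \<inter> S. *)
definition local_approx :: "nat \<Rightarrow> (real^'n) measure \<Rightarrow> (real^'n \<Rightarrow> real) \<Rightarrow> (real^'n) set \<Rightarrow> ennreal" where
  "local_approx m M f A =
     (INF P \<in> polys_below m. (\<integral>\<^sup>+y\<in>A. ennreal \<bar>f y - P y\<bar> \<partial>M) / emeasure M A)"

definition approx_Rn :: "nat \<Rightarrow> (real^'n \<Rightarrow> real) \<Rightarrow> (real^'n) set \<Rightarrow> ennreal" where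
  "approx_Rn m f Q = local_approx m lebesgue f Q"

definition approx_on :: "real \<Rightarrow> (real^'n) set \<Rightarrow> nat \<Rightarrow> (real^'n \<Rightarrow> real) \<Rightarrow> (real^'n) set \<Rightarrow> ennreal" where
  "approx_on d S m g Q = local_approx m (hausdorff_measure d) g (Q \<inter> S)"

definition Lp_norm :: "'a measure \<Rightarrow> real \<Rightarrow> ('a \<Rightarrow> ennreal) \<Rightarrow> ennreal" where
  "Lp_norm M p u = (\<integral>\<^sup>+x. u x ennpowr p \<partial>M) ennpowr (1 / p)"

definition L1_loc :: "(real^'n \<Rightarrow> real) \<Rightarrow> bool" where
  "L1_loc f \<longleftrightarrow> (\<forall>K. compact K \<longrightarrow> set_integrable lebesgue K f)"

definition TL_function :: "nat \<Rightarrow> real \<Rightarrow> ennreal \<Rightarrow> (real^'n \<Rightarrow> real) \<Rightarrow> real^'n \<Rightarrow> ennreal" where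
  "TL_function m \<alpha> q f x =
     (if q = \<infinity> then SUP t\<in>{0<..1}. ennreal (t powr (-\<alpha>)) * approx_Rn m f (cube x t)
      else (\<integral>\<^sup>+t\<in>{0<..1}. (ennreal (t powr (-\<alpha>)) * approx_Rn m f (cube x t)) ennpowr (enn2real q)
              * ennreal (1 / t) \<partial>lborel) ennpowr (1 / enn2real q))"

definition TL_space :: "nat \<Rightarrow> real \<Rightarrow> real \<Rightarrow> ennreal \<Rightarrow> (real^'n \<Rightarrow> real) set" where
  "TL_space m \<alpha> p q = {f. L1_loc f \<and>
     f \<in> borel_measurable lebesgue \<and> Lp_norm lebesgue p (\<lambda>x. ennreal \<bar>f x\<bar>) < \<infinity> \<and>
     TL_function m \<alpha> q f \<in> borel_measurable lebesgue \<and> Lp_norm lebesgue p (TL_function m \<alpha> q f) < \<infinity>}"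

definition TL_norm :: "nat \<Rightarrow> real \<Rightarrow> real \<Rightarrow> ennreal \<Rightarrow> (real^'n \<Rightarrow> real) \<Rightarrow> ennreal" where
  "TL_norm m \<alpha> p q f =
     Lp_norm lebesgue p (\<lambda>x. ennreal \<bar>f x\<bar>) + Lp_norm lebesgue p (TL_function m \<alpha> q f)"

definition cube_average :: "(real^'n \<Rightarrow> real) \<Rightarrow> real^'n \<Rightarrow> real \<Rightarrow> real" where
  "cube_average f x r = (LINT y:cube x r|lebesgue. f y) / measure lebesgue (cube x r)"

(* The limit of the averages; its restriction to S is the trace of f on S.  Points at
   which the limit does not exist get the dummy value 0; for the functions considered
   they form a null set of S. *)
definition pointwise_trace :: "(real^'n \<Rightarrow> real) \<Rightarrow> real^'n \<Rightarrow> real" where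
  "pointwise_trace f x =
     (if \<exists>l. (cube_average f x \<longlongrightarrow> l) (at_right 0) then Lim (at_right 0) (cube_average f x) else 0)"

end

theory Submission
  imports Defs "HOL-Computational_Algebra.Polynomial"
begin

text \<open>
  Fix bounded kernels on the unit cube that reproduce the coefficients of polynomials of degree
  less than \<open>m\<close>. Transported to the cube \<open>Q(y,r)\<close> they yield a projection onto polynomials whose error
  \<open>osc f y r\<close> is comparable to the local approximation error of \<open>f\<close>, but measurable in \<open>y\<close> and, up to
  constants, monotone in the cube. Telescoping the coefficients over dyadic scales shows that the
  averages of \<open>f\<close> converge wherever \<open>\<Sum>j. osc f y (rho j)\<close> is finite, and bounds the distance of the
  trace to a polynomial of degree less than \<open>k\<close> by sums of oscillations, pointwise and without
  exceptional sets (where the sum is infinite there is nothing to show). Hardy's inequality then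
  reduces the theorem to a bound for the weighted \<open>l\<^sup>p(L\<^sup>p(S))\<close> norm of the oscillations. Since \<open>d < n\<close>,
  the set \<open>S\<close> is porous: a fixed proportion of \<open>Q(y,r)\<close> has distance comparable to \<open>r\<close> from \<open>S\<close>.
  Comparing the oscillation at \<open>y\<close> with those at such points only, the regions used at different
  scales overlap boundedly, so that a supremum over the scales under the integral, i.e. the case
  \<open>q = \<infinity>\<close>, already suffices on the right-hand side.
\<close>

subsection \<open>Powers and integral inequalities in the extended nonnegative reals\<close>

text \<open>The infimum in \<open>local_approx\<close> comes with no measurable choice of a
  polynomial, whereas \<open>coef f y r b\<close> is an integral of \<open>f\<close> against a fixed
  kernel: linear in \<open>f\<close>, and Borel in \<open>y\<close> once \<open>f\<close> is Borel.
  Hence \<open>f\<close> is replaced by a Borel representative, which changes the trace and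
  \<open>TL_function\<close> at no point. The trace itself is never shown to be measurable:
  nonnegative integrals are monotone for arbitrary functions, so Borel majorants suffice. The norm
  fixes \<open>m\<close>, the conclusion has an arbitrary \<open>k > \<alpha>\<close>, and the
  constant may depend neither on \<open>k\<close> nor on \<open>q\<close>. As the error decreases in
  \<open>k\<close>, only the least integer \<open>k0 > \<alpha>\<close> matters, and
  \<open>k0 \<le> m\<close>. The projection has degree below \<open>m\<close>, so its coefficients
  of order at least \<open>k0\<close> must be discarded. Up to oscillations they shrink by
  \<open>(1 / 2) ^ k0\<close> per dyadic step, which beats the growth \<open>2 powr beta\<close> of
  the weight because \<open>k0 > \<alpha> > beta\<close>.\<close>

lemma ennpowr_ennreal: "0 \<le> x \<Longrightarrow> ennreal x ennpowr a = ennreal (x powr a)"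
  by (simp add: ennpowr_def)

lemma ennpowr_infinity [simp]: "\<infinity> ennpowr a = \<infinity>" "top ennpowr a = \<infinity>"
  by (simp_all add: ennpowr_def)

lemma ennpowr_zero [simp]: "0 ennpowr a = 0"
  by (simp add: ennpowr_def)

lemma ennpowr_mono:
  assumes "x \<le> y" "0 \<le> a"
  shows "x ennpowr a \<le> y ennpowr a"
proof (cases y)
  case (real r)
  then obtain s where "x = ennreal s" "0 \<le> s"
    using assms by (metis ennreal_cases ennreal_less_top leD)
  with real assms show ?thesis
    by (auto simp: ennpowr_ennreal ennreal_le_iff intro!: ennreal_leI powr_mono2)
qed simp

lemma ennpowr_eq_0_iff [simp]: "x ennpowr a = 0 \<longleftrightarrow> x = 0"
  by (cases x) (auto simp: ennpowr_ennreal)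

text \<open>With \<open>0 * top = 0\<close> there are no exceptions, since \<open>ennpowr\<close>
  sends only 0 to 0, whatever the exponent.\<close>

lemma ennpowr_mult: "(x * y) ennpowr a = x ennpowr a * y ennpowr a"
proof (cases "x = top \<or> y = top")
  case True
  have "top * z = (if z = 0 then 0 else top)" for z :: ennreal
    by (simp add: ennreal_top_mult)
  moreover have "z * top = (if z = 0 then 0 else top)" for z :: ennreal
    by (simp add: ennreal_mult_top)
  ultimately show ?thesis
    using True by auto
next
  case False
  then obtain r s where "x = ennreal r" "0 \<le> r" "y = ennreal s" "0 \<le> s"
    by (metis ennreal_cases)
  then show ?thesis
    by (simp add: ennreal_mult'[symmetric] ennpowr_ennreal powr_mult)
qed

lemma ennpowr_ennpowr: "(x ennpowr a) ennpowr b = x ennpowr (a * b)"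
  by (cases x) (auto simp: ennpowr_ennreal powr_powr)

lemma ennpowr_one [simp]: "x ennpowr 1 = x"
  by (cases x) (auto simp: ennpowr_ennreal)

lemma ennpowr_add_le:
  assumes "0 \<le> a"
  shows "(x + y) ennpowr a \<le> ennreal (2 powr a) * (x ennpowr a + y ennpowr a)"
proof -
  have "x + y \<le> 2 * max x y"
    by (metis add_mono max.cobounded1 max.cobounded2 mult_2)
  then have "(x + y) ennpowr a \<le> (2 * max x y) ennpowr a"
    using assms by (rule ennpowr_mono)
  also have "\<dots> = ennreal (2 powr a) * (max x y) ennpowr a"
    using ennpowr_ennreal[of 2 a] by (simp add: ennpowr_mult)
  also have "(max x y) ennpowr a \<le> x ennpowr a + y ennpowr a"
    by (cases "x \<le> y") (auto simp: max_def)
  finally show ?thesis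
    by (simp add: mult_left_mono)
qed

lemma ennpowr_add_le_mono:
  assumes "0 \<le> a" "z \<le> x + y" "x ennpowr a \<le> X" "y ennpowr a \<le> Y"
  shows "z ennpowr a \<le> ennreal (2 powr a) * (X + Y)"
proof -
  have "z ennpowr a \<le> ennreal (2 powr a) * (x ennpowr a + y ennpowr a)"
    using ennpowr_mono[OF assms(2,1)] ennpowr_add_le[OF assms(1)] by (rule order_trans)
  also have "\<dots> \<le> ennreal (2 powr a) * (X + Y)"
    using assms by (intro mult_left_mono add_mono) auto
  finally show ?thesis .
qed

lemma borel_measurable_ennpowr [measurable (raw)]:
  assumes [measurable]: "f \<in> borel_measurable M"
  shows "(\<lambda>x. f x ennpowr a) \<in> borel_measurable M"
  unfolding ennpowr_def by measurable

text \<open>Convexity: \<open>t powr p\<close> lies above its tangent at \<open>a\<close>. Young's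
  inequality for \<open>t\<close> and \<open>a powr (p - 1)\<close> with exponents \<open>p\<close>
  and \<open>p / (p - 1)\<close> yields this without derivatives and includes
  \<open>a = 0\<close>.\<close>

lemma powr_tangent_le:
  fixes t a p :: real
  assumes "1 < p" "0 \<le> t" "0 \<le> a"
  shows "p * a powr (p - 1) * t \<le> t powr p + (p - 1) * a powr p"
proof -
  define q where "q = p / (p - 1)"
  have "1 / q = (p - 1) / p" "(p - 1) * q = p" "q > 1"
    using assms by (simp_all add: q_def less_divide_eq)
  then have q: "q > 1" "1 / p + 1 / q = 1" "(p - 1) * q = p" "1 / q = (p - 1) / p"
    using assms by (simp_all add: add_divide_distrib[symmetric])
  have "t * a powr (p - 1) \<le> t powr p / p + (a powr (p - 1)) powr q / q"
    using assms q by (intro Youngs_inequality) auto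
  also have "(a powr (p - 1)) powr q / q = a powr p * ((p - 1) / p)"
    by (simp add: powr_powr q(3) q(4)[symmetric])
  finally have "p * (t * a powr (p - 1)) \<le> p * (t powr p / p + a powr p * ((p - 1) / p))"
    using assms by (intro mult_left_mono) auto
  also have "\<dots> = t powr p + (p - 1) * a powr p"
    using assms by (simp add: distrib_left)
  finally show ?thesis
    by (simp add: mult_ac)
qed

text \<open>Jensen's inequality, obtained by integrating the tangent inequality. An upper bound
  \<open>K\<close> of the mass suffices because the mass enters only through the constant term of
  the tangent.\<close>

lemma nn_integral_ennpowr_le:
  assumes K: "emeasure M (space M) \<le> ennreal K" "0 < K" and p: "1 < p"
    and u[measurable]: "u \<in> borel_measurable M"
  shows "(\<integral>\<^sup>+x. u x \<partial>M) ennpowr p \<le> ennreal (K powr (p - 1)) * (\<integral>\<^sup>+x. u x ennpowr p \<partial>M)"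
proof (cases "(\<integral>\<^sup>+x. u x \<partial>M)")
  case top
  \<comment> \<open>On a finite measure this forces \<open>u ennpowr p\<close> to have infinite
    integral as soon as \<open>u\<close> has.\<close>
  have "u x \<le> 1 + u x ennpowr p" for x
  proof (cases "u x")
    case (real r)
    then show ?thesis
    proof (cases "r \<le> 1")
      case False
      then have "r powr 1 \<le> r powr p"
        using p by (intro powr_mono) auto
      with False real show ?thesis
        by (auto simp: ennpowr_ennreal intro!: order_trans[OF _ add_increasing] ennreal_leI)
    qed (auto intro!: add_increasing2)
  qed simp
  then have "(\<integral>\<^sup>+x. u x \<partial>M) \<le> (\<integral>\<^sup>+x. 1 + u x ennpowr p \<partial>M)"
    by (intro nn_integral_mono) auto
  also have "\<dots> = emeasure M (space M) + (\<integral>\<^sup>+x. u x ennpowr p \<partial>M)"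
    by (subst nn_integral_add) auto
  finally have "emeasure M (space M) + (\<integral>\<^sup>+x. u x ennpowr p \<partial>M) = top"
    using top by (simp add: top_unique)
  then have "(\<integral>\<^sup>+x. u x ennpowr p \<partial>M) = top"
    using K by (metis ennreal_add_eq_top ennreal_neq_top top_unique)
  then show ?thesis
    using K by (simp add: ennreal_mult_top)
next
  case (real A)
  \<comment> \<open>The mean of \<open>u\<close>, with \<open>K\<close> in place of the mass: the
    point of tangency for which the integrated inequality is exactly the claim.\<close>
  define a where "a = A / K"
  have a: "0 \<le> a" "A = a * K" using real K by (auto simp: a_def)
  have pt: "ennreal (p * a powr (p - 1)) * u x \<le> u x ennpowr p + ennreal ((p - 1) * a powr p)" for x
  proof (cases "u x")
    case (real t)
    then show ?thesis
      using powr_tangent_le[of p t a] a p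
      by (simp add: ennpowr_ennreal ennreal_mult'[symmetric] ennreal_plus[symmetric] del: ennreal_plus)
  qed simp
  have "ennreal (p * a powr (p - 1)) * (\<integral>\<^sup>+x. u x \<partial>M) = (\<integral>\<^sup>+x. ennreal (p * a powr (p - 1)) * u x \<partial>M)"
    by (simp add: nn_integral_cmult)
  also have "\<dots> \<le> (\<integral>\<^sup>+x. u x ennpowr p + ennreal ((p - 1) * a powr p) \<partial>M)"
    by (intro nn_integral_mono pt)
  also have "\<dots> = (\<integral>\<^sup>+x. u x ennpowr p \<partial>M) + ennreal ((p - 1) * a powr p) * emeasure M (space M)"
    by (subst nn_integral_add) auto
  also have "\<dots> \<le> (\<integral>\<^sup>+x. u x ennpowr p \<partial>M) + ennreal ((p - 1) * a powr p) * ennreal K"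
    using K by (intro add_left_mono mult_left_mono) auto
  finally have *: "ennreal (p * a powr (p - 1) * A)
      \<le> (\<integral>\<^sup>+x. u x ennpowr p \<partial>M) + ennreal ((p - 1) * a powr p * K)"
    using real p K by (simp add: ennreal_mult'[symmetric])
  have eq: "a powr (p - 1) * A = a powr p * K"
    using a p by (cases "a = 0") (auto simp: powr_diff)
  have main: "ennreal (a powr p * K) \<le> (\<integral>\<^sup>+x. u x ennpowr p \<partial>M)"
  proof (cases "(\<integral>\<^sup>+x. u x ennpowr p \<partial>M)")
    case (real I)
    with * K p eq have "p * (a powr p * K) \<le> I + (p - 1) * a powr p * K"
      by (simp add: ennreal_plus[symmetric] mult.assoc del: ennreal_plus)
    then show ?thesis
      using real by (simp add: algebra_simps ennreal_leI)
  qed simp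
  have "A powr p = K powr (p - 1) * (a powr p * K)"
    using a K p by (simp add: powr_mult powr_diff)
  then have "(\<integral>\<^sup>+x. u x \<partial>M) ennpowr p = ennreal (K powr (p - 1)) * ennreal (a powr p * K)"
    using real K by (simp add: ennpowr_ennreal ennreal_mult'[symmetric])
  also have "\<dots> \<le> ennreal (K powr (p - 1)) * (\<integral>\<^sup>+x. u x ennpowr p \<partial>M)"
    using main by (intro mult_left_mono) auto
  finally show ?thesis .
qed

section \<open>Discrete Hardy inequalities\<close>

lemma suminf_geometric_ennpowr_le:
  fixes u :: "nat \<Rightarrow> ennreal"
  assumes \<theta>: "0 < \<theta>" "\<theta> < 1" and p: "1 < p"
  shows "(\<Sum>j. ennreal (\<theta> ^ j) * u j) ennpowr p
    \<le> ennreal ((1 / (1 - \<theta>)) powr (p - 1)) * (\<Sum>j. ennreal (\<theta> ^ j) * u j ennpowr p)"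
proof -
  \<comment> \<open>Jensen's inequality on the natural numbers with point masses
    \<open>\<theta> ^ j\<close>, of total mass \<open>1 / (1 - \<theta>)\<close>.\<close>
  define M where "M = density (count_space (UNIV :: nat set)) (\<lambda>j. ennreal (\<theta> ^ j))"
  have int: "(\<integral>\<^sup>+j. v j \<partial>M) = (\<Sum>j. ennreal (\<theta> ^ j) * v j)" for v
    by (simp add: M_def nn_integral_density nn_integral_count_space_nat)
  have "emeasure M (space M) = (\<Sum>j. ennreal (\<theta> ^ j))"
    using int[of "\<lambda>_. 1"] by simp
  also have "\<dots> = ennreal (1 / (1 - \<theta>))"
    using \<theta> geometric_sums[of \<theta>] by (intro suminf_ennreal_eq) auto
  finally show ?thesis
    using nn_integral_ennpowr_le[of M "1 / (1 - \<theta>)" p u] \<theta> p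
    by (simp add: int) (simp add: M_def)
qed

lemma suminf_ennreal_swap:
  fixes f :: "nat \<Rightarrow> nat \<Rightarrow> ennreal"
  shows "(\<Sum>i. \<Sum>j. f i j) = (\<Sum>j. \<Sum>i. f i j)"
proof -
  have "(\<Sum>i. \<Sum>j. f i j) = (\<integral>\<^sup>+i. (\<Sum>j. f i j) \<partial>count_space UNIV)"
    by (simp add: nn_integral_count_space_nat)
  also have "\<dots> = (\<Sum>j. \<integral>\<^sup>+i. f i j \<partial>count_space UNIV)"
    by (rule nn_integral_suminf) simp
  finally show ?thesis
    by (simp add: nn_integral_count_space_nat)
qed

text \<open>Young's inequality for convolution with a geometric sequence. The shifted sequence stays
  abstract as \<open>u i j\<close>, so that forward shifts (tails) and backward shifts (heads) are
  both covered.\<close>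

lemma suminf_geometric_convolution_le:
  fixes u :: "nat \<Rightarrow> nat \<Rightarrow> ennreal"
  assumes \<theta>: "0 < \<theta>" "\<theta> < 1" and p: "1 < p"
    and Z: "\<And>j. (\<Sum>i. u i j ennpowr p) \<le> Z"
  shows "(\<Sum>i. (\<Sum>j. ennreal (\<theta> ^ j) * u i j) ennpowr p) \<le> ennreal ((1 / (1 - \<theta>)) powr p) * Z"
proof -
  let ?K = "(1 / (1 - \<theta>)) powr (p - 1)"
  have "(\<Sum>i. (\<Sum>j. ennreal (\<theta> ^ j) * u i j) ennpowr p)
      \<le> (\<Sum>i. ennreal ?K * (\<Sum>j. ennreal (\<theta> ^ j) * u i j ennpowr p))"
    using \<theta> p by (intro suminf_le suminf_geometric_ennpowr_le) auto
  also have "\<dots> = ennreal ?K * (\<Sum>j. \<Sum>i. ennreal (\<theta> ^ j) * u i j ennpowr p)"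
    by (simp add: suminf_ennreal_swap[of "\<lambda>i j. ennreal (\<theta> ^ j) * u i j ennpowr p"])
  also have "(\<Sum>j. \<Sum>i. ennreal (\<theta> ^ j) * u i j ennpowr p) \<le> (\<Sum>j. ennreal (\<theta> ^ j) * Z)"
    using Z by (intro suminf_le) (auto intro: mult_left_mono)
  also have "(\<Sum>j. ennreal (\<theta> ^ j) * Z) = ennreal (1 / (1 - \<theta>)) * Z"
  proof -
    have "(\<Sum>j. ennreal (\<theta> ^ j)) = ennreal (1 / (1 - \<theta>))"
      using \<theta> geometric_sums[of \<theta>] by (intro suminf_ennreal_eq) auto
    then show ?thesis by simp
  qed
  also have "ennreal ?K * (ennreal (1 / (1 - \<theta>)) * Z) = ennreal ((1 / (1 - \<theta>)) powr p) * Z"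
    using \<theta> by (simp add: mult.assoc[symmetric] ennreal_mult'[symmetric] powr_diff)
  finally show ?thesis by (simp add: mult_left_mono)
qed

text \<open>The substitution \<open>b i = (1 / \<theta>) ^ i * a i\<close> turns the weighted tail
  into a convolution of \<open>b\<close> with \<open>\<theta> ^ j\<close>.\<close>

lemma weighted_hardy_tail:
  fixes a :: "nat \<Rightarrow> ennreal"
  assumes \<theta>: "0 < \<theta>" "\<theta> < 1" and p: "1 < p"
  shows "(\<Sum>i. (ennreal ((1 / \<theta>) ^ i) * (\<Sum>j. a (i + j))) ennpowr p)
    \<le> ennreal ((1 / (1 - \<theta>)) powr p) * (\<Sum>i. (ennreal ((1 / \<theta>) ^ i) * a i) ennpowr p)"
proof -
  define b where "b i = ennreal ((1 / \<theta>) ^ i) * a i" for i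
  have "ennreal ((1 / \<theta>) ^ i) * a (i + j) = ennreal (\<theta> ^ j) * b (i + j)" for i j
    using \<theta> by (simp add: b_def mult.assoc[symmetric] ennreal_mult'[symmetric] power_add power_divide)
  then have "ennreal ((1 / \<theta>) ^ i) * (\<Sum>j. a (i + j)) = (\<Sum>j. ennreal (\<theta> ^ j) * b (i + j))" for i
    by (simp flip: ennreal_suminf_cmult)
  moreover have "(\<Sum>i. (\<Sum>j. ennreal (\<theta> ^ j) * b (i + j)) ennpowr p)
      \<le> ennreal ((1 / (1 - \<theta>)) powr p) * (\<Sum>i. b i ennpowr p)"
  proof (rule suminf_geometric_convolution_le[OF \<theta> p])
    fix j
    have "(\<Sum>i. b (i + j) ennpowr p) \<le> (\<Sum>i. b (i + j) ennpowr p) + (\<Sum>i<j. b i ennpowr p)"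
      by simp
    also have "\<dots> = (\<Sum>i. b i ennpowr p)"
      by (rule suminf_offset[symmetric]) simp
    finally show "(\<Sum>i. b (i + j) ennpowr p) \<le> (\<Sum>i. b i ennpowr p)" .
  qed
  ultimately show ?thesis by (simp add: b_def)
qed

text \<open>Mirror image of the tail estimate with \<open>j = i - l\<close>: weight and damping
  combine to \<open>(\<kappa> / \<theta>) ^ j\<close>, which is summable because
  \<open>\<kappa> < \<theta>\<close>.\<close>

lemma weighted_hardy_head:
  fixes a :: "nat \<Rightarrow> ennreal"
  assumes \<theta>: "0 < \<theta>" "0 < \<kappa>" "\<kappa> < \<theta>" and p: "1 < p"
  shows "(\<Sum>i. (ennreal ((1 / \<theta>) ^ i) * (\<Sum>l\<le>i. ennreal (\<kappa> ^ (i - l)) * a l)) ennpowr p)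
    \<le> ennreal ((1 / (1 - \<kappa> / \<theta>)) powr p) * (\<Sum>i. (ennreal ((1 / \<theta>) ^ i) * a i) ennpowr p)"
proof -
  define b where "b i = ennreal ((1 / \<theta>) ^ i) * a i" for i
  define u where "u i j = (if j \<le> i then b (i - j) else 0)" for i j
  have eq: "ennreal ((1 / \<theta>) ^ i) * (ennreal (\<kappa> ^ (i - l)) * a l) = ennreal ((\<kappa> / \<theta>) ^ (i - l)) * u i (i - l)"
    if "l \<le> i" for i l
  proof -
    have "(1 / \<theta>) ^ i = (1 / \<theta>) ^ (i - l) * (1 / \<theta>) ^ l"
      using that by (simp flip: power_add)
    then have "(1 / \<theta>) ^ i * \<kappa> ^ (i - l) = (\<kappa> / \<theta>) ^ (i - l) * (1 / \<theta>) ^ l"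
      by (simp add: power_divide)
    then show ?thesis
      using \<theta> that by (simp add: u_def b_def mult.assoc[symmetric] ennreal_mult'[symmetric])
  qed
  have "ennreal ((1 / \<theta>) ^ i) * (\<Sum>l\<le>i. ennreal (\<kappa> ^ (i - l)) * a l)
      = (\<Sum>j. ennreal ((\<kappa> / \<theta>) ^ j) * u i j)" for i
  proof -
    have "ennreal ((1 / \<theta>) ^ i) * (\<Sum>l\<le>i. ennreal (\<kappa> ^ (i - l)) * a l)
        = (\<Sum>l\<le>i. ennreal ((\<kappa> / \<theta>) ^ (i - l)) * u i (i - l))"
      by (simp add: sum_distrib_left eq)
    also have "\<dots> = (\<Sum>j\<le>i. ennreal ((\<kappa> / \<theta>) ^ j) * u i j)"
      by (rule sum.reindex_bij_witness[of _ "\<lambda>j. i - j" "\<lambda>j. i - j"]) auto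
    also have "\<dots> = (\<Sum>j. ennreal ((\<kappa> / \<theta>) ^ j) * u i j)"
      by (rule suminf_finite[symmetric]) (auto simp: u_def)
    finally show ?thesis .
  qed
  moreover have "(\<Sum>i. (\<Sum>j. ennreal ((\<kappa> / \<theta>) ^ j) * u i j) ennpowr p)
      \<le> ennreal ((1 / (1 - \<kappa> / \<theta>)) powr p) * (\<Sum>i. b i ennpowr p)"
  proof (rule suminf_geometric_convolution_le)
    fix j
    have "(\<Sum>i. u i j ennpowr p) = (\<Sum>i. u (i + j) j ennpowr p) + (\<Sum>i<j. u i j ennpowr p)"
      by (rule suminf_offset) simp
    then show "(\<Sum>i. u i j ennpowr p) \<le> (\<Sum>i. b i ennpowr p)"
      by (simp add: u_def)
  qed (use \<theta> p in auto)
  ultimately show ?thesis by (simp add: b_def)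
qed

subsection \<open>Polynomials and coefficient functionals\<close>

definition mmonom :: "('n::finite \<Rightarrow> nat) \<Rightarrow> real^'n \<Rightarrow> real" where
  "mmonom b x = (\<Prod>i\<in>UNIV. (x $ i) ^ b i)"

definition multi_below :: "nat \<Rightarrow> ('n::finite \<Rightarrow> nat) set" where
  "multi_below m = {b. (\<Sum>i\<in>UNIV. b i) < m}"

definition poly_below :: "nat \<Rightarrow> (('n::finite \<Rightarrow> nat) \<Rightarrow> real) \<Rightarrow> real^'n \<Rightarrow> real" where
  "poly_below m a x = (\<Sum>b\<in>multi_below m. a b * mmonom b x)"

lemma finite_multi_below [simp]: "finite (multi_below m)"
  unfolding multi_below_def by (rule finite_multi_indices)

lemma polys_below_eq: "polys_below m = range (poly_below m)"
  by (auto simp: polys_below_def poly_below_def[abs_def] multi_below_def mmonom_def)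

lemma multi_below_mono: "k \<le> m \<Longrightarrow> multi_below k \<subseteq> multi_below m"
  by (auto simp: multi_below_def)

lemma multi_below_entry_less: "b \<in> multi_below m \<Longrightarrow> b i < m"
  using member_le_sum[of i UNIV b] by (auto simp: multi_below_def)

lemma poly_below_trunc:
  assumes "k \<le> m"
  shows "poly_below m (\<lambda>b. if b \<in> multi_below k then a b else 0) = poly_below k a"
proof
  fix x
  have "poly_below m (\<lambda>b. if b \<in> multi_below k then a b else 0) x
      = (\<Sum>b\<in>multi_below m. if b \<in> multi_below k then a b * mmonom b x else 0)"
    unfolding poly_below_def by (rule sum.cong) auto
  also have "\<dots> = poly_below k a x"
    unfolding poly_below_def
    by (simp add: sum.inter_restrict[symmetric] Int_absorb1[OF multi_below_mono[OF assms]])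
  finally show "poly_below m (\<lambda>b. if b \<in> multi_below k then a b else 0) x = poly_below k a x" .
qed

lemma polys_below_mono: "k \<le> m \<Longrightarrow> polys_below k \<subseteq> polys_below m"
  unfolding polys_below_eq by (auto simp flip: poly_below_trunc[of k m])

lemma cube_iff: "y \<in> cube x r \<longleftrightarrow> (\<forall>i. \<bar>y $ i - x $ i\<bar> \<le> r)"
proof
  assume y: "y \<in> cube x r"
  show "\<forall>i. \<bar>y $ i - x $ i\<bar> \<le> r"
  proof
    fix i
    have "\<bar>(y - x) $ i\<bar> \<le> infnorm (y - x)" by (rule component_le_infnorm_cart)
    with y show "\<bar>y $ i - x $ i\<bar> \<le> r" by (simp add: cube_def)
  qed
next
  assume *: "\<forall>i. \<bar>y $ i - x $ i\<bar> \<le> r"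
  have "infnorm (y - x) \<le> r"
    unfolding infnorm_cart by (rule cSup_least) (use * in auto)
  then show "y \<in> cube x r" by (simp add: cube_def)
qed

lemma abs_mmonom_le:
  assumes "z \<in> cube 0 r" "0 \<le> r"
  shows "\<bar>mmonom b z\<bar> \<le> r ^ (\<Sum>i\<in>UNIV. b i)"
proof -
  have "\<bar>mmonom b z\<bar> = (\<Prod>i\<in>UNIV. \<bar>z $ i\<bar> ^ b i)"
    by (simp add: mmonom_def abs_prod power_abs)
  also have "\<dots> \<le> (\<Prod>i\<in>UNIV. r ^ b i)"
    using assms by (intro prod_mono) (auto simp: cube_iff intro!: power_mono)
  finally show ?thesis by (simp add: power_sum)
qed

lemma mmonom_scaleR: "mmonom b (r *\<^sub>R z) = r ^ (\<Sum>i\<in>UNIV. b i) * mmonom b z"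
  by (simp add: mmonom_def power_mult_distrib prod.distrib power_sum)

lemma mmonom_zero: "mmonom b 0 = (if b = (\<lambda>_. 0) then 1 else 0)"
  by (auto simp: mmonom_def power_0_left fun_eq_iff)

lemma poly_below_zero: "0 < m \<Longrightarrow> poly_below m a 0 = a (\<lambda>_. 0)"
  unfolding poly_below_def mmonom_zero by (simp add: multi_below_def mult_delta_right finite_multi_indices)

lemma poly_below_scaleR:
  "poly_below m a (r *\<^sub>R z) = poly_below m (\<lambda>b. r ^ (\<Sum>i\<in>UNIV. b i) * a b) z"
  by (simp add: poly_below_def mmonom_scaleR mult_ac)

text \<open>Binomial expansion in each coordinate; every multi-index that occurs lies coordinatewise
  below \<open>g\<close>, so the degree does not grow.\<close>

lemma mmonom_affine_ex:
  fixes y :: "real^'n"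
  assumes "g \<in> multi_below m"
  shows "\<exists>c. \<forall>z. mmonom g (y + s *\<^sub>R z) = poly_below m c z"
proof -
  let ?E = "PiE UNIV (\<lambda>i. {..g i})"
  let ?c = "\<lambda>h. \<Prod>i\<in>UNIV. of_nat (g i choose h i) * s ^ h i * (y $ i) ^ (g i - h i) :: real"
  have sub: "?E \<subseteq> multi_below m"
  proof
    fix h assume h: "h \<in> ?E"
    have "(\<Sum>i\<in>UNIV. h i) \<le> (\<Sum>i\<in>UNIV. g i)"
      using h by (intro sum_mono) auto
    then show "h \<in> multi_below m" using assms by (simp add: multi_below_def)
  qed
  have fin: "finite ?E" using sub finite_multi_below by (rule finite_subset)
  have "mmonom g (y + s *\<^sub>R z) = poly_below m (\<lambda>h. if h \<in> ?E then ?c h else 0) z" for z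
  proof -
    have "mmonom g (y + s *\<^sub>R z) = (\<Prod>i\<in>UNIV. \<Sum>j\<le>g i. of_nat (g i choose j) * (s * z $ i) ^ j * (y $ i) ^ (g i - j))"
      unfolding mmonom_def by (intro prod.cong refl) (simp add: binomial_ring add.commute[of "y $ _"])
    also have "\<dots> = (\<Sum>h\<in>?E. \<Prod>i\<in>UNIV. of_nat (g i choose h i) * (s * z $ i) ^ h i * (y $ i) ^ (g i - h i))"
      by (rule prod_sum_PiE) auto
    also have "\<dots> = (\<Sum>h\<in>?E. ?c h * mmonom h z)"
      unfolding mmonom_def by (intro sum.cong refl) (simp add: prod.distrib power_mult_distrib mult_ac)
    also have "\<dots> = (\<Sum>h\<in>multi_below m. if h \<in> ?E then ?c h * mmonom h z else 0)"
      using sub by (simp add: sum.inter_restrict[symmetric] Int_absorb1 del: PiE_UNIV_domain)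
    also have "\<dots> = poly_below m (\<lambda>h. if h \<in> ?E then ?c h else 0) z"
      unfolding poly_below_def by (intro sum.cong refl) simp
    finally show ?thesis .
  qed
  then show ?thesis by blast
qed

lemma poly_below_affine_ex: "\<exists>c. \<forall>z. poly_below m a (y + s *\<^sub>R z) = poly_below m c z"
proof -
  obtain c where c: "\<And>g z. g \<in> multi_below m \<Longrightarrow> mmonom g (y + s *\<^sub>R z) = poly_below m (c g) z"
    using mmonom_affine_ex[of _ m y s] by metis
  have "poly_below m a (y + s *\<^sub>R z) = poly_below m (\<lambda>h. \<Sum>g\<in>multi_below m. a g * c g h) z" for z
  proof -
    have "poly_below m a (y + s *\<^sub>R z) = (\<Sum>g\<in>multi_below m. a g * poly_below m (c g) z)"
      using c by (simp add: poly_below_def[of m a])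
    also have "\<dots> = (\<Sum>g\<in>multi_below m. \<Sum>h\<in>multi_below m. a g * c g h * mmonom h z)"
      by (simp add: poly_below_def sum_distrib_left mult_ac)
    also have "\<dots> = (\<Sum>h\<in>multi_below m. \<Sum>g\<in>multi_below m. a g * c g h * mmonom h z)"
      by (rule sum.swap)
    finally show ?thesis by (simp add: poly_below_def sum_distrib_right)
  qed
  then show ?thesis by blast
qed

lemma polys_below_affine:
  assumes "P \<in> polys_below m"
  shows "(\<lambda>z. P (y + s *\<^sub>R z)) \<in> polys_below m"
proof -
  obtain a where "P = poly_below m a" using assms by (auto simp: polys_below_eq)
  with poly_below_affine_ex[of m a y s] show ?thesis
    unfolding polys_below_eq by (auto simp: fun_eq_iff)
qed

text \<open>The inverse of a Vandermonde matrix: \<open>\<kappa> a j\<close> is the coefficient of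
  degree \<open>a\<close> of the Lagrange basis polynomial that equals 1 at
  \<open>t j\<close>.\<close>

lemma lagrange_coefficients_ex:
  fixes t :: "nat \<Rightarrow> real"
  assumes "inj_on t {..<m}"
  shows "\<exists>\<kappa>. \<forall>a<m. \<forall>b<m. (\<Sum>j<m. \<kappa> a j * t j ^ b) = (if a = b then 1 else 0)"
proof -
  define L where "L j = (\<Prod>i\<in>{..<m} - {j}. smult (1 / (t j - t i)) [:- t i, 1:])" for j
  have L: "poly (L j) (t i) = (if i = j then 1 else 0)" if "i < m" "j < m" for i j
  proof (cases "i = j")
    case True
    have "poly (L j) (t j) = (\<Prod>i\<in>{..<m} - {j}. 1)"
      unfolding L_def poly_prod using assms that
      by (intro prod.cong) (auto simp: inj_on_def diff_divide_distrib[symmetric])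
    with True show ?thesis by simp
  next
    case False
    then have "poly (L j) (t i) = 0"
      unfolding L_def poly_prod using that by (intro prod_zero) auto
    with False show ?thesis by simp
  qed
  have deg: "degree (L j) < m" if "j < m" for j
  proof -
    have "degree (L j) \<le> (\<Sum>i\<in>{..<m} - {j}. degree (smult (1 / (t j - t i)) [:- t i, 1:]))"
      unfolding L_def using degree_prod_sum_le[of "{..<m} - {j}" "\<lambda>i. smult (1 / (t j - t i)) [:- t i, 1:]"]
      by (simp add: o_def)
    also have "\<dots> \<le> (\<Sum>i\<in>{..<m} - {j}. 1)"
      by (intro sum_mono) simp
    also have "\<dots> < m" using that by simp
    finally show ?thesis .
  qed
  have "(\<Sum>j<m. coeff (L j) a * t j ^ b) = (if a = b then 1 else 0)" if "a < m" "b < m" for a b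
  proof -
    let ?q = "\<Sum>j<m. smult (t j ^ b) (L j)"
    \<comment> \<open>Interpolation at \<open>m\<close> nodes reproduces the monomial because
      \<open>b < m\<close>; the claim is the comparison of the coefficients of degree
      \<open>a\<close>.\<close>
    have "?q = monom 1 b"
    proof (rule poly_eqI_degree[of "t ` {..<m}"])
      fix x assume "x \<in> t ` {..<m}"
      then obtain i where i: "i < m" "x = t i" by auto
      have "poly ?q x = (\<Sum>j<m. t j ^ b * (if i = j then 1 else 0))"
        unfolding poly_sum i(2) using i by (intro sum.cong) (auto simp: L)
      then show "poly ?q x = poly (monom 1 b) x"
        using i by (simp add: poly_monom if_distrib cong: if_cong)
    next
      have "degree ?q < m"
        using that deg by (intro degree_sum_less) (auto intro: le_less_trans[OF degree_smult_le])
      then show "degree ?q < card (t ` {..<m})"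
        using assms by (simp add: card_image)
      show "degree (monom (1::real) b) < card (t ` {..<m})"
        using assms that by (simp add: card_image degree_monom_eq)
    qed
    then have "coeff ?q a = coeff (monom 1 b) a" by simp
    then show ?thesis by (auto simp: coeff_sum mult.commute)
  qed
  then show ?thesis by (intro exI[of _ "\<lambda>a j. coeff (L j) a"]) simp
qed

lemma interval_moment:
  fixes t :: real
  assumes "0 \<le> t"
  shows "integrable lborel (\<lambda>s. indicator {0..t} s * s ^ b)"
    and "(\<integral>s. indicator {0..t} s * s ^ b \<partial>lborel) = t ^ Suc b / Suc b"
proof -
  have "integrable lborel (\<lambda>s. s ^ b * indicator {0..t} s :: real)"
    by (rule borel_integrable_atLeastAtMost) auto
  then show "integrable lborel (\<lambda>s. indicator {0..t} s * s ^ b)"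
    by (simp add: mult.commute)
  show "(\<integral>s. indicator {0..t} s * s ^ b \<partial>lborel) = t ^ Suc b / Suc b"
    using integral_power[OF assms, of b] by (simp add: mult.commute)
qed

text \<open>Combinations of indicators of the intervals \<open>{0..t j}\<close> are bounded with
  support in the unit interval, and their moments \<open>t j ^ Suc b / Suc b\<close> reduce duality
  to the monomials to a Vandermonde system.\<close>

lemma moment_kernel_1d_ex:
  "\<exists>\<psi> K. (\<forall>a. \<psi> a \<in> borel_measurable borel) \<and> 0 \<le> K \<and>
     (\<forall>a s. \<bar>\<psi> a s\<bar> \<le> K * indicator {0..1} (s::real)) \<and>
     (\<forall>a<m. \<forall>b<m. integrable lborel (\<lambda>s. \<psi> a s * s ^ b) \<and>
        (\<integral>s. \<psi> a s * s ^ b \<partial>lborel) = (if a = b then 1 else (0::real)))"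
proof -
  \<comment> \<open>Distinct nodes, positive so that one may divide by them, and at most 1 for
    \<open>j < m\<close>.\<close>
  define t where "t j = real (Suc j) / real (Suc m)" for j
  have "inj_on t {..<m}" by (auto simp: inj_on_def t_def)
  from lagrange_coefficients_ex[OF this] obtain \<kappa>
    where \<kappa>: "\<And>a b. a < m \<Longrightarrow> b < m \<Longrightarrow> (\<Sum>j<m. \<kappa> a j * t j ^ b) = (if a = b then 1 else 0)"
    by blast
  have t: "0 < t j" "j < m \<Longrightarrow> t j \<le> 1" for j by (auto simp: t_def)
  \<comment> \<open>The factor \<open>Suc a / t j\<close> undoes the moment formula, leaving
    \<open>Suc a / Suc b\<close> times a Kronecker delta. The value 0 for \<open>a \<ge> m\<close>
    lets one \<open>K\<close> bound the kernels for all \<open>a\<close>.\<close>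
  define l where "l a j = (if a < m then \<kappa> a j * real (Suc a) / t j else 0)" for a j
  define \<psi> where "\<psi> a s = (\<Sum>j<m. l a j * indicator {0..t j} s)" for a and s :: real
  define K where "K = (\<Sum>a<m. \<Sum>j<m. \<bar>l a j\<bar>)"
  have "K \<ge> 0" by (simp add: K_def sum_nonneg)
  have bound: "\<bar>\<psi> a s\<bar> \<le> K * indicator {0..1} s" for a s
  proof (cases "s \<in> {0..1}")
    case False
    then have "\<psi> a s = 0"
      unfolding \<psi>_def using t by (intro sum.neutral ballI) (fastforce simp: indicator_def)
    with False show ?thesis by simp
  next
    case True
    have "\<bar>\<psi> a s\<bar> \<le> (\<Sum>j<m. \<bar>l a j\<bar>)"
      unfolding \<psi>_def by (intro order_trans[OF sum_abs] sum_mono) (auto simp: indicator_def)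
    also have "\<dots> \<le> K"
    proof (cases "a < m")
      case True
      then show ?thesis unfolding K_def
        by (intro member_le_sum[of a "{..<m}" "\<lambda>a. \<Sum>j<m. \<bar>l a j\<bar>"]) (auto intro: sum_nonneg)
    next
      case False
      with \<open>K \<ge> 0\<close> show ?thesis by (simp add: l_def)
    qed
    finally show ?thesis using True by simp
  qed
  have expand: "\<psi> a s * s ^ b = (\<Sum>j<m. l a j * (indicator {0..t j} s * s ^ b))" for a b s
    unfolding \<psi>_def sum_distrib_right by (simp only: mult.assoc)
  have "integrable lborel (\<lambda>s. \<psi> a s * s ^ b)" for a b
    unfolding expand using t by (intro Bochner_Integration.integrable_sum integrable_mult_right interval_moment) (auto intro: less_imp_le)
  moreover have "(\<integral>s. \<psi> a s * s ^ b \<partial>lborel) = (if a = b then 1 else 0)" if "a < m" "b < m" for a b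
  proof -
    have "(\<integral>s. \<psi> a s * s ^ b \<partial>lborel) = (\<Sum>j<m. l a j * (t j ^ Suc b / Suc b))"
      unfolding expand using t
      by (subst Bochner_Integration.integral_sum)
        (auto simp del: power_Suc simp: interval_moment less_imp_le intro!: sum.cong integrable_mult_right)
    also have "\<dots> = (\<Sum>j<m. real (Suc a) / real (Suc b) * (\<kappa> a j * t j ^ b))"
      using that less_imp_neq[OF t(1)] by (intro sum.cong) (auto simp: l_def simp del: of_nat_Suc)
    also have "\<dots> = real (Suc a) / real (Suc b) * (if a = b then 1 else 0)"
      by (simp only: sum_distrib_left[symmetric] \<kappa>[OF that])
    finally show ?thesis by auto
  qed
  moreover have "\<psi> a \<in> borel_measurable borel" for a
    unfolding \<psi>_def[abs_def] by measurable
  ultimately show ?thesis using bound \<open>K \<ge> 0\<close> by blast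
qed

text \<open>\<open>lborel\<close> is available as a product over \<open>Basis\<close>, not over the
  index type. The work lies in the translation between an index \<open>i\<close> and the vector
  \<open>axis i 1\<close>, which \<open>ix\<close> inverts.\<close>

lemma lborel_cart_prod:
  fixes f :: "'n::finite \<Rightarrow> real \<Rightarrow> real"
  assumes f: "\<And>i. integrable lborel (f i)"
  shows "(\<integral>z. (\<Prod>i\<in>UNIV. f i (z $ i)) \<partial>(lborel :: (real^'n) measure)) = (\<Prod>i\<in>UNIV. \<integral>s. f i s \<partial>lborel)"
proof -
  interpret product_sigma_finite "\<lambda>_ :: real^'n. lborel :: real measure" ..
  have B: "(Basis :: (real^'n) set) = range (\<lambda>i. axis i 1)"
    by (auto simp: Basis_vec_def)
  define ix where "ix b = (THE i. b = axis i (1::real))" for b :: "real^'n"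
  have ix[simp]: "ix (axis i 1) = i" for i
    unfolding ix_def by (rule the_equality) (auto simp: axis_eq_axis)
  have prod_eq: "(\<Prod>b\<in>Basis. h b) = (\<Prod>i\<in>UNIV. h (axis i 1))" for h :: "real^'n \<Rightarrow> real"
    unfolding B by (subst prod.reindex) (auto simp: inj_on_def axis_eq_axis)
  have [measurable]: "f i \<in> borel_measurable borel" for i
    using f[of i] by (auto dest: borel_measurable_integrable)
  have "(\<integral>z. (\<Prod>i\<in>UNIV. f i (z $ i)) \<partial>(lborel :: (real^'n) measure))
      = (\<integral>z. (\<Prod>b\<in>Basis. f (ix b) (z \<bullet> b)) \<partial>(lborel :: (real^'n) measure))"
    by (simp add: prod_eq inner_axis)
  also have "\<dots> = (\<integral>g. (\<Prod>b\<in>Basis. f (ix b) ((\<Sum>c\<in>Basis. g c *\<^sub>R c) \<bullet> b)) \<partial>(\<Pi>\<^sub>M b\<in>(Basis :: (real^'n) set). lborel))"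
    by (subst lborel_eq) (rule integral_distr, auto)
  also have "\<dots> = (\<integral>g. (\<Prod>b\<in>Basis. f (ix b) (g b)) \<partial>(\<Pi>\<^sub>M b\<in>(Basis :: (real^'n) set). lborel))"
    by (intro Bochner_Integration.integral_cong prod.cong refl) simp
  also have "\<dots> = (\<Prod>b\<in>(Basis :: (real^'n) set). \<integral>s. f (ix b) s \<partial>lborel)"
    by (rule product_integral_prod) (auto intro: f)
  finally show ?thesis by (simp add: prod_eq)
qed

text \<open>Tensor products of the one-dimensional kernels. All entries of a multi-index in
  \<open>multi_below m\<close> are below \<open>m\<close>, so duality holds in each coordinate and
  the integral factorises.\<close>

lemma coefficient_kernel_ex:
  "\<exists>\<Phi> C. (\<forall>b. \<Phi> b \<in> borel_measurable borel) \<and> 0 \<le> C \<and>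
     (\<forall>b z. \<bar>\<Phi> b z\<bar> \<le> C * indicator (cube 0 1) (z :: real^'n)) \<and>
     (\<forall>a. \<forall>b\<in>multi_below m. (\<integral>z. \<Phi> b z * poly_below m a z \<partial>lborel) = a b)"
proof -
  obtain \<psi> K where [measurable]: "\<And>a. \<psi> a \<in> borel_measurable borel" and K: "0 \<le> K"
    and bound: "\<And>a s. \<bar>\<psi> a s\<bar> \<le> K * indicator {0..1} (s::real)"
    and int: "\<And>a b. a < m \<Longrightarrow> b < m \<Longrightarrow> integrable lborel (\<lambda>s. \<psi> a s * s ^ b)"
    and val: "\<And>a b. a < m \<Longrightarrow> b < m \<Longrightarrow> (\<integral>s. \<psi> a s * s ^ b \<partial>lborel) = (if a = b then 1 else (0::real))"
    using moment_kernel_1d_ex[of m] by blast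
  define \<Phi> where "\<Phi> b z = (\<Prod>i\<in>UNIV. \<psi> (b i) (z $ i))" for b :: "'n \<Rightarrow> nat" and z
  have [measurable]: "\<Phi> b \<in> borel_measurable borel" for b
    unfolding \<Phi>_def[abs_def] by measurable
  have bnd: "\<bar>\<Phi> b z\<bar> \<le> K ^ CARD('n) * indicator (cube 0 1) z" for b z
  proof -
    have "\<bar>\<Phi> b z\<bar> \<le> (\<Prod>i\<in>UNIV. K * indicator {0..1} (z $ i))"
      unfolding \<Phi>_def abs_prod using bound by (intro prod_mono) auto
    also have "\<dots> = K ^ CARD('n) * (\<Prod>i\<in>UNIV. indicator {0..1} (z $ i))"
      by (simp add: prod.distrib)
    also have "(\<Prod>i\<in>UNIV. indicator {0..1} (z $ i) :: real) \<le> indicator (cube 0 1) z"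
    proof (cases "z \<in> cube 0 1")
      case False
      then obtain i where "\<not> \<bar>z $ i\<bar> \<le> 1" by (auto simp: cube_iff)
      then have "indicator {0..1} (z $ i) = (0::real)" by (auto simp: indicator_def)
      then have "(\<Prod>i\<in>UNIV. indicator {0..1} (z $ i) :: real) = 0" by (intro prod_zero) auto
      then show ?thesis by (simp only: indicator_pos_le)
    qed (auto intro!: prod_le_1)
    finally show ?thesis using K by (simp add: mult_left_mono)
  qed
  have mon: "(\<integral>z. \<Phi> b z * mmonom g z \<partial>lborel) = (if b = g then 1 else 0)"
    if "b \<in> multi_below m" "g \<in> multi_below m" for b g
  proof -
    note less = multi_below_entry_less[OF that(1)] multi_below_entry_less[OF that(2)]
    have "(\<integral>z. \<Phi> b z * mmonom g z \<partial>lborel) = (\<integral>z. (\<Prod>i\<in>UNIV. \<psi> (b i) (z $ i) * (z $ i) ^ g i) \<partial>lborel)"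
      by (simp add: \<Phi>_def mmonom_def prod.distrib)
    also have "\<dots> = (\<Prod>i\<in>UNIV. \<integral>s. \<psi> (b i) s * s ^ g i \<partial>lborel)"
      by (rule lborel_cart_prod) (intro int less)
    also have "\<dots> = (\<Prod>i\<in>UNIV. if b i = g i then 1 else 0)"
      by (simp add: val less)
    also have "\<dots> = (if b = g then 1 else 0)"
      by (auto simp: fun_eq_iff)
    finally show ?thesis .
  qed
  have meas_mon[measurable]: "mmonom g \<in> borel_measurable borel" for g :: "'n \<Rightarrow> nat"
    unfolding mmonom_def[abs_def] by measurable
  have cube: "cube (0 :: real^'n) 1 \<in> sets borel" "emeasure lborel (cube (0 :: real^'n) 1) < \<infinity>"
  proof -
    have "cube (0 :: real^'n) 1 = cbox (-1) 1"
      by (auto simp: cube_iff mem_box_cart abs_le_iff minus_le_iff)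
    then show "cube (0 :: real^'n) 1 \<in> sets borel" "emeasure lborel (cube (0 :: real^'n) 1) < \<infinity>"
      using emeasure_lborel_cbox_finite[of "-1 :: real^'n" 1] by auto
  qed
  have intg: "integrable lborel (\<lambda>z. \<Phi> b z * mmonom g z)" for b g
  proof (rule Bochner_Integration.integrable_bound)
    show "integrable lborel (\<lambda>z. K ^ CARD('n) * indicator (cube 0 1) (z :: real^'n))"
      using cube by (intro integrable_mult_right integrable_real_indicator) auto
    show "AE z in lborel. norm (\<Phi> b z * mmonom g z) \<le> norm (K ^ CARD('n) * indicator (cube 0 1) z)"
    proof (rule AE_I2)
      fix z
      show "norm (\<Phi> b z * mmonom g z) \<le> norm (K ^ CARD('n) * indicator (cube 0 1) z)"
      proof (cases "z \<in> cube 0 1")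
        case True
        then have "\<bar>\<Phi> b z\<bar> * \<bar>mmonom g z\<bar> \<le> K ^ CARD('n) * 1"
          using bnd[of b z] abs_mmonom_le[of z 1 g] K by (intro mult_mono) auto
        with True K show ?thesis by (simp add: abs_mult)
      qed (use bnd[of b z] in auto)
    qed
  qed measurable
  have "(\<integral>z. \<Phi> b z * poly_below m a z \<partial>lborel) = a b" if b: "b \<in> multi_below m" for a b
  proof -
    have "(\<integral>z. \<Phi> b z * poly_below m a z \<partial>lborel) = (\<integral>z. (\<Sum>g\<in>multi_below m. a g * (\<Phi> b z * mmonom g z)) \<partial>lborel)"
      by (simp add: poly_below_def sum_distrib_left mult_ac)
    also have "\<dots> = (\<Sum>g\<in>multi_below m. a g * (\<integral>z. \<Phi> b z * mmonom g z \<partial>lborel))"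
      by (subst Bochner_Integration.integral_sum) (auto intro: intg)
    also have "\<dots> = (\<Sum>g\<in>multi_below m. if b = g then a g else 0)"
      using b by (intro sum.cong refl) (simp add: mon)
    also have "\<dots> = a b" using b by simp
    finally show ?thesis .
  qed
  then show ?thesis
    using K bnd by (intro exI[of _ \<Phi>] exI[of _ "K ^ CARD('n)"]) auto
qed

subsection \<open>Local projection onto polynomials\<close>

lemma cube_eq_cbox: "cube x r = cbox (x - (\<chi> i. r)) (x + (\<chi> i. r))"
  by (auto simp: cube_iff mem_box_cart abs_le_iff algebra_simps)

lemma compact_cube [simp]: "compact (cube x r)"
  by (simp add: cube_eq_cbox)

lemma cube_borel [measurable, simp]: "cube x r \<in> sets borel"
  by (simp add: cube_eq_cbox)

lemma emeasure_cube:
  assumes "0 \<le> r"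
  shows "emeasure lborel (cube (x::real^'n) r) = ennreal ((2 * r) ^ CARD('n))"
proof -
  have "(\<Prod>b\<in>Basis. ((x + (\<chi> i. r)) - (x - (\<chi> i. r))) \<bullet> b) = (\<Prod>b\<in>(Basis::(real^'n) set). 2 * r)"
    by (intro prod.cong refl) (auto simp: Basis_vec_def inner_axis inner_add_left)
  moreover have "(x - (\<chi> i. r)) \<bullet> b \<le> (x + (\<chi> i. r)) \<bullet> b" if "b \<in> Basis" for b
    using that assms by (auto simp: Basis_vec_def inner_axis inner_add_left inner_diff_left)
  ultimately show ?thesis
    unfolding cube_eq_cbox by (subst emeasure_lborel_cbox) (auto simp: ennreal_power)
qed

lemma cube_sym: "y \<in> cube x r \<longleftrightarrow> x \<in> cube y r"
  by (simp add: cube_iff abs_minus_commute)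

lemma cube_center [simp]: "x \<in> cube x r \<longleftrightarrow> 0 \<le> r"
  by (simp add: cube_iff)

lemma cube_subset:
  assumes "y \<in> cube x a" "a + s \<le> r"
  shows "cube y s \<subseteq> cube x r"
proof
  fix z assume z: "z \<in> cube y s"
  show "z \<in> cube x r"
    unfolding cube_iff
  proof
    fix i
    have "\<bar>y $ i - x $ i\<bar> \<le> a" "\<bar>z $ i - y $ i\<bar> \<le> s"
      using assms z by (auto simp: cube_iff)
    then show "\<bar>z $ i - x $ i\<bar> \<le> r" using assms(2) by linarith
  qed
qed

lemma cube_mono: "s \<le> r \<Longrightarrow> cube x s \<subseteq> cube x r"
  using order_trans by (fastforce simp: cube_iff)

lemma cube_affine:
  assumes "0 < r"
  shows "y + r *\<^sub>R z \<in> cube y r \<longleftrightarrow> z \<in> cube 0 1"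
  using assms by (simp add: cube_iff abs_mult)

lemma borel_measurable_affine [measurable (raw)]:
  fixes u :: "real^'n \<Rightarrow> 'b::topological_space"
  assumes "u \<in> borel_measurable borel"
  shows "(\<lambda>z. u (y + r *\<^sub>R z)) \<in> borel_measurable borel"
proof -
  have "(\<lambda>z. y + r *\<^sub>R z :: real^'n) \<in> borel_measurable borel" by measurable
  from measurable_compose[OF this assms] show ?thesis .
qed

lemma nn_integral_unit_cube:
  fixes u :: "real^'n \<Rightarrow> ennreal"
  assumes [measurable]: "u \<in> borel_measurable borel" and r: "0 < r"
  shows "(\<integral>\<^sup>+z\<in>cube 0 1. u (y + r *\<^sub>R z) \<partial>lborel) = ennreal (1 / r ^ CARD('n)) * (\<integral>\<^sup>+x\<in>cube y r. u x \<partial>lborel)"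
proof -
  have "(\<integral>\<^sup>+x\<in>cube y r. u x \<partial>lborel)
      = (\<integral>\<^sup>+x. u x * indicator (cube y r) x \<partial>density (distr lborel borel (\<lambda>z. y + r *\<^sub>R z)) (\<lambda>_. ennreal (\<bar>r\<bar> ^ DIM(real^'n))))"
    using lborel_affine[of r y] r by simp
  also have "\<dots> = (\<integral>\<^sup>+z. ennreal (r ^ CARD('n)) * (u (y + r *\<^sub>R z) * indicator (cube y r) (y + r *\<^sub>R z)) \<partial>lborel)"
    using r by (simp add: nn_integral_density nn_integral_distr ennreal_power)
  also have "\<dots> = (\<integral>\<^sup>+z. ennreal (r ^ CARD('n)) * (u (y + r *\<^sub>R z) * indicator (cube 0 1) z) \<partial>lborel)"
    using r by (simp add: indicator_def cube_affine)
  also have "\<dots> = ennreal (r ^ CARD('n)) * (\<integral>\<^sup>+z\<in>cube 0 1. u (y + r *\<^sub>R z) \<partial>lborel)"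
    by (simp add: nn_integral_cmult)
  finally show ?thesis
    using r by (simp add: mult.assoc[symmetric] ennreal_mult'[symmetric])
qed

text \<open>The Borel counterpart of \<open>L1_loc\<close>: measurability of
  \<open>f (y + r *\<^sub>R z)\<close> jointly in \<open>y\<close> and \<open>z\<close>, on which
  all measurability in \<open>y\<close> rests, is obtained from a Borel \<open>f\<close>.\<close>

definition loc_int :: "(real^'n \<Rightarrow> real) \<Rightarrow> bool" where
  "loc_int f \<longleftrightarrow> f \<in> borel_measurable borel \<and> (\<forall>y r. 0 < r \<longrightarrow> (\<integral>\<^sup>+x\<in>cube y r. ennreal \<bar>f x\<bar> \<partial>lborel) < \<infinity>)"

text \<open>\<open>2 ^ CARD('n)\<close> times the mean of \<open>\<bar>h\<bar>\<close> over
  \<open>cube y r\<close>, pulled back to the unit cube, where the kernels live.\<close>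

definition cube_L1 :: "(real^'n \<Rightarrow> real) \<Rightarrow> real^'n \<Rightarrow> real \<Rightarrow> ennreal" where
  "cube_L1 h y r = (\<integral>\<^sup>+z\<in>cube 0 1. ennreal \<bar>h (y + r *\<^sub>R z)\<bar> \<partial>lborel)"

lemma loc_intD [measurable_dest]: "loc_int f \<Longrightarrow> f \<in> borel_measurable borel"
  by (simp add: loc_int_def)

lemma cube_L1_eq:
  fixes h :: "real^'n \<Rightarrow> real"
  assumes [measurable]: "h \<in> borel_measurable borel" and "0 < r"
  shows "cube_L1 h y r = ennreal (1 / r ^ CARD('n)) * (\<integral>\<^sup>+x\<in>cube y r. ennreal \<bar>h x\<bar> \<partial>lborel)"
  unfolding cube_L1_def using nn_integral_unit_cube[of "\<lambda>x. ennreal \<bar>h x\<bar>" r y] assms by simp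

lemma cube_L1_average:
  fixes h :: "real^'n \<Rightarrow> real"
  assumes "h \<in> borel_measurable borel" and r: "0 < r"
  shows "cube_L1 h y r = 2 ^ CARD('n) * ((\<integral>\<^sup>+x\<in>cube y r. ennreal \<bar>h x\<bar> \<partial>lborel) / emeasure lborel (cube y r))"
proof -
  have "ennreal (1 / r ^ CARD('n)) = 2 ^ CARD('n) / ennreal ((2 * r) ^ CARD('n))"
  proof -
    have "(2 ^ CARD('n) :: ennreal) = ennreal (2 ^ CARD('n))"
      by (simp add: ennreal_power flip: ennreal_numeral)
    then show ?thesis
      using r by (simp add: power_mult_distrib divide_ennreal)
  qed
  then show ?thesis
    using assms by (simp add: cube_L1_eq emeasure_cube ennreal_times_divide mult.commute ennreal_divide_times)
qed

lemma cube_L1_mono: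
  fixes h :: "real^'n \<Rightarrow> real"
  assumes h: "h \<in> borel_measurable borel" and s: "0 < s" and r: "0 < r" and sub: "cube y s \<subseteq> cube x r"
  shows "cube_L1 h y s \<le> ennreal ((r / s) ^ CARD('n)) * cube_L1 h x r"
proof -
  have "(\<integral>\<^sup>+z\<in>cube y s. ennreal \<bar>h z\<bar> \<partial>lborel) \<le> (\<integral>\<^sup>+z\<in>cube x r. ennreal \<bar>h z\<bar> \<partial>lborel)"
    using sub by (intro nn_integral_mono) (auto simp: indicator_def)
  then have "cube_L1 h y s \<le> ennreal (1 / s ^ CARD('n)) * (\<integral>\<^sup>+z\<in>cube x r. ennreal \<bar>h z\<bar> \<partial>lborel)"
    by (simp add: cube_L1_eq h s mult_left_mono)
  also have "ennreal (1 / s ^ CARD('n)) = ennreal ((r / s) ^ CARD('n)) * ennreal (1 / r ^ CARD('n))"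
    using s r by (simp add: ennreal_mult'[symmetric] power_divide)
  finally show ?thesis by (simp add: cube_L1_eq h r mult.assoc)
qed

lemma cube_L1_finite: "loc_int f \<Longrightarrow> 0 < r \<Longrightarrow> cube_L1 f y r < \<infinity>"
  by (simp add: cube_L1_eq ennreal_mult_less_top loc_int_def)

lemma loc_int_bounded:
  assumes [measurable]: "f \<in> borel_measurable borel"
    and b: "\<And>y r. 0 < r \<Longrightarrow> \<exists>B. \<forall>x\<in>cube y r. \<bar>f x\<bar> \<le> B"
  shows "loc_int f"
  unfolding loc_int_def
proof (intro conjI allI impI)
  fix y :: "real^'a" and r :: real assume r: "0 < r"
  obtain B where B: "\<And>x. x \<in> cube y r \<Longrightarrow> \<bar>f x\<bar> \<le> B" using b[OF r] by blast
  have "(\<integral>\<^sup>+x\<in>cube y r. ennreal \<bar>f x\<bar> \<partial>lborel) \<le> (\<integral>\<^sup>+x\<in>cube y r. ennreal B \<partial>lborel)"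
    using B by (intro nn_integral_mono) (auto simp: indicator_def intro: ennreal_leI)
  also have "\<dots> < \<infinity>"
    using r by (simp add: nn_integral_cmult_indicator emeasure_cube ennreal_mult_less_top)
  finally show "(\<integral>\<^sup>+x\<in>cube y r. ennreal \<bar>f x\<bar> \<partial>lborel) < \<infinity>" .
qed (rule assms)

lemma borel_measurable_poly_below [measurable]: "poly_below m a \<in> borel_measurable borel"
  unfolding poly_below_def[abs_def] mmonom_def by measurable

lemma continuous_on_poly_below: "continuous_on A (poly_below m a)"
  unfolding poly_below_def[abs_def] mmonom_def by (intro continuous_intros)

lemma loc_int_poly:
  assumes "P \<in> polys_below m"
  shows "loc_int P"
proof (rule loc_int_bounded)
  obtain a where P: "P = poly_below m a" using assms by (auto simp: polys_below_eq)
  then show "P \<in> borel_measurable borel" by simp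
  fix y :: "real^'a" and r :: real
  have "compact (P ` cube y r)"
    unfolding P by (intro compact_continuous_image continuous_on_poly_below) simp
  then have "bounded (P ` cube y r)" by (rule compact_imp_bounded)
  then show "\<exists>B. \<forall>x\<in>cube y r. \<bar>P x\<bar> \<le> B" by (auto simp: bounded_iff)
qed

lemma loc_int_diff:
  assumes f: "loc_int f" and g: "loc_int g"
  shows "loc_int (\<lambda>x. f x - g x)"
  unfolding loc_int_def
proof (intro conjI allI impI)
  note [measurable] = loc_intD[OF f] loc_intD[OF g]
  show "(\<lambda>x. f x - g x) \<in> borel_measurable borel" by measurable
  fix y :: "real^'a" and r :: real assume r: "0 < r"
  have "(\<integral>\<^sup>+x\<in>cube y r. ennreal \<bar>f x - g x\<bar> \<partial>lborel)
     \<le> (\<integral>\<^sup>+x. ennreal \<bar>f x\<bar> * indicator (cube y r) x + ennreal \<bar>g x\<bar> * indicator (cube y r) x \<partial>lborel)"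
    by (intro nn_integral_mono) (auto simp: indicator_def simp flip: ennreal_plus intro!: ennreal_leI)
  also have "\<dots> = (\<integral>\<^sup>+x\<in>cube y r. ennreal \<bar>f x\<bar> \<partial>lborel) + (\<integral>\<^sup>+x\<in>cube y r. ennreal \<bar>g x\<bar> \<partial>lborel)"
    by (subst nn_integral_add) auto
  also have "\<dots> < \<infinity>" using f g r by (simp add: loc_int_def)
  finally show "(\<integral>\<^sup>+x\<in>cube y r. ennreal \<bar>f x - g x\<bar> \<partial>lborel) < \<infinity>" .
qed

section \<open>The projection and its oscillation\<close>

locale coefficient_kernel =
  fixes m :: nat and \<Phi> :: "('n::finite \<Rightarrow> nat) \<Rightarrow> real^'n \<Rightarrow> real" and K :: real
  assumes kernel_measurable [measurable]: "\<Phi> b \<in> borel_measurable borel"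
    and K_nonneg: "0 \<le> K"
    and kernel_bound: "\<bar>\<Phi> b z\<bar> \<le> K * indicator (cube 0 1) z"
    and kernel_poly: "b \<in> multi_below m \<Longrightarrow> (\<integral>z. \<Phi> b z * poly_below m a z \<partial>lborel) = a b"
begin

text \<open>The coefficients refer to the rescaled variable \<open>(x - y) / r\<close>. Shrinking
  the cube about its centre therefore multiplies those of a fixed polynomial by a power of the ratio
  of the radii, the source of all geometric decay below.\<close>

definition coef :: "(real^'n \<Rightarrow> real) \<Rightarrow> real^'n \<Rightarrow> real \<Rightarrow> ('n \<Rightarrow> nat) \<Rightarrow> real" where
  "coef f y r b = (\<integral>z. \<Phi> b z * f (y + r *\<^sub>R z) \<partial>lborel)"

definition proj :: "(real^'n \<Rightarrow> real) \<Rightarrow> real^'n \<Rightarrow> real \<Rightarrow> real^'n \<Rightarrow> real" where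
  "proj f y r x = poly_below m (coef f y r) ((1 / r) *\<^sub>R (x - y))"

definition osc :: "(real^'n \<Rightarrow> real) \<Rightarrow> real^'n \<Rightarrow> real \<Rightarrow> ennreal" where
  "osc f y r = cube_L1 (\<lambda>x. f x - proj f y r x) y r"

text \<open>Bounds the identity minus the projection in \<open>cube_L1\<close>: each coefficient is
  at most \<open>K\<close> times \<open>cube_L1\<close>, and the constant bound for the polynomial
  is integrated over the unit cube, of volume \<open>2 ^ CARD('n)\<close>.\<close>

definition C0 :: real where
  "C0 = 1 + card (multi_below m :: ('n \<Rightarrow> nat) set) * K * 2 ^ CARD('n)"

lemma C0_ge_1: "1 \<le> C0"
  using K_nonneg by (simp add: C0_def)

lemma ennreal_kernel_bound: "ennreal \<bar>\<Phi> b z * t\<bar> \<le> ennreal K * (ennreal \<bar>t\<bar> * indicator (cube 0 1) z)"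
proof -
  have "\<bar>\<Phi> b z * t\<bar> \<le> (K * indicator (cube 0 1) z) * \<bar>t\<bar>"
    unfolding abs_mult by (intro mult_right_mono kernel_bound) auto
  then have "ennreal \<bar>\<Phi> b z * t\<bar> \<le> ennreal ((K * indicator (cube 0 1) z) * \<bar>t\<bar>)"
    by (rule ennreal_leI)
  also have "\<dots> = ennreal K * (ennreal \<bar>t\<bar> * indicator (cube 0 1) z)"
    using K_nonneg by (auto simp: indicator_def ennreal_mult')
  finally show ?thesis .
qed

lemma nn_kernel_le:
  assumes [measurable]: "h \<in> borel_measurable borel"
  shows "(\<integral>\<^sup>+z. ennreal \<bar>\<Phi> b z * h (y + r *\<^sub>R z)\<bar> \<partial>lborel) \<le> ennreal K * cube_L1 h y r"
proof -
  have "(\<integral>\<^sup>+z. ennreal \<bar>\<Phi> b z * h (y + r *\<^sub>R z)\<bar> \<partial>lborel)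
      \<le> (\<integral>\<^sup>+z. ennreal K * (ennreal \<bar>h (y + r *\<^sub>R z)\<bar> * indicator (cube 0 1) z) \<partial>lborel)"
    by (intro nn_integral_mono ennreal_kernel_bound)
  also have "\<dots> = ennreal K * cube_L1 h y r"
    unfolding cube_L1_def by (subst nn_integral_cmult) auto
  finally show ?thesis .
qed

lemma kernel_integrable:
  assumes f: "loc_int f" and r: "0 < r"
  shows "integrable lborel (\<lambda>z. \<Phi> b z * f (y + r *\<^sub>R z))"
proof (rule integrableI_bounded)
  note [measurable] = loc_intD[OF f]
  show "(\<lambda>z. \<Phi> b z * f (y + r *\<^sub>R z)) \<in> borel_measurable lborel" by measurable
  have "(\<integral>\<^sup>+z. ennreal (norm (\<Phi> b z * f (y + r *\<^sub>R z))) \<partial>lborel) \<le> ennreal K * cube_L1 f y r"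
    using nn_kernel_le[of f] by simp
  also have "\<dots> < \<infinity>"
    using cube_L1_finite[OF f r] by (simp add: ennreal_mult_less_top)
  finally show "(\<integral>\<^sup>+z. ennreal (norm (\<Phi> b z * f (y + r *\<^sub>R z))) \<partial>lborel) < \<infinity>" .
qed

lemma coef_le:
  assumes f: "loc_int f" and r: "0 < r"
  shows "ennreal \<bar>coef f y r b\<bar> \<le> ennreal K * cube_L1 f y r"
proof -
  have "ennreal \<bar>coef f y r b\<bar> \<le> (\<integral>\<^sup>+z. ennreal \<bar>\<Phi> b z * f (y + r *\<^sub>R z)\<bar> \<partial>lborel)"
    unfolding coef_def using integral_norm_bound_ennreal[OF kernel_integrable[OF f r]] by simp
  then show ?thesis using nn_kernel_le[OF loc_intD[OF f]] by (rule order_trans)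
qed

lemma coef_diff:
  assumes "loc_int f" "loc_int g" "0 < r"
  shows "coef (\<lambda>x. f x - g x) y r b = coef f y r b - coef g y r b"
  unfolding coef_def right_diff_distrib
  by (intro Bochner_Integration.integral_diff kernel_integrable assms)

lemma coef_poly:
  assumes "\<And>z. P (y + r *\<^sub>R z) = poly_below m a z" "b \<in> multi_below m"
  shows "coef P y r b = a b"
  unfolding coef_def assms(1) by (rule kernel_poly) fact

lemma proj_affine: "r \<noteq> 0 \<Longrightarrow> proj f y r (y + r *\<^sub>R z) = poly_below m (coef f y r) z"
  by (simp add: proj_def)

lemma proj_in_polys: "proj f y r \<in> polys_below m"
proof -
  have "poly_below m (coef f y r) \<in> polys_below m" by (simp add: polys_below_eq)
  from polys_below_affine[OF this, of "- (1 / r) *\<^sub>R y" "1 / r"]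
  show ?thesis by (simp add: proj_def[abs_def] algebra_simps)
qed

lemma proj_reproduces:
  assumes "P \<in> polys_below m" "0 < r"
  shows "proj P y r = P"
proof
  fix x
  have "(\<lambda>z. P (y + r *\<^sub>R z)) \<in> polys_below m" using assms by (intro polys_below_affine)
  then obtain a where a: "\<And>z. P (y + r *\<^sub>R z) = poly_below m a z"
    unfolding polys_below_eq by (metis imageE)
  have "proj P y r x = poly_below m a ((1 / r) *\<^sub>R (x - y))"
    unfolding proj_def poly_below_def using coef_poly[of P y r a, OF a] by simp
  also have "\<dots> = P x" using assms by (simp flip: a)
  finally show "proj P y r x = P x" .
qed

lemma loc_int_proj: "loc_int (proj f y r)"
  by (rule loc_int_poly[OF proj_in_polys])

lemma abs_poly_below_le: "z \<in> cube 0 1 \<Longrightarrow> \<bar>poly_below m a z\<bar> \<le> (\<Sum>b\<in>multi_below m. \<bar>a b\<bar>)"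
  unfolding poly_below_def using abs_mmonom_le[of z 1]
  by (intro order_trans[OF sum_abs] sum_mono) (simp add: abs_mult mult_left_le)

lemma proj_diff:
  assumes "loc_int f" "loc_int g" "0 < r"
  shows "proj (\<lambda>x. f x - g x) y r x = proj f y r x - proj g y r x"
  unfolding proj_def poly_below_def using coef_diff[OF assms]
  by (simp add: left_diff_distrib sum_subtractf)

text \<open>The projection is linear and reproduces \<open>P\<close>, so \<open>f\<close> may be
  replaced by \<open>f - P\<close>; what remains is boundedness of the projection.\<close>

lemma osc_le:
  assumes f: "loc_int f" and P: "P \<in> polys_below m" and r: "0 < r"
  shows "osc f y r \<le> ennreal C0 * cube_L1 (\<lambda>x. f x - P x) y r"
proof -
  let ?h = "\<lambda>x. f x - P x"
  let ?M = "multi_below m :: ('n \<Rightarrow> nat) set"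
  have h: "loc_int ?h" using f loc_int_poly[OF P] by (rule loc_int_diff)
  note [measurable] = loc_intD[OF h]
  have "f x - proj f y r x = ?h x - proj ?h y r x" for x
    using proj_diff[OF f loc_int_poly[OF P] r] proj_reproduces[OF P r] by simp
  from this[of "y + r *\<^sub>R _"] have eq: "f (y + r *\<^sub>R z) - poly_below m (coef f y r) z
      = ?h (y + r *\<^sub>R z) - poly_below m (coef ?h y r) z" for z
    using r by (simp only: proj_affine less_imp_neq[OF r, symmetric] not_False_eq_True)
  have "osc f y r = (\<integral>\<^sup>+z\<in>cube 0 1. ennreal \<bar>?h (y + r *\<^sub>R z) - poly_below m (coef ?h y r) z\<bar> \<partial>lborel)"
    unfolding osc_def cube_L1_def using r by (simp add: proj_affine eq)
  also have "\<dots> \<le> (\<integral>\<^sup>+z. ennreal \<bar>?h (y + r *\<^sub>R z)\<bar> * indicator (cube 0 1) z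
      + ennreal (\<Sum>b\<in>?M. \<bar>coef ?h y r b\<bar>) * indicator (cube 0 1) z \<partial>lborel)"
  proof (intro nn_integral_mono)
    fix z
    show "ennreal \<bar>?h (y + r *\<^sub>R z) - poly_below m (coef ?h y r) z\<bar> * indicator (cube 0 1) z
      \<le> ennreal \<bar>?h (y + r *\<^sub>R z)\<bar> * indicator (cube 0 1) z
      + ennreal (\<Sum>b\<in>?M. \<bar>coef ?h y r b\<bar>) * indicator (cube 0 1) z"
    proof (cases "z \<in> cube 0 1")
      case True
      then have "\<bar>?h (y + r *\<^sub>R z) - poly_below m (coef ?h y r) z\<bar> \<le> \<bar>?h (y + r *\<^sub>R z)\<bar> + (\<Sum>b\<in>?M. \<bar>coef ?h y r b\<bar>)"
        using abs_poly_below_le[OF True, of "coef ?h y r"] by linarith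
      from ennreal_leI[OF this] True show ?thesis
        by (simp add: ennreal_plus sum_nonneg del: sum_ennreal)
    qed simp
  qed
  also have "\<dots> = cube_L1 ?h y r + ennreal (\<Sum>b\<in>?M. \<bar>coef ?h y r b\<bar>) * ennreal (2 ^ CARD('n))"
    unfolding cube_L1_def
    by (subst nn_integral_add) (auto simp: nn_integral_cmult_indicator emeasure_cube)
  also have "ennreal (\<Sum>b\<in>?M. \<bar>coef ?h y r b\<bar>) = (\<Sum>b\<in>?M. ennreal \<bar>coef ?h y r b\<bar>)"
    by (simp add: sum_ennreal)
  also have "\<dots> \<le> (\<Sum>b\<in>?M. ennreal K * cube_L1 ?h y r)"
    using h r by (intro sum_mono coef_le) auto
  also have "\<dots> = ennreal (card ?M * K) * cube_L1 ?h y r"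
    using K_nonneg by (simp add: ennreal_mult mult.assoc ennreal_of_nat_eq_real_of_nat)
  also have "cube_L1 ?h y r + ennreal (card ?M * K) * cube_L1 ?h y r * ennreal (2 ^ CARD('n))
      = (1 + ennreal (card ?M * K) * ennreal (2 ^ CARD('n))) * cube_L1 ?h y r"
    by (simp only: distrib_right mult_1_left) (simp add: mult_ac)
  also have "1 + ennreal (card ?M * K) * ennreal (2 ^ CARD('n)) = ennreal C0"
    using K_nonneg by (simp add: C0_def ennreal_mult'[symmetric] flip: ennreal_1 ennreal_plus)
  finally show ?thesis by (simp add: mult_right_mono add_left_mono)
qed

text \<open>The projection on the larger cube is a competitor on the smaller one; the power of
  \<open>r / s\<close> is the ratio of the volumes.\<close>

lemma osc_mono:
  assumes f: "loc_int f" and s: "0 < s" and r: "0 < r" and sub: "cube y s \<subseteq> cube x r"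
  shows "osc f y s \<le> ennreal (C0 * (r / s) ^ CARD('n)) * osc f x r"
proof -
  have "osc f y s \<le> ennreal C0 * cube_L1 (\<lambda>z. f z - proj f x r z) y s"
    using f proj_in_polys s by (rule osc_le)
  also have "\<dots> \<le> ennreal C0 * (ennreal ((r / s) ^ CARD('n)) * osc f x r)"
    unfolding osc_def using loc_int_diff[OF f loc_int_proj] s r sub
    by (intro mult_left_mono cube_L1_mono) (auto dest: loc_intD)
  also have "\<dots> = ennreal (C0 * (r / s) ^ CARD('n)) * osc f x r"
    using C0_ge_1 s r by (simp add: ennreal_mult mult.assoc)
  finally show ?thesis .
qed

lemma zero_in_polys: "(\<lambda>_. 0) \<in> polys_below k"
  by (auto simp: polys_below_eq poly_below_def fun_eq_iff intro!: image_eqI[of _ _ "\<lambda>_. 0"])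

lemma osc_le_cube_L1: "loc_int f \<Longrightarrow> 0 < r \<Longrightarrow> osc f y r \<le> ennreal C0 * cube_L1 f y r"
  using osc_le[OF _ zero_in_polys] by simp

lemma osc_finite: "loc_int f \<Longrightarrow> 0 < r \<Longrightarrow> osc f y r < \<infinity>"
  unfolding osc_def by (intro cube_L1_finite loc_int_diff loc_int_proj)

text \<open>Every competitor in the infimum obeys \<open>osc_le\<close>. The constant is first moved
  to the left, since the infimum is then compared directly.\<close>

lemma osc_le_approx:
  assumes f: "loc_int f" and r: "0 < r"
  shows "osc f y r \<le> ennreal (C0 * 2 ^ CARD('n)) * local_approx m lborel f (cube y r)"
proof -
  let ?C = "C0 * 2 ^ CARD('n)"
  have C: "0 < ?C" using C0_ge_1 by simp
  have "ennreal (1 / ?C) * osc f y r \<le> local_approx m lborel f (cube y r)"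
    unfolding local_approx_def
  proof (rule INF_greatest)
    fix P :: "real^'n \<Rightarrow> real" assume P: "P \<in> polys_below m"
    let ?q = "(\<integral>\<^sup>+z\<in>cube y r. ennreal \<bar>f z - P z\<bar> \<partial>lborel) / emeasure lborel (cube y r)"
    have "osc f y r \<le> ennreal C0 * cube_L1 (\<lambda>z. f z - P z) y r"
      by (rule osc_le[OF f P r])
    also have "cube_L1 (\<lambda>z. f z - P z) y r = ennreal (2 ^ CARD('n)) * ?q"
      using cube_L1_average[OF loc_intD[OF loc_int_diff[OF f loc_int_poly[OF P]]] r] by (simp add: ennreal_power[symmetric])
    also have "ennreal C0 * (ennreal (2 ^ CARD('n)) * ?q) = ennreal ?C * ?q"
      using C0_ge_1 by (subst ennreal_mult) (auto simp: mult.assoc)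
    finally have "ennreal (1 / ?C) * osc f y r \<le> ennreal (1 / ?C) * (ennreal ?C * ?q)"
      by (intro mult_left_mono) auto
    also have "ennreal (1 / ?C) * (ennreal ?C * ?q) = ?q"
      using C C0_ge_1 by (simp add: mult.assoc[symmetric] ennreal_mult'[symmetric])
    finally show "ennreal (1 / ?C) * osc f y r \<le> ?q" .
  qed
  then have "ennreal ?C * (ennreal (1 / ?C) * osc f y r) \<le> ennreal ?C * local_approx m lborel f (cube y r)"
    by (intro mult_left_mono) auto
  moreover have "ennreal ?C * (ennreal (1 / ?C) * osc f y r) = osc f y r"
    using C C0_ge_1 by (simp add: mult.assoc[symmetric] ennreal_mult'[symmetric])
  ultimately show ?thesis by simp
qed

lemma cube_L1_diff_proj_le:
  assumes f: "loc_int f" and s: "0 < s" and r: "0 < r" and sub: "cube y s \<subseteq> cube w r"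
  shows "cube_L1 (\<lambda>x. f x - proj f w r x) y s \<le> ennreal ((r / s) ^ CARD('n)) * osc f w r"
  unfolding osc_def using loc_int_diff[OF f loc_int_proj] s r sub
  by (intro cube_L1_mono) (auto dest: loc_intD)

text \<open>By linearity the left side is a coefficient of \<open>f - proj f w r\<close> on the
  smaller cube. The centres may differ: equal centres give the decay of coefficients, different ones
  relate the expansions about two points.\<close>

lemma coef_diff_proj_le:
  assumes f: "loc_int f" and s: "0 < s" and r: "0 < r" and sub: "cube y s \<subseteq> cube w r"
  shows "ennreal \<bar>coef f y s b - coef (proj f w r) y s b\<bar> \<le> ennreal (K * (r / s) ^ CARD('n)) * osc f w r"
proof -
  have "ennreal \<bar>coef f y s b - coef (proj f w r) y s b\<bar> \<le> ennreal K * cube_L1 (\<lambda>x. f x - proj f w r x) y s"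
    unfolding coef_diff[OF f loc_int_proj s, symmetric]
    by (intro coef_le loc_int_diff f loc_int_proj s)
  also have "\<dots> \<le> ennreal K * (ennreal ((r / s) ^ CARD('n)) * osc f w r)"
    by (intro mult_left_mono cube_L1_diff_proj_le assms) auto
  finally show ?thesis using K_nonneg s r by (simp add: ennreal_mult mult.assoc)
qed

text \<open>Seen from radius \<open>s\<close>, the projection at radius \<open>r\<close> with the
  same centre has its coefficients multiplied by \<open>s / r\<close> to the order of the
  monomial.\<close>

lemma coef_step:
  assumes f: "loc_int f" and s: "0 < s" "s \<le> r" and b: "b \<in> multi_below m"
  shows "ennreal \<bar>coef f y s b - (s / r) ^ (\<Sum>i\<in>UNIV. b i) * coef f y r b\<bar>
    \<le> ennreal (K * (r / s) ^ CARD('n)) * osc f y r"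
proof -
  have "proj f y r (y + s *\<^sub>R z) = poly_below m (\<lambda>b. (s / r) ^ (\<Sum>i\<in>UNIV. b i) * coef f y r b) z" for z
    by (simp add: proj_def flip: poly_below_scaleR)
  from coef_poly[of "proj f y r", OF this b] coef_diff_proj_le[OF f s(1) _ cube_mono[OF s(2)], of y b] s
  show ?thesis by simp
qed

lemma coef_zero_poly:
  assumes "P \<in> polys_below m" "0 < s" "0 < m"
  shows "coef P y s (\<lambda>_. 0) = P y"
proof -
  have "P y = proj P y s y" using proj_reproduces assms by simp
  also have "\<dots> = coef P y s (\<lambda>_. 0)" using assms by (simp add: proj_def poly_below_zero)
  finally show ?thesis ..
qed

text \<open>The constant coefficient of a polynomial expanded about \<open>y\<close> is its value at
  \<open>y\<close>; this is how the polynomial of the larger cube is evaluated away from its centre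
  \<open>w\<close>.\<close>

lemma coef_zero_proj_le:
  assumes f: "loc_int f" and s: "0 < s" and r: "0 < r" and sub: "cube y s \<subseteq> cube w r" and m: "0 < m"
  shows "ennreal \<bar>coef f y s (\<lambda>_. 0) - proj f w r y\<bar> \<le> ennreal (K * (r / s) ^ CARD('n)) * osc f w r"
  using coef_diff_proj_le[OF f s r sub, of "\<lambda>_. 0"] coef_zero_poly[OF proj_in_polys s m] by simp

text \<open>A parameter integral, measurable in \<open>y\<close> because the integrand is jointly
  measurable in \<open>(y, z)\<close>; here \<open>f\<close> has to be Borel.\<close>

lemma borel_measurable_coef [measurable]:
  assumes [measurable]: "f \<in> borel_measurable borel"
  shows "(\<lambda>y. coef f y r b) \<in> borel_measurable borel"
proof -
  have [measurable]: "(\<lambda>(y, z). f (y + r *\<^sub>R z)) \<in> borel_measurable (borel \<Otimes>\<^sub>M lborel)"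
    unfolding case_prod_unfold by (rule measurable_compose[OF _ assms]) measurable
  have "(\<lambda>(y, z). \<Phi> b z * f (y + r *\<^sub>R z)) \<in> borel_measurable (borel \<Otimes>\<^sub>M lborel)"
    unfolding case_prod_unfold
    using \<open>(\<lambda>(y, z). f (y + r *\<^sub>R z)) \<in> _\<close>[unfolded case_prod_unfold] by measurable
  then show ?thesis unfolding coef_def
    by (rule lborel.borel_measurable_lebesgue_integral)
qed

lemma borel_measurable_cube_L1 [measurable]:
  assumes [measurable]: "h \<in> borel_measurable borel"
  shows "(\<lambda>y. cube_L1 h y r) \<in> borel_measurable borel"
proof -
  have "(\<lambda>p. h (fst p + r *\<^sub>R snd p)) \<in> borel_measurable (borel \<Otimes>\<^sub>M lborel)"
    by (rule measurable_compose[OF _ assms]) measurable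
  then have "(\<lambda>p. ennreal \<bar>h (fst p + r *\<^sub>R snd p)\<bar> * indicator (cube 0 1) (snd p)) \<in> borel_measurable (borel \<Otimes>\<^sub>M lborel)"
    by measurable
  from lborel.borel_measurable_nn_integral_fst[OF this] show ?thesis
    by (simp add: cube_L1_def[abs_def])
qed

lemma borel_measurable_osc [measurable]:
  assumes f: "f \<in> borel_measurable borel" and r: "r \<noteq> 0"
  shows "(\<lambda>y. osc f y r) \<in> borel_measurable borel"
proof -
  have m1: "(\<lambda>p. f (fst p + r *\<^sub>R snd p)) \<in> borel_measurable (borel \<Otimes>\<^sub>M lborel)"
    by (rule measurable_compose[OF _ f]) measurable
  have m2: "(\<lambda>p. poly_below m (coef f (fst p) r) (snd p)) \<in> borel_measurable (borel \<Otimes>\<^sub>M lborel)"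
    unfolding poly_below_def mmonom_def
  proof (intro borel_measurable_sum borel_measurable_times borel_measurable_prod borel_measurable_power)
    show "(\<lambda>p. coef f (fst p) r b) \<in> borel_measurable (borel \<Otimes>\<^sub>M lborel)" for b
      by (rule measurable_compose[OF measurable_fst borel_measurable_coef[OF f]])
    show "(\<lambda>p. snd p $ i) \<in> borel_measurable (borel \<Otimes>\<^sub>M lborel)" for i :: 'n
      by (rule measurable_compose[OF measurable_snd]) (simp add: borel_measurable_continuous_onI continuous_intros)
  qed
  have "(\<lambda>p. ennreal \<bar>f (fst p + r *\<^sub>R snd p) - poly_below m (coef f (fst p) r) (snd p)\<bar> * indicator (cube 0 1) (snd p)) \<in> borel_measurable (borel \<Otimes>\<^sub>M lborel)"
    using m1 m2 by measurable
  from lborel.borel_measurable_nn_integral_fst[OF this] show ?thesis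
    using r by (simp add: cube_L1_def[abs_def] osc_def[abs_def] proj_affine)
qed

end

subsection \<open>Convergence of the averages and the trace\<close>

(* Starts at 1/2: a cube of radius r meeting S lies in one of radius 2r centred in S. *)
definition rho :: "nat \<Rightarrow> real" where
  "rho j = (1 / 2) ^ Suc j"

lemma rho_pos [simp]: "0 < rho j" "0 \<le> rho j" "rho j \<noteq> 0"
  by (simp_all add: rho_def)

lemma rho_Suc: "rho (Suc j) = rho j / 2" "rho j = 2 * rho (Suc j)"
  by (simp_all add: rho_def)

lemma rho_antimono: "i \<le> j \<Longrightarrow> rho j \<le> rho i"
  unfolding rho_def by (rule power_decreasing) auto

lemma rho_le_half: "rho j \<le> 1 / 2"
  using rho_antimono[of 0 j] by (simp add: rho_def)

lemma rho_bracket: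
  assumes "0 < s" "s \<le> rho J"
  shows "\<exists>j\<ge>J. rho (Suc j) < s \<and> s \<le> rho j"
proof -
  obtain n where "(1 / 2 :: real) ^ n < s" using real_arch_pow_inv[OF assms(1), of "1/2"] by auto
  then have "rho n < s" by (simp add: rho_def) (use assms in linarith)
  then have ex: "\<exists>n. rho n < s" ..
  define N where "N = (LEAST n. rho n < s)"
  have N: "rho N < s" unfolding N_def by (rule LeastI_ex[OF ex])
  have "J < N" using rho_antimono[of N J] N assms by (meson leI less_le_trans not_le order_trans)
  then obtain j where j: "N = Suc j" "J \<le> j" by (cases N) auto
  have "\<not> rho j < s" using not_less_Least[of j "\<lambda>n. rho n < s"] j by (simp add: N_def)
  with j N show ?thesis by auto
qed

lemma ennreal_le_add: "x \<le> y + z \<Longrightarrow> 0 \<le> y \<Longrightarrow> 0 \<le> z \<Longrightarrow> ennreal x \<le> ennreal y + ennreal z"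
  by (metis ennreal_leI ennreal_plus)

text \<open>Summing the recursion bounds the partial sums of \<open>x\<close> by
  \<open>2 * (x 0 + suminf d)\<close>, so \<open>x\<close> is even summable.\<close>

lemma halving_recursion_tendsto_0:
  fixes x d :: "nat \<Rightarrow> real"
  assumes x: "\<And>j. 0 \<le> x j" and d: "\<And>j. 0 \<le> d j" "summable d"
    and rec: "\<And>j. x (Suc j) \<le> x j / 2 + d j"
  shows "x \<longlonglongrightarrow> 0"
proof -
  have bd: "(\<Sum>l<n. x l) \<le> 2 * (x 0 + suminf d)" for n
  proof (induction n)
    case 0
    show ?case using x[of 0] suminf_nonneg[OF d(2,1)] by simp
  next
    case (Suc n)
    have "(\<Sum>l<Suc n. x l) = x 0 + (\<Sum>l<n. x (Suc l))" by (rule sum.lessThan_Suc_shift)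
    also have "(\<Sum>l<n. x (Suc l)) \<le> (\<Sum>l<n. x l / 2 + d l)" by (intro sum_mono rec)
    also have "\<dots> = (\<Sum>l<n. x l) / 2 + (\<Sum>l<n. d l)" by (simp add: sum.distrib sum_divide_distrib)
    also have "(\<Sum>l<n. d l) \<le> suminf d" by (rule sum_le_suminf) (use d in auto)
    finally show ?case using Suc by simp
  qed
  have "summable x"
    by (rule summableI_nonneg_bounded[OF x bd])
  then show ?thesis by (rule summable_LIMSEQ_zero)
qed

lemma cube_average_unit_cube:
  fixes f :: "real^'n \<Rightarrow> real"
  assumes [measurable]: "f \<in> borel_measurable borel" and r: "0 < r"
  shows "cube_average f y r = (\<integral>z. indicator (cube 0 1) z * f (y + r *\<^sub>R z) \<partial>lborel) / 2 ^ CARD('n)"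
proof -
  have "(LINT x:cube y r|lebesgue. f x) = (\<integral>x. indicator (cube y r) x * f x \<partial>lborel)"
    unfolding set_lebesgue_integral_def by (simp add: integral_completion)
  also have "\<dots> = (\<integral>x. indicator (cube y r) x * f x \<partial>density (distr lborel borel (\<lambda>z. y + r *\<^sub>R z)) (\<lambda>_. ennreal (\<bar>r\<bar> ^ DIM(real^'n))))"
    using lborel_affine[of r y] r by simp
  also have "\<dots> = (\<integral>z. r ^ CARD('n) * (indicator (cube y r) (y + r *\<^sub>R z) * f (y + r *\<^sub>R z)) \<partial>lborel)"
    using r by (subst integral_density) (auto simp: integral_distr)
  also have "\<dots> = r ^ CARD('n) * (\<integral>z. indicator (cube 0 1) z * f (y + r *\<^sub>R z) \<partial>lborel)"
    using r by (simp add: indicator_def cube_affine)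
  finally have "(LINT x:cube y r|lebesgue. f x) = r ^ CARD('n) * (\<integral>z. indicator (cube 0 1) z * f (y + r *\<^sub>R z) \<partial>lborel)" .
  moreover have "measure lebesgue (cube y r) = (2 * r) ^ CARD('n)"
    using emeasure_cube[of r y] r by (simp add: measure_def)
  ultimately show ?thesis
    using r by (simp add: cube_average_def power_mult_distrib)
qed

context coefficient_kernel begin

lemma cube_average_diff_le:
  assumes f: "loc_int f" and s: "0 < s" "s \<le> r" and m: "0 < m"
  shows "ennreal \<bar>cube_average f y s - coef f y r (\<lambda>_. 0)\<bar>
    \<le> ennreal ((r / s) ^ CARD('n)) * osc f y r + ennreal (\<Sum>b\<in>multi_below m - {\<lambda>_. 0}. \<bar>coef f y r b\<bar>)"
proof -
  let ?c = "coef f y r" and ?N = "CARD('n)"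
  let ?E = "multi_below m - {\<lambda>_::'n. 0::nat}" and ?cz = "?c (\<lambda>_. 0)"
  let ?B = "\<Sum>b\<in>?E. \<bar>?c b\<bar>"
  note [measurable] = loc_intD[OF f] loc_intD[OF loc_int_proj]
  have r: "0 < r" using s by linarith
  have zero: "(\<lambda>_. 0) \<in> multi_below m" using m by (simp add: multi_below_def)
  have int1: "integrable lborel (\<lambda>z. indicator (cube 0 1) z * f (y + s *\<^sub>R z))"
  proof (rule integrableI_bounded)
    show "(\<integral>\<^sup>+z. ennreal (norm (indicator (cube 0 1) z * f (y + s *\<^sub>R z))) \<partial>lborel) < \<infinity>"
      using cube_L1_finite[OF f s(1), of y] by (simp add: cube_L1_def abs_mult ennreal_mult' mult.commute ennreal_indicator)
  qed measurable
  have int2: "integrable lborel (\<lambda>z. indicator (cube 0 1) z * ?cz :: real)"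
    by (intro integrable_mult_left integrable_real_indicator) (auto simp: emeasure_cube)
  have I2: "(\<integral>z. indicator (cube (0::real^'n) 1) z * ?cz \<partial>lborel) = 2 ^ ?N * ?cz"
    using emeasure_cube[of 1 "0::real^'n"] by (simp add: measure_def)
  let ?u = "\<lambda>z. f (y + s *\<^sub>R z) - ?cz"
  have "cube_average f y s - ?cz
      = ((\<integral>z. indicator (cube 0 1) z * f (y + s *\<^sub>R z) \<partial>lborel) - (\<integral>z. indicator (cube (0::real^'n) 1) z * ?cz \<partial>lborel)) / 2 ^ ?N"
    by (simp only: cube_average_unit_cube[OF loc_intD[OF f] s(1)] I2) (simp add: diff_divide_distrib)
  also have "\<dots> = (\<integral>z. indicator (cube 0 1) z * ?u z \<partial>lborel) / 2 ^ ?N"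
    unfolding Bochner_Integration.integral_diff[OF int1 int2, symmetric] by (simp only: right_diff_distrib)
  finally have "\<bar>cube_average f y s - ?cz\<bar> = \<bar>\<integral>z. indicator (cube 0 1) z * ?u z \<partial>lborel\<bar> / 2 ^ ?N"
    by simp
  then have "ennreal \<bar>cube_average f y s - ?cz\<bar>
      = ennreal (1 / 2 ^ ?N) * ennreal \<bar>\<integral>z. indicator (cube 0 1) z * ?u z \<partial>lborel\<bar>"
    by (simp add: ennreal_mult'[symmetric])
  also have "ennreal \<bar>\<integral>z. indicator (cube 0 1) z * ?u z \<partial>lborel\<bar>
      \<le> (\<integral>\<^sup>+z. ennreal (norm (indicator (cube 0 1) z * ?u z)) \<partial>lborel)"
    using integral_norm_bound_ennreal[OF Bochner_Integration.integrable_diff[OF int1 int2]]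
    by (simp add: right_diff_distrib)
  also have "\<dots> \<le> (\<integral>\<^sup>+z. ennreal \<bar>f (y + s *\<^sub>R z) - proj f y r (y + s *\<^sub>R z)\<bar> * indicator (cube 0 1) z
      + ennreal ?B * indicator (cube 0 1) z \<partial>lborel)"
  proof (intro nn_integral_mono)
    fix z :: "real^'n"
    show "ennreal (norm (indicator (cube 0 1) z * ?u z))
      \<le> ennreal \<bar>f (y + s *\<^sub>R z) - proj f y r (y + s *\<^sub>R z)\<bar> * indicator (cube 0 1) z + ennreal ?B * indicator (cube 0 1) z"
    proof (cases "z \<in> cube 0 1")
      case True
      have "z \<in> cube 0 1 \<Longrightarrow> (s / r) *\<^sub>R z \<in> cube 0 1"
        using s r by (auto simp: cube_iff abs_mult field_simps intro: order_trans[OF mult_left_mono, of _ 1])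
      then have sz: "(s / r) *\<^sub>R z \<in> cube 0 1" using True by blast
      have "proj f y r (y + s *\<^sub>R z) = poly_below m ?c ((s / r) *\<^sub>R z)"
        by (simp add: proj_def)
      also have "\<dots> = ?cz + (\<Sum>b\<in>?E. ?c b * mmonom b ((s / r) *\<^sub>R z))"
        unfolding poly_below_def by (subst sum.remove[OF finite_multi_below zero]) (simp add: mmonom_def)
      finally have "\<bar>proj f y r (y + s *\<^sub>R z) - ?cz\<bar> = \<bar>\<Sum>b\<in>?E. ?c b * mmonom b ((s / r) *\<^sub>R z)\<bar>"
        by simp
      also have "\<dots> \<le> ?B"
        using abs_mmonom_le[OF sz]
        by (intro order_trans[OF sum_abs] sum_mono) (simp add: abs_mult mult_left_le)
      finally have "\<bar>?u z\<bar> \<le> \<bar>f (y + s *\<^sub>R z) - proj f y r (y + s *\<^sub>R z)\<bar> + ?B" by linarith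
      from ennreal_leI[OF this] True show ?thesis
        by (simp add: ennreal_plus sum_nonneg del: sum_ennreal)
    qed simp
  qed
  also have "\<dots> = cube_L1 (\<lambda>x. f x - proj f y r x) y s + ennreal ?B * ennreal (2 ^ ?N)"
    unfolding cube_L1_def
    by (subst nn_integral_add) (auto simp: nn_integral_cmult_indicator emeasure_cube)
  also have "cube_L1 (\<lambda>x. f x - proj f y r x) y s \<le> ennreal ((r / s) ^ ?N) * osc f y r"
    by (rule cube_L1_diff_proj_le[OF f s(1) r cube_mono[OF s(2)]])
  finally have "ennreal \<bar>cube_average f y s - ?cz\<bar>
      \<le> ennreal (1 / 2 ^ ?N) * (ennreal ((r / s) ^ ?N) * osc f y r + ennreal ?B * ennreal (2 ^ ?N))"
    by (simp add: mult_left_mono add_right_mono)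
  also have "\<dots> = ennreal (1 / 2 ^ ?N) * (ennreal ((r / s) ^ ?N) * osc f y r) + ennreal ?B"
  proof -
    have "ennreal (1 / 2 ^ ?N) * (ennreal ?B * ennreal (2 ^ ?N)) = ennreal ?B"
      by (simp add: ennreal_mult'[symmetric] sum_nonneg del: sum_ennreal)
    then show ?thesis by (simp add: distrib_left)
  qed
  also have "ennreal (1 / 2 ^ ?N) * (ennreal ((r / s) ^ ?N) * osc f y r) \<le> 1 * (ennreal ((r / s) ^ ?N) * osc f y r)"
    by (intro mult_right_mono) (auto simp flip: ennreal_1 intro!: ennreal_leI)
  finally show ?thesis by (simp add: add_right_mono)
qed

lemma coef_rho_step:
  assumes "loc_int f" "b \<in> multi_below m"
  shows "ennreal \<bar>coef f y (rho (Suc j)) b - (1 / 2) ^ (\<Sum>i\<in>UNIV. b i) * coef f y (rho j) b\<bar>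
    \<le> ennreal (K * 2 ^ CARD('n)) * osc f y (rho j)"
  using coef_step[OF assms(1) rho_pos(1) rho_antimono assms(2), of j "Suc j" y]
  by (simp add: rho_Suc(1))

text \<open>The constant coefficients have absolutely summable increments and so converge, while the
  sum of the other coefficients tends to 0. The averages at all radii then share the limit of the
  constant coefficients.\<close>

lemma trace_exists:
  assumes f: "loc_int f" and m: "0 < m" and fin: "(\<Sum>j. osc f y (rho j)) < \<infinity>"
  shows "(\<lambda>j. coef f y (rho j) (\<lambda>_. 0)) \<longlonglongrightarrow> pointwise_trace f y"
proof -
  define d where "d j = enn2real (osc f y (rho j))" for j
  have d: "osc f y (rho j) = ennreal (d j)" "0 \<le> d j" for j
    using osc_finite[OF f rho_pos(1)] by (auto simp: d_def less_top)
  have sd: "summable d"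
    using fin d by (intro summable_suminf_not_top) auto
  let ?KN = "K * 2 ^ CARD('n)"
  have KN: "0 \<le> ?KN" using K_nonneg by simp
  have step: "\<bar>coef f y (rho (Suc j)) b - (1 / 2) ^ (\<Sum>i\<in>UNIV. b i) * coef f y (rho j) b\<bar> \<le> ?KN * d j"
    if "b \<in> multi_below m" for b j
    using coef_rho_step[OF f that, of y j] d KN by (simp add: ennreal_mult'[symmetric])
  define c where "c j = coef f y (rho j) (\<lambda>_. 0)" for j
  define e where "e j = c (Suc j) - c j" for j
  have zero: "(\<lambda>_. 0) \<in> multi_below m" using m by (simp add: multi_below_def)
  have e: "\<bar>e j\<bar> \<le> ?KN * d j" for j using step[OF zero, of j] by (simp add: e_def c_def)
  have "summable (\<lambda>j. \<bar>e j\<bar>)"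
    by (rule summable_comparison_test'[OF summable_mult[OF sd, of ?KN], of 0]) (use e in auto)
  then have "summable e" by (rule summable_rabs_cancel)
  then have "(\<lambda>n. \<Sum>j<n. e j) \<longlonglongrightarrow> suminf e" by (rule summable_LIMSEQ)
  moreover have "(\<Sum>j<n. e j) = c n - c 0" for n
    unfolding e_def by (rule sum_lessThan_telescope)
  ultimately have "(\<lambda>n. c n - c 0 + c 0) \<longlonglongrightarrow> suminf e + c 0"
    by (intro tendsto_add tendsto_const) simp
  then obtain l where l: "c \<longlonglongrightarrow> l" by auto
  let ?E = "multi_below m - {\<lambda>_::'n. 0::nat}"
  define B where "B j = (\<Sum>b\<in>?E. \<bar>coef f y (rho j) b\<bar>)" for j
  let ?M = "card (multi_below m :: ('n \<Rightarrow> nat) set)"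
  \<comment> \<open>A coefficient of order at least 1 gains a factor of at most 1/2 per dyadic step,
    up to an oscillation.\<close>
  have B0: "B \<longlonglongrightarrow> 0"
  proof (rule halving_recursion_tendsto_0[where d = "\<lambda>j. real ?M * (?KN * d j)"])
    show "0 \<le> B j" for j by (simp add: B_def sum_nonneg)
    show "0 \<le> real ?M * (?KN * d j)" for j using d KN by simp
    show "summable (\<lambda>j. real ?M * (?KN * d j))" by (intro summable_mult sd)
    fix j
    have "\<bar>coef f y (rho (Suc j)) b\<bar> \<le> \<bar>coef f y (rho j) b\<bar> / 2 + ?KN * d j" if "b \<in> ?E" for b
    proof -
      have "(\<Sum>i\<in>UNIV. b i) \<noteq> 0" using that by (auto simp: fun_eq_iff)
      then have "1 \<le> (\<Sum>i\<in>UNIV. b i)" by linarith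
      from power_decreasing[OF this, of "1 / 2 :: real"] have "(1 / 2 :: real) ^ (\<Sum>i\<in>UNIV. b i) \<le> 1 / 2"
        by simp
      then have "\<bar>(1 / 2) ^ (\<Sum>i\<in>UNIV. b i) * coef f y (rho j) b\<bar> \<le> (1 / 2) * \<bar>coef f y (rho j) b\<bar>"
        unfolding abs_mult by (intro mult_right_mono) auto
      then show ?thesis using step[of b j] that by auto
    qed
    then have "B (Suc j) \<le> (\<Sum>b\<in>?E. \<bar>coef f y (rho j) b\<bar> / 2 + ?KN * d j)"
      unfolding B_def by (intro sum_mono) auto
    also have "\<dots> = B j / 2 + real (card ?E) * (?KN * d j)"
      by (simp add: B_def sum.distrib sum_divide_distrib)
    also have "real (card ?E) * (?KN * d j) \<le> real ?M * (?KN * d j)"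
      using KN d by (intro mult_right_mono) (auto intro: card_mono)
    finally show "B (Suc j) \<le> B j / 2 + real ?M * (?KN * d j)" by simp
  qed
  define \<eta> where "\<eta> j = 2 ^ CARD('n) * d j + B j" for j
  have "\<eta> \<longlonglongrightarrow> 2 ^ CARD('n) * 0 + 0"
    unfolding \<eta>_def by (intro tendsto_add tendsto_mult tendsto_const B0 summable_LIMSEQ_zero sd)
  then have \<eta>0: "\<eta> \<longlonglongrightarrow> 0" by simp
  \<comment> \<open>Each small radius lies in one such dyadic interval, and there
    \<open>rho j / s \<le> 2\<close>.\<close>
  have avg: "\<bar>cube_average f y s - c j\<bar> \<le> \<eta> j" if "rho (Suc j) < s" "s \<le> rho j" for s j
  proof -
    have s: "0 < s" using that(1) rho_pos(1) less_trans by blast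
    have "0 \<le> \<eta> j" using d by (simp add: \<eta>_def B_def sum_nonneg)
    have "rho j / s \<le> 2" using that s by (simp add: rho_Suc(2)[of j] field_simps)
    then have q: "(rho j / s) ^ CARD('n) \<le> 2 ^ CARD('n)" using s by (intro power_mono) auto
    have "ennreal \<bar>cube_average f y s - c j\<bar> \<le> ennreal ((rho j / s) ^ CARD('n)) * osc f y (rho j) + ennreal (B j)"
      unfolding c_def B_def by (rule cube_average_diff_le[OF f s that(2) m])
    also have "\<dots> \<le> ennreal (2 ^ CARD('n)) * osc f y (rho j) + ennreal (B j)"
      using q by (intro add_right_mono mult_right_mono ennreal_leI) auto
    also have "\<dots> = ennreal (\<eta> j)"
      using d by (simp add: \<eta>_def ennreal_mult ennreal_plus B_def sum_nonneg)
    finally show ?thesis using \<open>0 \<le> \<eta> j\<close> by simp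
  qed
  have "(cube_average f y \<longlongrightarrow> l) (at_right 0)"
  proof (rule tendstoI)
    fix \<epsilon> :: real assume "0 < \<epsilon>"
    then have "\<forall>\<^sub>F j in sequentially. \<bar>\<eta> j\<bar> < \<epsilon> / 2 \<and> \<bar>c j - l\<bar> < \<epsilon> / 2"
      using tendstoD[OF \<eta>0, of "\<epsilon> / 2"] tendstoD[OF l, of "\<epsilon> / 2"] by (simp add: dist_real_def eventually_conj_iff)
    then obtain J where J: "\<And>j. J \<le> j \<Longrightarrow> \<bar>\<eta> j\<bar> < \<epsilon> / 2 \<and> \<bar>c j - l\<bar> < \<epsilon> / 2"
      by (auto simp: eventually_sequentially)
    have "dist (cube_average f y s) l < \<epsilon>" if s: "0 < s" "s < rho J" for s
    proof -
      obtain j where j: "J \<le> j" "rho (Suc j) < s" "s \<le> rho j"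
        using rho_bracket[of s J] s by auto
      show ?thesis using avg[OF j(2,3)] J[OF j(1)] unfolding dist_real_def by linarith
    qed
    then show "\<forall>\<^sub>F s in at_right 0. dist (cube_average f y s) l < \<epsilon>"
      unfolding eventually_at_right_field by (intro exI[of _ "rho J"]) auto
  qed
  \<comment> \<open>The limit exists, so the dummy value 0 does not apply.\<close>
  then have "pointwise_trace f y = l"
    unfolding pointwise_trace_def by (auto intro!: tendsto_Lim)
  with l show ?thesis by (simp add: c_def[abs_def])
qed

text \<open>\<open>C\<close> has to be positive: where the sum of the oscillations diverges the
  right side must be infinite, but \<open>0 * top = 0\<close>. Elsewhere the coefficients telescope
  and the bound passes to the limit.\<close>

lemma trace_coef_le:
  assumes f: "loc_int f" and m: "0 < m" and C: "K * 2 ^ CARD('n) \<le> C" "0 < C"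
  shows "ennreal \<bar>pointwise_trace f y - coef f y (rho i) (\<lambda>_. 0)\<bar> \<le> ennreal C * (\<Sum>j. osc f y (rho (i + j)))"
proof (cases "(\<Sum>j. osc f y (rho (i + j))) = \<infinity>")
  case True
  then show ?thesis using C by (simp add: ennreal_mult_top)
next
  case False
  let ?c = "\<lambda>j. coef f y (rho j) (\<lambda>_. 0)"
  have zero: "(\<lambda>_. 0) \<in> multi_below m" using m by (simp add: multi_below_def)
  have "(\<Sum>j. osc f y (rho j)) = (\<Sum>j. osc f y (rho (j + i))) + (\<Sum>j<i. osc f y (rho j))"
    by (rule suminf_offset) simp
  also have "\<dots> < \<infinity>"
    using False osc_finite[OF f rho_pos(1)] by (simp add: add.commute less_top)
  finally have lim: "?c \<longlonglongrightarrow> pointwise_trace f y" by (rule trace_exists[OF f m])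
  have part: "ennreal \<bar>?c (i + n) - ?c i\<bar> \<le> ennreal (K * 2 ^ CARD('n)) * (\<Sum>j<n. osc f y (rho (i + j)))" for n
  proof (induction n)
    case (Suc n)
    have "ennreal \<bar>?c (i + Suc n) - ?c i\<bar> \<le> ennreal \<bar>?c (i + n) - ?c i\<bar> + ennreal \<bar>?c (Suc (i + n)) - ?c (i + n)\<bar>"
      by (rule ennreal_le_add) auto
    also have "\<dots> \<le> ennreal (K * 2 ^ CARD('n)) * (\<Sum>j<n. osc f y (rho (i + j))) + ennreal (K * 2 ^ CARD('n)) * osc f y (rho (i + n))"
      using coef_rho_step[OF f zero, of y "i + n"] by (intro add_mono Suc) simp
    finally show ?case by (simp add: distrib_left)
  qed simp
  have "(\<lambda>n. ennreal \<bar>?c (i + n) - ?c i\<bar>) \<longlonglongrightarrow> ennreal \<bar>pointwise_trace f y - ?c i\<bar>"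
    using LIMSEQ_ignore_initial_segment[OF lim, of i]
    by (intro tendsto_intros) (simp add: add.commute)
  then show ?thesis
  proof (rule LIMSEQ_le_const2)
    show "\<exists>N. \<forall>n\<ge>N. ennreal \<bar>?c (i + n) - ?c i\<bar> \<le> ennreal C * (\<Sum>j. osc f y (rho (i + j)))"
      using C by (intro exI allI impI order_trans[OF part] mult_mono ennreal_leI sum_le_suminf) auto
  qed
qed

text \<open>Iteration of \<open>coef_rho_step\<close> from scale 0 on; an order of at least
  \<open>k\<close> means a contraction by at least \<open>(1 / 2) ^ k\<close> per step. The
  oscillation at scale \<open>l\<close> enters in the step to \<open>l + 1\<close> and is contracted
  only \<open>i - l - 1\<close> times, whence the extra factor \<open>2 ^ k\<close>.\<close>

lemma coef_growth:
  assumes f: "loc_int f" and b: "b \<in> multi_below m" "b \<notin> multi_below k"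
  shows "ennreal \<bar>coef f w (rho i) b\<bar> \<le> ennreal (((1 / 2) ^ k) ^ i * K) * cube_L1 f w (rho 0)
    + ennreal (K * 2 ^ CARD('n) * 2 ^ k) * (\<Sum>l<i. ennreal (((1 / 2) ^ k) ^ (i - l)) * osc f w (rho l))"
proof (induction i)
  case 0
  show ?case using coef_le[OF f rho_pos(1), of w 0 b] by simp
next
  case (Suc i)
  let ?\<kappa> = "(1 / 2 :: real) ^ k" and ?c = "\<lambda>i. coef f w (rho i) b" and ?A = "cube_L1 f w (rho 0)"
  let ?C = "K * 2 ^ CARD('n)"
  let ?S = "\<lambda>i. \<Sum>l<i. ennreal (?\<kappa> ^ (i - l)) * osc f w (rho l)"
  have deg: "k \<le> (\<Sum>i\<in>UNIV. b i)" using b by (simp add: multi_below_def)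
  have "\<bar>?c (Suc i)\<bar> \<le> (1 / 2) ^ (\<Sum>i\<in>UNIV. b i) * \<bar>?c i\<bar> + \<bar>?c (Suc i) - (1 / 2) ^ (\<Sum>i\<in>UNIV. b i) * ?c i\<bar>"
    using abs_triangle_ineq[of "(1 / 2) ^ (\<Sum>i\<in>UNIV. b i) * ?c i" "?c (Suc i) - (1 / 2) ^ (\<Sum>i\<in>UNIV. b i) * ?c i"]
    by (simp add: abs_mult)
  also have "(1 / 2) ^ (\<Sum>i\<in>UNIV. b i) * \<bar>?c i\<bar> \<le> ?\<kappa> * \<bar>?c i\<bar>"
    using deg by (intro mult_right_mono power_decreasing) auto
  finally have "ennreal \<bar>?c (Suc i)\<bar> \<le> ennreal (?\<kappa> * \<bar>?c i\<bar>) + ennreal \<bar>?c (Suc i) - (1 / 2) ^ (\<Sum>i\<in>UNIV. b i) * ?c i\<bar>"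
    by (rule ennreal_le_add) auto
  also have "\<dots> \<le> ennreal ?\<kappa> * (ennreal (?\<kappa> ^ i * K) * ?A + ennreal (?C * 2 ^ k) * ?S i) + ennreal ?C * osc f w (rho i)"
    by (subst ennreal_mult') (auto intro!: add_mono mult_left_mono Suc coef_rho_step[OF f b(1)])
  also have "\<dots> = ennreal (?\<kappa> ^ Suc i * K) * ?A + ennreal (?C * 2 ^ k) * (ennreal ?\<kappa> * ?S i) + ennreal ?C * osc f w (rho i)"
  proof -
    have "ennreal ?\<kappa> * (ennreal (?\<kappa> ^ i * K) * ?A) = ennreal (?\<kappa> ^ Suc i * K) * ?A"
      using K_nonneg by (simp add: mult.assoc[symmetric] ennreal_mult'[symmetric])
    then show ?thesis by (simp add: distrib_left mult.left_commute)
  qed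
  also have "ennreal ?\<kappa> * ?S i = (\<Sum>l<i. ennreal (?\<kappa> ^ (Suc i - l)) * osc f w (rho l))"
    by (auto simp: sum_distrib_left mult.assoc[symmetric] ennreal_mult'[symmetric] Suc_diff_le intro!: sum.cong)
  also have "ennreal ?C * osc f w (rho i) = ennreal (?C * 2 ^ k) * (ennreal (?\<kappa> ^ (Suc i - i)) * osc f w (rho i))"
    using K_nonneg by (simp add: mult.assoc[symmetric] ennreal_mult'[symmetric] power_divide)
  finally show ?case
    by (simp add: distrib_left add.assoc)
qed

text \<open>One constant dominating those of all trace estimates. The leading 1 makes it positive;
  the last summand accounts for the discarded coefficients, each bounded by
  \<open>coef_growth\<close>.\<close>

definition C1 :: "nat \<Rightarrow> real" where
  "C1 k = 1 + K * 2 ^ CARD('n) + K + card (multi_below m :: ('n \<Rightarrow> nat) set) * (K + K * 2 ^ CARD('n) * 2 ^ k)"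

lemma C1_ge:
  shows "1 \<le> C1 k" (is ?a) and "K * 2 ^ CARD('n) \<le> C1 k" (is ?b) and "K \<le> C1 k" (is ?c)
    and "K * 2 ^ CARD('n) + card (multi_below m :: ('n \<Rightarrow> nat) set) * (K * 2 ^ CARD('n) * 2 ^ k) \<le> C1 k" (is ?d)
    and "card (multi_below m :: ('n \<Rightarrow> nat) set) * K \<le> C1 k" (is ?e)
proof -
  have "0 \<le> K * 2 ^ CARD('n)" "0 \<le> card (multi_below m :: ('n \<Rightarrow> nat) set) * K"
      "0 \<le> card (multi_below m :: ('n \<Rightarrow> nat) set) * (K * 2 ^ CARD('n) * 2 ^ k)"
    using K_nonneg by simp_all
  then show ?a ?b ?c ?d ?e
    using K_nonneg unfolding C1_def distrib_left by linarith+
qed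

lemma trace_le:
  assumes f: "loc_int f" and m: "0 < m"
  shows "ennreal \<bar>pointwise_trace f y\<bar> \<le> ennreal (C1 k) * ((\<Sum>j. osc f y (rho j)) + cube_L1 f y (rho 0))"
proof -
  let ?c = "coef f y (rho 0) (\<lambda>_. 0)"
  have "ennreal \<bar>pointwise_trace f y\<bar> \<le> ennreal \<bar>pointwise_trace f y - ?c\<bar> + ennreal \<bar>?c\<bar>"
    by (rule ennreal_le_add) auto
  also have "\<dots> \<le> ennreal (C1 k) * (\<Sum>j. osc f y (rho (0 + j))) + ennreal K * cube_L1 f y (rho 0)"
    using C1_ge[of k] by (intro add_mono trace_coef_le coef_le f m) auto
  also have "\<dots> \<le> ennreal (C1 k) * (\<Sum>j. osc f y (rho j)) + ennreal (C1 k) * cube_L1 f y (rho 0)"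
    using C1_ge[of k] by (intro add_mono mult_right_mono ennreal_leI) auto
  finally show ?thesis by (simp add: distrib_left)
qed

text \<open>Two intermediate values connect the trace with the polynomial: the constant coefficient
  at \<open>y\<close> with radius \<open>rho (Suc i)\<close>, and the value at \<open>y\<close> of
  the projection on \<open>cube w (rho i)\<close>. Truncating that projection below order
  \<open>k\<close> leaves the coefficients that \<open>coef_growth\<close> controls.\<close>

lemma trace_local_poly_le:
  assumes f: "loc_int f" and m: "0 < m" and k: "k \<le> m" and y: "y \<in> cube w (rho (Suc i))"
  shows "ennreal \<bar>pointwise_trace f y - poly_below k (coef f w (rho i)) ((1 / rho i) *\<^sub>R (y - w))\<bar>
    \<le> ennreal (C1 k) * (\<Sum>j. osc f y (rho (Suc i + j)))
      + ennreal (C1 k) * ((\<Sum>l\<le>i. ennreal (((1 / 2) ^ k) ^ (i - l)) * osc f w (rho l))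
          + ennreal (((1 / 2) ^ k) ^ i) * cube_L1 f w (rho 0))"
proof -
  let ?c = "coef f w (rho i)" and ?z = "(1 / rho i) *\<^sub>R (y - w)" and ?\<kappa> = "(1 / 2 :: real) ^ k"
  let ?E = "multi_below m - multi_below k :: ('n \<Rightarrow> nat) set"
  let ?A = "cube_L1 f w (rho 0)" and ?C = "K * 2 ^ CARD('n)"
  let ?M = "card (multi_below m :: ('n \<Rightarrow> nat) set)"
  let ?S = "\<Sum>l\<le>i. ennreal (?\<kappa> ^ (i - l)) * osc f w (rho l)"
  \<comment> \<open>The reason for halving the radius of the admissible \<open>y\<close>: the cube
    about \<open>y\<close> stays inside the cube on which the projection is formed.\<close>
  have sub: "cube y (rho (Suc i)) \<subseteq> cube w (rho i)"
    using y by (rule cube_subset) (simp add: rho_Suc(1))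
  have "y \<in> cube w (rho i)" using y cube_mono[OF rho_antimono[of i "Suc i"]] by auto
  then have z: "?z \<in> cube 0 1" using cube_affine[OF rho_pos(1), of w i ?z] by simp
  have split: "proj f w (rho i) y - poly_below k ?c ?z = (\<Sum>b\<in>?E. ?c b * mmonom b ?z)"
    unfolding proj_def poly_below_def by (simp add: sum_diff[OF finite_multi_below multi_below_mono[OF k]])
  have "\<bar>pointwise_trace f y - poly_below k ?c ?z\<bar>
      \<le> \<bar>pointwise_trace f y - coef f y (rho (Suc i)) (\<lambda>_. 0)\<bar>
        + \<bar>coef f y (rho (Suc i)) (\<lambda>_. 0) - proj f w (rho i) y\<bar> + \<bar>\<Sum>b\<in>?E. ?c b * mmonom b ?z\<bar>"
    unfolding split[symmetric] by linarith
  also have "\<bar>\<Sum>b\<in>?E. ?c b * mmonom b ?z\<bar> \<le> (\<Sum>b\<in>?E. \<bar>?c b\<bar>)"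
    using abs_mmonom_le[OF z] by (intro order_trans[OF sum_abs] sum_mono) (simp add: abs_mult mult_left_le)
  finally have "ennreal \<bar>pointwise_trace f y - poly_below k ?c ?z\<bar>
      \<le> ennreal \<bar>pointwise_trace f y - coef f y (rho (Suc i)) (\<lambda>_. 0)\<bar>
        + ennreal \<bar>coef f y (rho (Suc i)) (\<lambda>_. 0) - proj f w (rho i) y\<bar> + (\<Sum>b\<in>?E. ennreal \<bar>?c b\<bar>)"
    by (simp add: ennreal_leI sum_nonneg flip: ennreal_plus)
  also have "\<dots> \<le> ennreal (C1 k) * (\<Sum>j. osc f y (rho (Suc i + j))) + ennreal ?C * osc f w (rho i)
        + (\<Sum>b\<in>?E. ennreal (?\<kappa> ^ i * K) * ?A + ennreal (?C * 2 ^ k) * ?S)"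
  proof (intro add_mono sum_mono)
    show "ennreal \<bar>pointwise_trace f y - coef f y (rho (Suc i)) (\<lambda>_. 0)\<bar> \<le> ennreal (C1 k) * (\<Sum>j. osc f y (rho (Suc i + j)))"
      using C1_ge[of k] by (intro trace_coef_le f m) auto
    show "ennreal \<bar>coef f y (rho (Suc i)) (\<lambda>_. 0) - proj f w (rho i) y\<bar> \<le> ennreal ?C * osc f w (rho i)"
      using coef_zero_proj_le[OF f rho_pos(1) rho_pos(1) sub m] by (simp add: rho_Suc(1))
    fix b assume b: "b \<in> ?E"
    have "ennreal \<bar>?c b\<bar> \<le> ennreal (?\<kappa> ^ i * K) * ?A + ennreal (?C * 2 ^ k) * (\<Sum>l<i. ennreal (?\<kappa> ^ (i - l)) * osc f w (rho l))"
      using coef_growth[OF f, of b k w i] b by blast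
    also have "\<dots> \<le> ennreal (?\<kappa> ^ i * K) * ?A + ennreal (?C * 2 ^ k) * ?S"
      by (intro add_left_mono mult_left_mono sum_mono2) auto
    finally show "ennreal \<bar>?c b\<bar> \<le> ennreal (?\<kappa> ^ i * K) * ?A + ennreal (?C * 2 ^ k) * ?S" .
  qed
  also have "\<dots> \<le> ennreal (C1 k) * (\<Sum>j. osc f y (rho (Suc i + j))) + ennreal ?C * ?S
        + of_nat ?M * (ennreal (?\<kappa> ^ i * K) * ?A + ennreal (?C * 2 ^ k) * ?S)"
  proof (intro add_mono order_refl mult_left_mono)
    have "ennreal (?\<kappa> ^ (i - i)) * osc f w (rho i) \<le> ?S"
      by (rule member_le_sum[of i "{..i}" "\<lambda>l. ennreal (?\<kappa> ^ (i - l)) * osc f w (rho l)"]) auto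
    then show "osc f w (rho i) \<le> ?S" by simp
    show "(\<Sum>b\<in>?E. ennreal (?\<kappa> ^ i * K) * ?A + ennreal (?C * 2 ^ k) * ?S)
      \<le> of_nat ?M * (ennreal (?\<kappa> ^ i * K) * ?A + ennreal (?C * 2 ^ k) * ?S)"
      unfolding sum_constant by (intro mult_right_mono) (auto intro!: card_mono)
  qed auto
  also have "\<dots> = ennreal (C1 k) * (\<Sum>j. osc f y (rho (Suc i + j)))
      + (ennreal (?C + ?M * (?C * 2 ^ k)) * ?S + ennreal (?M * K) * (ennreal (?\<kappa> ^ i) * ?A))"
  proof -
    have "of_nat ?M * (ennreal (?\<kappa> ^ i * K) * ?A) = ennreal (?M * K) * (ennreal (?\<kappa> ^ i) * ?A)"
      using K_nonneg by (simp add: mult.assoc[symmetric] ennreal_mult'[symmetric] ennreal_of_nat_eq_real_of_nat) (simp add: mult_ac)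
    moreover have "ennreal ?C * ?S + of_nat ?M * (ennreal (?C * 2 ^ k) * ?S) = ennreal (?C + ?M * (?C * 2 ^ k)) * ?S"
      using K_nonneg by (simp add: ennreal_of_nat_eq_real_of_nat distrib_right mult.assoc[symmetric] ennreal_mult'[symmetric])
    moreover have "a + b + (p + q) = a + ((b + q) + p)" for a b p q :: ennreal by (simp add: ac_simps)
    ultimately show ?thesis by (simp only: distrib_left[of "of_nat ?M"])
  qed
  also have "\<dots> \<le> ennreal (C1 k) * (\<Sum>j. osc f y (rho (Suc i + j)))
      + (ennreal (C1 k) * ?S + ennreal (C1 k) * (ennreal (?\<kappa> ^ i) * ?A))"
    using C1_ge[of k] by (intro add_left_mono add_mono mult_right_mono ennreal_leI) auto
  finally show ?thesis by (simp only: distrib_left)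
qed

end

subsection \<open>The measure on a d-set and porosity\<close>

lemma d_set_cube_sets:
  assumes "d_set d S" "w \<in> S" "0 < r" "r \<le> 1"
  shows "cube w r \<inter> S \<in> sets (hausdorff_measure d)"
proof (rule ccontr)
  assume "cube w r \<inter> S \<notin> sets (hausdorff_measure d)"
  then have "emeasure (hausdorff_measure d) (cube w r \<inter> S) = 0"
    by (rule emeasure_notin_sets)
  moreover obtain c where "c > 0" "ennreal (c * r powr d) \<le> emeasure (hausdorff_measure d) (cube w r \<inter> S)"
    using assms unfolding d_set_def by blast
  ultimately show False using assms by (simp add: ennreal_eq_0_iff mult_le_0_iff)
qed

text \<open>A set for which the lower mass bound holds is automatically measurable, since non-measurable
  sets have \<^const>\<open>emeasure\<close> zero. This gives the measurability of all Borel subsets of \<open>S\<close>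
  without Caratheodory's criterion for metric outer measures.\<close>

lemma d_set_open_Int_sets:
  fixes S :: "(real^'n) set"
  assumes S: "d_set d S" and U: "open U"
  shows "U \<inter> S \<in> sets (hausdorff_measure d)"
proof -
  obtain D where D: "countable D" "D \<subseteq> S" "S \<subseteq> closure D" using separable by blast
  \<comment> \<open>Centres in a countable dense subset of \<open>S\<close> and rational radii at
    most 1: a countable family of sets already known to be measurable.\<close>
  define I where "I = {(w, q :: rat). w \<in> D \<and> 0 < q \<and> q \<le> 1 \<and> cube w (of_rat q) \<subseteq> U}"
  have "countable I"
    by (rule countable_subset[of _ "D \<times> UNIV"]) (use D in \<open>auto simp: I_def\<close>)
  have "U \<inter> S = (\<Union>(w, q)\<in>I. cube w (of_rat q) \<inter> S)"
  proof (intro equalityI subsetI)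
    fix x assume x: "x \<in> U \<inter> S"
    then obtain e where e: "e > 0" "ball x e \<subseteq> U" using U openE by blast
    \<comment> \<open>The Euclidean norm is at most \<open>CARD('n)\<close> times
      \<open>infnorm\<close>, so this choice keeps a cube of radius below \<open>e'\<close>, with
      centre within \<open>e' / 2\<close> of \<open>x\<close>, inside the ball of radius
      \<open>e\<close>. The minimum with 1 keeps the radius in the range of the mass bounds.\<close>
    define e' where "e' = min e 1 / (2 * (CARD('n) + 1))"
    have e': "0 < e'" "e' < 1" using e by (auto simp: e'_def min_def divide_simps)
    obtain w where w: "w \<in> D" "dist w x < e' / 2"
      using x D e' by (meson IntD2 closure_approachable half_gt_zero subsetD)
    obtain q :: rat where q: "e' / 2 < of_rat q" "of_rat q < e'"
      using of_rat_dense[of "e' / 2" e'] e' by auto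
    have wx: "infnorm (x - w) < e' / 2"
      using infnorm_le_norm[of "x - w"] w by (simp add: dist_norm norm_minus_commute)
    have "x \<in> cube w (of_rat q)" using wx q by (simp add: cube_def)
    moreover have "cube w (of_rat q) \<subseteq> U"
    proof
      fix z assume "z \<in> cube w (of_rat q)"
      then have "infnorm (z - w) < e'" using q by (simp add: cube_def)
      have "norm (z - w) \<le> sqrt DIM(real^'n) * infnorm (z - w)" by (rule norm_le_infnorm)
      also have "sqrt DIM(real^'n) \<le> real CARD('n)"
        by (rule real_le_lsqrt) (simp_all add: power2_eq_square)
      finally have "norm (z - w) \<le> real CARD('n) * infnorm (z - w)" 
        by (simp add: mult_right_mono infnorm_pos_le)
      also have "\<dots> \<le> real CARD('n) * e'" using \<open>infnorm (z - w) < e'\<close> by (intro mult_left_mono) auto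
      finally have "dist z x \<le> real CARD('n) * e' + e' / 2"
        using w dist_triangle[of z x w] by (simp add: dist_norm norm_minus_commute)
      also have "\<dots> < (2 * (CARD('n) + 1)) * e'" using e' by (simp add: algebra_simps add_pos_nonneg)
      also have "\<dots> \<le> e" by (simp add: e'_def)
      finally show "z \<in> U" using e by (auto simp: dist_commute)
    qed
    moreover have "0 < q" "q \<le> 1"
      using q e' by (metis less_trans half_gt_zero zero_less_of_rat_iff)
        (metis less_eq_real_def less_trans of_rat_1 of_rat_less_eq q(2) e'(2))
    ultimately have "(w, q) \<in> I" "x \<in> cube w (of_rat q) \<inter> S" using w x by (auto simp: I_def)
    then show "x \<in> (\<Union>(w, q)\<in>I. cube w (of_rat q) \<inter> S)" by blast
  qed (auto simp: I_def)
  also have "\<dots> \<in> sets (hausdorff_measure d)"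
  proof (rule sets.countable_UN'[OF \<open>countable I\<close>], clarify)
    fix w q assume "(w, q) \<in> I"
    then show "cube w (of_rat q) \<inter> S \<in> sets (hausdorff_measure d)"
      using D by (intro d_set_cube_sets[OF S]) (auto simp: I_def)
  qed
  finally show ?thesis .
qed

text \<open>The identity carries the restricted Hausdorff measure to the Borel sigma-algebra. For a
  \<open>d\<close>-set the result is sigma-finite, as Tonelli's theorem requires, and integrals of
  Borel functions are unchanged.\<close>

definition trace_measure :: "real \<Rightarrow> (real^'n) set \<Rightarrow> (real^'n) measure" where
  "trace_measure d S = distr (restrict_space (hausdorff_measure d) S) borel (\<lambda>x. x)"

lemma sets_trace_measure [simp, measurable_cong]: "sets (trace_measure d S) = sets borel"
  by (simp add: trace_measure_def)

lemma space_hausdorff_measure [simp]: "space (hausdorff_measure d) = UNIV"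
  by (simp add: hausdorff_measure_def)

context
  fixes S :: "(real^'n) set" and d :: real
  assumes S: "d_set d S"
begin

lemma d_set_sets: "S \<in> sets (hausdorff_measure d)"
  using d_set_open_Int_sets[OF S, of UNIV] by simp

lemma measurable_id_trace: "(\<lambda>x. x) \<in> restrict_space (hausdorff_measure d) S \<rightarrow>\<^sub>M borel"
proof (rule borel_measurableI)
  fix U :: "(real^'n) set" assume "open U"
  then show "(\<lambda>x. x) -` U \<inter> space (restrict_space (hausdorff_measure d) S) \<in> sets (restrict_space (hausdorff_measure d) S)"
    using d_set_open_Int_sets[OF S, of U] d_set_sets
    by (simp add: space_restrict_space sets_restrict_space_iff)
qed

lemma nn_integral_trace_measure:
  "u \<in> borel_measurable borel \<Longrightarrow> (\<integral>\<^sup>+x. u x \<partial>restrict_space (hausdorff_measure d) S) = (\<integral>\<^sup>+x. u x \<partial>trace_measure d S)"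
  unfolding trace_measure_def by (subst nn_integral_distr[OF measurable_id_trace]) auto

lemma emeasure_trace_measure:
  assumes "A \<in> sets borel"
  shows "emeasure (trace_measure d S) A = emeasure (hausdorff_measure d) (A \<inter> S)"
  unfolding trace_measure_def using assms d_set_sets
  by (simp add: emeasure_distr[OF measurable_id_trace] space_restrict_space emeasure_restrict_space)

text \<open>\<open>u\<close> may be nonmeasurable. This is how integrals involving the trace are
  bounded by integrals of Borel functions.\<close>

lemma nn_integral_hausdorff_le:
  assumes [measurable]: "v \<in> borel_measurable borel" "Q \<in> sets borel"
    and le: "\<And>y. y \<in> Q \<Longrightarrow> y \<in> S \<Longrightarrow> u y \<le> v y"
  shows "(\<integral>\<^sup>+y\<in>Q \<inter> S. u y \<partial>hausdorff_measure d) \<le> (\<integral>\<^sup>+y\<in>Q. v y \<partial>trace_measure d S)"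
proof -
  have "(\<integral>\<^sup>+y\<in>Q \<inter> S. u y \<partial>hausdorff_measure d) \<le> (\<integral>\<^sup>+y. (v y * indicator Q y) * indicator S y \<partial>hausdorff_measure d)"
    using le by (intro nn_integral_mono) (auto simp: indicator_def)
  also have "\<dots> = (\<integral>\<^sup>+y. v y * indicator Q y \<partial>restrict_space (hausdorff_measure d) S)"
    using d_set_sets by (subst nn_integral_restrict_space) auto
  also have "\<dots> = (\<integral>\<^sup>+y\<in>Q. v y \<partial>trace_measure d S)"
    by (rule nn_integral_trace_measure) measurable
  finally show ?thesis .
qed

lemma nn_integral_restrict_le:
  assumes [measurable]: "v \<in> borel_measurable borel" and le: "\<And>y. y \<in> S \<Longrightarrow> u y \<le> v y"
  shows "(\<integral>\<^sup>+y. u y \<partial>restrict_space (hausdorff_measure d) S) \<le> (\<integral>\<^sup>+y. v y \<partial>trace_measure d S)"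
proof -
  have "(\<integral>\<^sup>+y. u y \<partial>restrict_space (hausdorff_measure d) S) \<le> (\<integral>\<^sup>+y. v y \<partial>restrict_space (hausdorff_measure d) S)"
    by (intro nn_integral_mono le) (simp add: space_restrict_space)
  then show ?thesis by (simp add: nn_integral_trace_measure)
qed

end

locale regular_measure =
  fixes \<nu> :: "(real^'n) measure" and S :: "(real^'n) set" and d c1 c2 :: real
  assumes sets_nu [simp, measurable_cong]: "sets \<nu> = sets borel"
    and sigma_finite_nu: "sigma_finite_measure \<nu>"
    and c1: "0 < c1" and c2: "0 < c2"
    and lower: "\<And>w r. w \<in> S \<Longrightarrow> 0 < r \<Longrightarrow> r \<le> 1 \<Longrightarrow> ennreal (c1 * r powr d) \<le> emeasure \<nu> (cube w r)"
    and upper: "\<And>w r. w \<in> S \<Longrightarrow> 0 < r \<Longrightarrow> r \<le> 1 \<Longrightarrow> emeasure \<nu> (cube w r) \<le> ennreal (c2 * r powr d)"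
    and null: "emeasure \<nu> (- S) = 0"
    and closed_S: "closed S"
    and d_less: "d < CARD('n)"

lemma d_set_regular_measure:
  fixes S :: "(real^'n) set"
  assumes S: "d_set d S" and d: "d < CARD('n)"
  shows "\<exists>c1 c2. regular_measure (trace_measure d S) S d c1 c2"
proof -
  obtain c1 c2 where c: "c1 > 0" "c2 > 0"
    and bd: "\<And>w r. w \<in> S \<Longrightarrow> 0 < r \<Longrightarrow> r \<le> 1 \<Longrightarrow>
        ennreal (c1 * r powr d) \<le> emeasure (trace_measure d S) (cube w r) \<and>
        emeasure (trace_measure d S) (cube w r) \<le> ennreal (c2 * r powr d)"
    using S unfolding d_set_def by (auto simp: emeasure_trace_measure[OF S])
  have cl: "closed S" using S by (simp add: d_set_def)
  have null: "emeasure (trace_measure d S) (- S) = 0"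
    using cl by (simp add: emeasure_trace_measure[OF S] borel_comp)
  obtain D where D: "countable D" "D \<subseteq> S" "S \<subseteq> closure D" using separable by blast
  have sf: "sigma_finite_measure (trace_measure d S)"
  proof
    have cover: "x \<in> (\<Union>w\<in>D. cube w 1)" if x: "x \<in> S" for x
    proof -
      obtain w where "w \<in> D" "dist w x < 1" using x D by (meson closure_approachable zero_less_one subsetD)
      moreover from this have "infnorm (x - w) \<le> 1"
        using infnorm_le_norm[of "x - w"] by (simp add: dist_norm norm_minus_commute)
      ultimately show ?thesis by (auto simp: cube_def)
    qed
    show "\<exists>A. countable A \<and> A \<subseteq> sets (trace_measure d S) \<and> \<Union> A = space (trace_measure d S) \<and>
        (\<forall>a\<in>A. emeasure (trace_measure d S) a \<noteq> \<infinity>)"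
    proof (intro exI conjI)
      \<comment> \<open>The complement of \<open>S\<close> is a null set, and unit cubes about a
        countable dense subset cover \<open>S\<close> with finite mass each.\<close>
      let ?A = "insert (- S) ((\<lambda>w. cube w 1) ` D)"
      show "countable ?A" using D by simp
      show "?A \<subseteq> sets (trace_measure d S)" using cl by (auto simp: borel_comp)
      show "\<Union> ?A = space (trace_measure d S)" using cover by (auto simp: trace_measure_def)
      show "\<forall>a\<in>?A. emeasure (trace_measure d S) a \<noteq> \<infinity>"
      proof
        fix a assume "a \<in> ?A"
        then consider "a = - S" | w where "w \<in> S" "a = cube w 1" using D(2) by blast
        then show "emeasure (trace_measure d S) a \<noteq> \<infinity>"
        proof cases
          case (2 w)
          then have "emeasure (trace_measure d S) a \<le> ennreal (c2 * 1 powr d)" using bd[of w 1] by simp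
          also have "\<dots> < \<infinity>" by simp
          finally show ?thesis by simp
        qed (simp add: null)
      qed
    qed
  qed
  have "regular_measure (trace_measure d S) S d c1 c2"
    by (rule regular_measure.intro)
      (fact sets_trace_measure sf c bd[THEN conjunct1] bd[THEN conjunct2] null cl d)+
  then show ?thesis by blast
qed

lemma measurable_in_cube [measurable]:
  fixes r :: real
  shows "Measurable.pred (borel \<Otimes>\<^sub>M borel) (\<lambda>p :: (real^'n) \<times> (real^'n). snd p \<in> cube (fst p) r)"
proof -
  have "closed {p :: (real^'n) \<times> (real^'n). snd p \<in> cube (fst p) r}"
    unfolding cube_iff by (intro closed_Collect_all closed_Collect_le continuous_intros)
  then have "{p :: (real^'n) \<times> (real^'n). snd p \<in> cube (fst p) r} \<in> sets borel"
    by (rule borel_closed)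
  then show ?thesis by (simp add: borel_prod pred_def)
qed

text \<open>Tonelli's theorem together with the symmetry
  \<open>x \<in> cube y r \<longleftrightarrow> y \<in> cube x r\<close>. It converts integrals over
  \<open>S\<close> of cube integrals into Lebesgue integrals, and averages back into the original
  measure.\<close>

lemma nn_integral_cube_swap:
  fixes \<mu> \<nu> :: "(real^'n) measure"
  assumes sets[simp, measurable_cong]: "sets \<mu> = sets borel" "sets \<nu> = sets borel"
    and sf: "sigma_finite_measure \<mu>" "sigma_finite_measure \<nu>"
    and u[measurable]: "u \<in> borel_measurable borel" and v[measurable]: "v \<in> borel_measurable borel"
  shows "(\<integral>\<^sup>+y. v y * (\<integral>\<^sup>+x\<in>cube y r. u x \<partial>\<mu>) \<partial>\<nu>) = (\<integral>\<^sup>+x. u x * (\<integral>\<^sup>+y\<in>cube x r. v y \<partial>\<nu>) \<partial>\<mu>)"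
proof -
  interpret pair_sigma_finite \<nu> \<mu> using sf by (simp add: pair_sigma_finite_def)
  let ?f = "\<lambda>y x. v y * (u x * indicator (cube y r) x)"
  have [measurable]: "(\<lambda>p. indicator (cube (fst p) r) (snd p) :: ennreal) \<in> borel_measurable (borel \<Otimes>\<^sub>M borel)"
  proof -
    have "(\<lambda>p. if snd p \<in> cube (fst p) r then 1 else 0 :: ennreal) \<in> borel_measurable (borel \<Otimes>\<^sub>M borel :: ((real^'n) \<times> (real^'n)) measure)"
      by measurable
    then show ?thesis by (simp add: indicator_def)
  qed
  have "(\<lambda>p. ?f (fst p) (snd p)) \<in> borel_measurable (borel \<Otimes>\<^sub>M borel)" by measurable
  then have m: "case_prod ?f \<in> borel_measurable (\<nu> \<Otimes>\<^sub>M \<mu>)"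
    using sets_pair_measure_cong[OF sets(2,1)] by (simp add: case_prod_unfold cong: measurable_cong_sets)
  have "(\<integral>\<^sup>+y. v y * (\<integral>\<^sup>+x\<in>cube y r. u x \<partial>\<mu>) \<partial>\<nu>) = (\<integral>\<^sup>+y. \<integral>\<^sup>+x. ?f y x \<partial>\<mu> \<partial>\<nu>)"
    by (subst nn_integral_cmult) auto
  also have "\<dots> = (\<integral>\<^sup>+x. \<integral>\<^sup>+y. ?f y x \<partial>\<nu> \<partial>\<mu>)"
    by (rule Fubini'[OF m, symmetric])
  also have "\<dots> = (\<integral>\<^sup>+x. \<integral>\<^sup>+y. u x * (v y * indicator (cube x r) y) \<partial>\<nu> \<partial>\<mu>)"
    by (intro nn_integral_cong) (auto simp: indicator_def cube_sym mult.commute)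
  also have "\<dots> = (\<integral>\<^sup>+x. u x * (\<integral>\<^sup>+y\<in>cube x r. v y \<partial>\<nu>) \<partial>\<mu>)"
    by (subst nn_integral_cmult) auto
  finally show ?thesis .
qed

section \<open>Porosity of the set\<close>

definition nbhd :: "(real^'n) set \<Rightarrow> real \<Rightarrow> (real^'n) set" where
  "nbhd S t = {x. \<exists>s\<in>S. x \<in> cube s t}"

text \<open>The neighbourhood is the sum of a closed and a compact set.\<close>

lemma nbhd_closed:
  assumes "closed S"
  shows "closed (nbhd S t)"
proof -
  have "nbhd S t = (\<Union>s\<in>S. \<Union>z\<in>cube 0 t. {s + z})"
  proof (intro equalityI subsetI)
    fix x assume "x \<in> nbhd S t"
    then obtain s where "s \<in> S" "x - s \<in> cube 0 t" by (auto simp: nbhd_def cube_def)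
    then show "x \<in> (\<Union>s\<in>S. \<Union>z\<in>cube 0 t. {s + z})" by force
  qed (auto simp: nbhd_def cube_def intro!: bexI)
  then show ?thesis using closed_compact_sums[OF assms compact_cube] by simp
qed

lemma nbhd_mono: "s \<le> t \<Longrightarrow> nbhd S s \<subseteq> nbhd S t"
  using cube_mono by (fastforce simp: nbhd_def)

context regular_measure begin

lemma space_nu [simp]: "space \<nu> = UNIV"
  using sets_eq_imp_space_eq[OF sets_nu] by simp

lemma AE_in_S: "AE y in \<nu>. y \<in> S"
  by (rule AE_I[OF _ null]) (use closed_S in \<open>auto simp: borel_comp\<close>)

text \<open>A cube either misses \<open>S\<close>, or lies in a cube of twice the radius centred in
  \<open>S\<close>; hence the restriction to radii at most 1/2.\<close>

lemma upper_anywhere: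
  assumes "0 < r" "r \<le> 1 / 2"
  shows "emeasure \<nu> (cube x r) \<le> ennreal (c2 * 2 powr d * r powr d)"
proof (cases "cube x r \<inter> S = {}")
  case True
  then have "emeasure \<nu> (cube x r) \<le> emeasure \<nu> (- S)"
    using closed_S by (intro emeasure_mono) (auto simp: borel_comp)
  then show ?thesis by (simp add: null)
next
  case False
  then obtain s where s: "s \<in> S" "x \<in> cube s r" by (auto simp: cube_sym)
  have "emeasure \<nu> (cube x r) \<le> emeasure \<nu> (cube s (2 * r))"
    using s by (intro emeasure_mono cube_subset) auto
  also have "\<dots> \<le> ennreal (c2 * (2 * r) powr d)" using assms s by (intro upper) auto
  finally show ?thesis using assms by (simp add: powr_mult mult.assoc)
qed

text \<open>Double counting. Each \<open>x\<close> in the neighbourhood has mass at least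
  \<open>c1 * (e * r) powr d\<close> within \<open>cube x (2 * e * r)\<close>, while a point
  \<open>z\<close> is counted only for \<open>x\<close> in a cube of volume
  \<open>(4 * e * r) ^ CARD('n)\<close>. All relevant \<open>z\<close> lie in
  \<open>cube y (2 * r)\<close>, whose mass is bounded above. The gain is the positive power of
  \<open>e\<close>, as \<open>d < CARD('n)\<close>.\<close>

lemma nbhd_thin:
  assumes y: "y \<in> S" and r: "0 < r" "r \<le> 1 / 2" and e: "0 < e" "e \<le> 1 / 2"
  shows "emeasure lborel (cube y r \<inter> nbhd S (e * r))
    \<le> ennreal (c2 / c1 * 2 powr d * 4 ^ CARD('n) * e powr (CARD('n) - d) * r ^ CARD('n))"
proof -
  let ?E = "cube y r \<inter> nbhd S (e * r)" and ?t = "2 * (e * r)"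
  have [measurable]: "?E \<in> sets borel" using nbhd_closed[OF closed_S] by (auto intro: borel_closed)
  have er: "0 < e * r" "e * r \<le> 1" "?t \<le> r" using e r by (auto intro: mult_le_one)
  let ?a = "c1 * (e * r) powr d"
  have a: "0 < ?a" using c1 e r by simp
  have "ennreal ?a * emeasure lborel ?E = (\<integral>\<^sup>+x. ennreal ?a * indicator ?E x \<partial>lborel)"
    by (simp add: nn_integral_cmult_indicator)
  also have "\<dots> \<le> (\<integral>\<^sup>+x. indicator ?E x * (\<integral>\<^sup>+z\<in>cube x ?t. 1 \<partial>\<nu>) \<partial>lborel)"
  proof (intro nn_integral_mono)
    fix x
    show "ennreal ?a * indicator ?E x \<le> indicator ?E x * (\<integral>\<^sup>+z\<in>cube x ?t. 1 \<partial>\<nu>)"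
    proof (cases "x \<in> ?E")
      case True
      then obtain s where s: "s \<in> S" "x \<in> cube s (e * r)" by (auto simp: nbhd_def)
      have "ennreal ?a \<le> emeasure \<nu> (cube s (e * r))" using s er by (intro lower) auto
      also have "\<dots> \<le> emeasure \<nu> (cube x ?t)"
        using s by (intro emeasure_mono cube_subset[of s x "e * r"]) (auto simp: cube_sym)
      finally show ?thesis using True by simp
    qed simp
  qed
  also have "\<dots> = (\<integral>\<^sup>+z. 1 * (\<integral>\<^sup>+x\<in>cube z ?t. indicator ?E x \<partial>lborel) \<partial>\<nu>)"
    by (rule nn_integral_cube_swap[symmetric]) (auto intro: sigma_finite_nu sigma_finite_lborel)
  also have "\<dots> \<le> (\<integral>\<^sup>+z. ennreal ((2 * ?t) ^ CARD('n)) * indicator (cube y (2 * r)) z \<partial>\<nu>)"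
  proof (intro nn_integral_mono)
    fix z
    show "1 * (\<integral>\<^sup>+x\<in>cube z ?t. indicator ?E x \<partial>lborel) \<le> ennreal ((2 * ?t) ^ CARD('n)) * indicator (cube y (2 * r)) z"
    proof (cases "z \<in> cube y (2 * r)")
      case True
      have "(\<integral>\<^sup>+x\<in>cube z ?t. indicator ?E x \<partial>lborel) \<le> (\<integral>\<^sup>+x. indicator (cube z ?t) x \<partial>lborel)"
        by (intro nn_integral_mono) (auto simp: indicator_def)
      also have "\<dots> = ennreal ((2 * ?t) ^ CARD('n))"
        using emeasure_cube[of ?t z] er by simp
      finally show ?thesis using True by simp
    next
      case False
      have nin: "x \<notin> ?E" if "x \<in> cube z ?t" for x
      proof
        assume "x \<in> ?E"
        then have "cube x ?t \<subseteq> cube y (2 * r)" using er by (intro cube_subset) auto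
        moreover have "z \<in> cube x ?t" using that by (simp add: cube_sym)
        ultimately show False using False by blast
      qed
      have "(\<integral>\<^sup>+x\<in>cube z ?t. indicator ?E x \<partial>lborel) = (\<integral>\<^sup>+x. 0 \<partial>(lborel :: (real^'n) measure))"
        by (rule nn_integral_cong) (use nin in \<open>auto simp: indicator_def\<close>)
      then show ?thesis by simp
    qed
  qed
  also have "\<dots> = ennreal ((2 * ?t) ^ CARD('n)) * emeasure \<nu> (cube y (2 * r))"
    by (simp add: nn_integral_cmult_indicator)
  also have "\<dots> \<le> ennreal ((2 * ?t) ^ CARD('n)) * ennreal (c2 * (2 * r) powr d)"
    using y r by (intro mult_left_mono upper) auto
  finally have "ennreal ?a * emeasure lborel ?E \<le> ennreal ((2 * ?t) ^ CARD('n) * (c2 * (2 * r) powr d))"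
    using er c2 by (simp add: ennreal_mult)
  then have "ennreal (1 / ?a) * (ennreal ?a * emeasure lborel ?E) \<le> ennreal (1 / ?a) * ennreal ((2 * ?t) ^ CARD('n) * (c2 * (2 * r) powr d))"
    by (intro mult_left_mono) auto
  also have "ennreal (1 / ?a) * (ennreal ?a * emeasure lborel ?E) = emeasure lborel ?E"
    using a c1 e r by (simp add: mult.assoc[symmetric] ennreal_mult'[symmetric])
  also have "ennreal (1 / ?a) * ennreal ((2 * ?t) ^ CARD('n) * (c2 * (2 * r) powr d))
      = ennreal (c2 / c1 * 2 powr d * 4 ^ CARD('n) * e powr (CARD('n) - d) * r ^ CARD('n))"
  proof -
    have "(2 * ?t) ^ CARD('n) = 4 ^ CARD('n) * e powr CARD('n) * r ^ CARD('n)"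
      using e by (simp add: power_mult_distrib powr_realpow)
    then have "1 / ?a * ((2 * ?t) ^ CARD('n) * (c2 * (2 * r) powr d))
        = c2 / c1 * 2 powr d * 4 ^ CARD('n) * e powr (CARD('n) - d) * r ^ CARD('n)"
      using e r c1 by (simp add: powr_mult powr_diff)
    then show ?thesis using a by (simp add: ennreal_mult'[symmetric])
  qed
  finally show ?thesis .
qed

definition porosity :: "nat \<Rightarrow> bool" where
  "porosity \<kappa> \<longleftrightarrow> (\<forall>y\<in>S. \<forall>j. ennreal ((2 * rho j) ^ CARD('n) / 2) \<le> emeasure lborel (cube y (rho j) - nbhd S (rho (j + \<kappa>))))"

text \<open>\<open>\<kappa>\<close> is so large that \<open>nbhd_thin\<close> with
  \<open>e = (1 / 2) ^ \<kappa>\<close> removes at most half of every cube. It is independent of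
  \<open>y\<close> and \<open>j\<close> because that bound is proportional to
  \<open>r ^ CARD('n)\<close>.\<close>

lemma porous: "\<exists>\<kappa>. porosity \<kappa>"
proof -
  let ?B = "c2 / c1 * 2 powr d * 4 ^ CARD('n)"
  have "(1 / 2) powr (CARD('n) - d) < 1"
    using d_less by (simp add: powr_def ln_div)
  then have "(\<lambda>k. ?B * ((1 / 2) powr (CARD('n) - d)) ^ k) \<longlonglongrightarrow> ?B * 0"
    by (intro tendsto_mult tendsto_const LIMSEQ_power_zero) auto
  then have "\<forall>\<^sub>F k in sequentially. ?B * ((1 / 2) powr (CARD('n) - d)) ^ k < 1 / 2"
    by (intro order_tendstoD) auto
  then have "\<forall>\<^sub>F k in sequentially. ?B * ((1 / 2) powr (CARD('n) - d)) ^ k < 1 / 2 \<and> 1 \<le> k"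
    using eventually_ge_at_top[of 1] by eventually_elim auto
  then obtain \<kappa> where \<kappa>: "?B * ((1 / 2) powr (CARD('n) - d)) ^ \<kappa> < 1 / 2" "1 \<le> \<kappa>"
    by (auto simp: eventually_sequentially)
  let ?e = "(1 / 2 :: real) ^ \<kappa>"
  have e: "0 < ?e" "?e \<le> 1 / 2" using power_decreasing[OF \<kappa>(2), of "1 / 2 :: real"] by auto
  have pe: "((1 / 2) powr (CARD('n) - d)) ^ \<kappa> = ?e powr (CARD('n) - d)"
  proof -
    have "?e powr (CARD('n) - d) = ((1 / 2) powr real \<kappa>) powr (CARD('n) - d)"
      by (subst powr_realpow) auto
    then show ?thesis by (simp only: powr_powr) (simp add: powr_power)
  qed
  show ?thesis
    unfolding porosity_def
  proof (intro exI ballI allI)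
    fix y j assume y: "y \<in> S"
    let ?r = "rho j" and ?E = "cube y (rho j) \<inter> nbhd S (rho (j + \<kappa>))"
    have er: "rho (j + \<kappa>) = ?e * ?r" by (simp add: rho_def power_add)
    have [measurable]: "nbhd S (rho (j + \<kappa>)) \<in> sets borel" by (intro borel_closed nbhd_closed closed_S)
    have "emeasure lborel ?E \<le> ennreal (?B * ?e powr (CARD('n) - d) * ?r ^ CARD('n))"
      unfolding er using y e rho_le_half[of j] by (intro nbhd_thin) auto
    also have "\<dots> \<le> ennreal ((2 * ?r) ^ CARD('n) / 2)"
    proof (rule ennreal_leI)
      have "?B * ?e powr (CARD('n) - d) * ?r ^ CARD('n) \<le> 1 / 2 * ?r ^ CARD('n)"
        using \<kappa>(1) unfolding pe by (intro mult_right_mono) auto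
      also have "\<dots> \<le> (2 * ?r) ^ CARD('n) / 2" by (simp add: power_mult_distrib)
      finally show "?B * ?e powr (CARD('n) - d) * ?r ^ CARD('n) \<le> (2 * ?r) ^ CARD('n) / 2" .
    qed
    finally have E: "emeasure lborel ?E \<le> ennreal ((2 * ?r) ^ CARD('n) / 2)" .
    have "ennreal ((2 * ?r) ^ CARD('n) / 2) + ennreal ((2 * ?r) ^ CARD('n) / 2) = emeasure lborel (cube y ?r)"
      by (simp add: emeasure_cube flip: ennreal_plus)
    also have "\<dots> = emeasure lborel ?E + emeasure lborel (cube y ?r - nbhd S (rho (j + \<kappa>)))"
      by (subst plus_emeasure) (auto intro!: arg_cong2[where f = emeasure])
    also have "\<dots> \<le> ennreal ((2 * ?r) ^ CARD('n) / 2) + emeasure lborel (cube y ?r - nbhd S (rho (j + \<kappa>)))"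
      using E by (intro add_right_mono)
    finally show "ennreal ((2 * ?r) ^ CARD('n) / 2) \<le> emeasure lborel (cube y ?r - nbhd S (rho (j + \<kappa>)))"
      by (simp add: ennreal_add_left_cancel_le)
  qed
qed

end

subsection \<open>Estimates in the mean\<close>

lemma rho_eq_powr: "rho j = 2 powr (- real (Suc j))"
  by (simp only: rho_def powr_minus powr_realpow[OF zero_less_numeral] power_one_over inverse_eq_divide)

definition layer :: "(real^'n) set \<Rightarrow> nat \<Rightarrow> nat \<Rightarrow> (real^'n) set" where
  "layer S \<kappa> j = nbhd S (rho j) - nbhd S (rho (j + \<kappa>))"

text \<open>The neighbourhoods shrink as \<open>j\<close> grows, so a point that enters its first
  layer at some index has left all layers \<open>\<kappa>\<close> indices later.\<close>

lemma sum_layers_le: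
  "(\<Sum>j. indicator (layer S \<kappa> j) x :: ennreal) \<le> of_nat \<kappa>"
proof -
  let ?J = "{j. x \<in> layer S \<kappa> j}"
  have sub: "?J \<subseteq> {Inf ?J..<Inf ?J + \<kappa>}"
  proof
    fix j assume j: "j \<in> ?J"
    then have "Inf ?J \<in> ?J" by (intro Inf_nat_def1) auto
    moreover have "Inf ?J \<le> j" using j by (intro cInf_lower) auto
    moreover have "j < Inf ?J + \<kappa>"
    proof (rule ccontr)
      assume "\<not> j < Inf ?J + \<kappa>"
      then have "nbhd S (rho j) \<subseteq> nbhd S (rho (Inf ?J + \<kappa>))" by (intro nbhd_mono rho_antimono) simp
      then show False using j \<open>Inf ?J \<in> ?J\<close> by (auto simp: layer_def)
    qed
    ultimately show "j \<in> {Inf ?J..<Inf ?J + \<kappa>}" by simp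
  qed
  then have fin: "finite ?J" by (rule finite_subset) simp
  have "(\<Sum>j. indicator (layer S \<kappa> j) x :: ennreal)
      = (\<Sum>j\<in>?J. indicator (layer S \<kappa> j) x)"
    by (rule suminf_finite[OF fin]) auto
  also have "\<dots> = of_nat (card ?J)" by simp
  also have "\<dots> \<le> of_nat \<kappa>" using card_mono[OF _ sub] by simp
  finally show ?thesis .
qed

text \<open>Jensen's inequality for the restriction of the measure to a cube, written as a
  density.\<close>

lemma nn_integral_cube_ennpowr_le:
  fixes \<mu> :: "(real^'n) measure"
  assumes [measurable_cong]: "sets \<mu> = sets borel" and u[measurable]: "u \<in> borel_measurable borel"
    and Q: "emeasure \<mu> (cube y r) \<le> ennreal B" "0 < B" and p: "1 < p"
  shows "(\<integral>\<^sup>+x\<in>cube y r. u x \<partial>\<mu>) ennpowr p \<le> ennreal (B powr (p - 1)) * (\<integral>\<^sup>+x\<in>cube y r. u x ennpowr p \<partial>\<mu>)"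
proof -
  have int: "(\<integral>\<^sup>+x. v x \<partial>density \<mu> (indicator (cube y r))) = (\<integral>\<^sup>+x\<in>cube y r. v x \<partial>\<mu>)"
    if [measurable]: "v \<in> borel_measurable borel" for v
    by (subst nn_integral_density) (auto simp: mult.commute)
  have "emeasure (density \<mu> (indicator (cube y r))) (space (density \<mu> (indicator (cube y r)))) = emeasure \<mu> (cube y r)"
    using int[of "\<lambda>_. 1"] sets_eq_imp_space_eq[OF assms(1)] by simp
  then have "(\<integral>\<^sup>+x. u x \<partial>density \<mu> (indicator (cube y r))) ennpowr p
      \<le> ennreal (B powr (p - 1)) * (\<integral>\<^sup>+x. u x ennpowr p \<partial>density \<mu> (indicator (cube y r)))"
    using Q p by (intro nn_integral_ennpowr_le) auto
  then show ?thesis by (simp add: int)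
qed

locale trace_setting = coefficient_kernel m \<Phi> K + regular_measure \<nu> S d c1 c2
  for m :: nat and \<Phi> :: "('n::finite \<Rightarrow> nat) \<Rightarrow> real^'n \<Rightarrow> real" and K :: real
    and \<nu> :: "(real^'n) measure" and S :: "(real^'n) set" and d c1 c2 :: real +
  fixes p \<alpha> :: real
  assumes p: "1 < p" and alpha: "(real CARD('n) - d) / p < \<alpha>" and m_pos: "0 < m"
begin

text \<open>The smoothness of the trace; \<open>(1 / theta) ^ i\<close> is the weight
  \<open>2 powr (real i * beta)\<close> of the theorem in the form used by the Hardy
  inequalities.\<close>

definition beta :: real where "beta = \<alpha> - (real CARD('n) - d) / p"
definition theta :: real where "theta = 2 powr (- beta)"

lemma beta_pos: "0 < beta" using alpha by (simp add: beta_def)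

lemma beta_less: "beta < \<alpha>" using d_less p by (simp add: beta_def)

lemma theta: "0 < theta" "theta < 1"
  using beta_pos by (auto simp: theta_def powr_minus divide_simps)

lemma inverse_theta_power: "(1 / theta) ^ i = 2 powr (real i * beta)"
  by (simp add: theta_def powr_minus powr_power divide_inverse)

definition Lp_mass :: "(real^'n \<Rightarrow> real) \<Rightarrow> ennreal" where
  "Lp_mass f = (\<integral>\<^sup>+x. ennreal \<bar>f x\<bar> ennpowr p \<partial>lborel)"

text \<open>The function defining the norm for \<open>q = \<infinity>\<close>, restricted to dyadic
  radii and with oscillations in place of best approximation.\<close>

definition sup_osc :: "(real^'n \<Rightarrow> real) \<Rightarrow> real^'n \<Rightarrow> ennreal" where
  "sup_osc f x = (SUP i. ennreal (2 powr (real i * \<alpha>)) * osc f x (rho i))"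

definition osc_mass :: "(real^'n \<Rightarrow> real) \<Rightarrow> ennreal" where
  "osc_mass f = (\<integral>\<^sup>+x. sup_osc f x ennpowr p \<partial>lborel)"

definition besov_sum :: "(real^'n \<Rightarrow> real) \<Rightarrow> real^'n \<Rightarrow> ennreal" where
  "besov_sum f y = (\<Sum>j. (ennreal ((1 / theta) ^ j) * osc f y (rho j)) ennpowr p)"

lemma measurable_osc_rho [measurable]:
  "f \<in> borel_measurable borel \<Longrightarrow> (\<lambda>y. osc f y (rho j)) \<in> borel_measurable borel"
  by (rule borel_measurable_osc) auto

lemma measurable_sup_osc [measurable]:
  assumes [measurable]: "f \<in> borel_measurable borel"
  shows "sup_osc f \<in> borel_measurable borel"
  unfolding sup_osc_def[abs_def] by measurable

lemma measurable_besov_sum [measurable]: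
  assumes [measurable]: "f \<in> borel_measurable borel"
  shows "besov_sum f \<in> borel_measurable borel"
  unfolding besov_sum_def[abs_def] by measurable

lemma osc_le_sup_osc: "osc f x (rho i) \<le> ennreal (2 powr (- (real i * \<alpha>))) * sup_osc f x"
proof -
  have "ennreal (2 powr (real i * \<alpha>)) * osc f x (rho i) \<le> sup_osc f x"
    unfolding sup_osc_def by (rule SUP_upper) simp
  then have "ennreal (2 powr (- (real i * \<alpha>))) * (ennreal (2 powr (real i * \<alpha>)) * osc f x (rho i))
      \<le> ennreal (2 powr (- (real i * \<alpha>))) * sup_osc f x"
    by (rule mult_left_mono) simp
  then show ?thesis
    by (simp add: mult.assoc[symmetric] ennreal_mult'[symmetric] powr_add[symmetric])
qed

text \<open>Jensen's inequality on each cube, then an exchange of the integrations. This controls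
  the scale \<open>rho 0\<close>, for which no coarser scale is available.\<close>

lemma cube_L1_mass_ex: "\<exists>C\<ge>0. \<forall>f. loc_int f \<longrightarrow> (\<integral>\<^sup>+y. cube_L1 f y (rho 0) ennpowr p \<partial>\<nu>) \<le> ennreal C * Lp_mass f"
proof (intro exI conjI allI impI)
  let ?r = "rho 0" and ?N = "CARD('n)"
  let ?C = "(1 / ?r ^ ?N) powr p * ((2 * ?r) ^ ?N) powr (p - 1)"
  let ?C' = "?C * (c2 * 2 powr d * ?r powr d)"
  show "0 \<le> ?C'" using c2 by simp
  fix f :: "real^'n \<Rightarrow> real" assume f: "loc_int f"
  note [measurable] = loc_intD[OF f]
  have pt: "cube_L1 f y ?r ennpowr p \<le> ennreal ?C * (\<integral>\<^sup>+x\<in>cube y ?r. ennreal \<bar>f x\<bar> ennpowr p \<partial>lborel)" for y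
  proof -
    have "cube_L1 f y ?r ennpowr p = ennreal ((1 / ?r ^ ?N) powr p) * (\<integral>\<^sup>+x\<in>cube y ?r. ennreal \<bar>f x\<bar> \<partial>lborel) ennpowr p"
      by (simp add: cube_L1_eq ennpowr_mult ennpowr_ennreal)
    also have "\<dots> \<le> ennreal ((1 / ?r ^ ?N) powr p) * (ennreal (((2 * ?r) ^ ?N) powr (p - 1)) * (\<integral>\<^sup>+x\<in>cube y ?r. ennreal \<bar>f x\<bar> ennpowr p \<partial>lborel))"
      using p by (intro mult_left_mono nn_integral_cube_ennpowr_le) (auto simp: emeasure_cube)
    finally show ?thesis by (simp add: ennreal_mult' mult.assoc)
  qed
  have "(\<integral>\<^sup>+y. cube_L1 f y ?r ennpowr p \<partial>\<nu>) \<le> (\<integral>\<^sup>+y. ennreal ?C * (\<integral>\<^sup>+x\<in>cube y ?r. ennreal \<bar>f x\<bar> ennpowr p \<partial>lborel) \<partial>\<nu>)"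
    by (intro nn_integral_mono pt)
  also have "\<dots> = (\<integral>\<^sup>+x. ennreal \<bar>f x\<bar> ennpowr p * (\<integral>\<^sup>+y\<in>cube x ?r. ennreal ?C \<partial>\<nu>) \<partial>lborel)"
    by (rule nn_integral_cube_swap) (auto intro: sigma_finite_nu sigma_finite_lborel)
  also have "\<dots> \<le> (\<integral>\<^sup>+x. ennreal \<bar>f x\<bar> ennpowr p * ennreal ?C' \<partial>lborel)"
  proof (intro nn_integral_mono mult_left_mono)
    fix x
    have "(\<integral>\<^sup>+y\<in>cube x ?r. ennreal ?C \<partial>\<nu>) = ennreal ?C * emeasure \<nu> (cube x ?r)"
      by (simp add: nn_integral_cmult_indicator)
    also have "\<dots> \<le> ennreal ?C * ennreal (c2 * 2 powr d * ?r powr d)"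
      by (intro mult_left_mono upper_anywhere rho_pos(1) rho_le_half) auto
    finally show "(\<integral>\<^sup>+y\<in>cube x ?r. ennreal ?C \<partial>\<nu>) \<le> ennreal ?C'" by (simp add: ennreal_mult')
  qed auto
  also have "\<dots> = ennreal ?C' * Lp_mass f"
    unfolding Lp_mass_def by (simp add: nn_integral_multc mult.commute)
  finally show "(\<integral>\<^sup>+y. cube_L1 f y ?r ennpowr p \<partial>\<nu>) \<le> ennreal ?C' * Lp_mass f" .
qed

text \<open>For every \<open>x\<close> in \<open>cube y (rho j)\<close> the oscillation at
  \<open>y\<close> is bounded by the one at \<open>x\<close> with doubled radius, hence by
  \<open>sup_osc f x\<close>. Averaging over only those \<open>x\<close> away from \<open>S\<close>
  places them in the layer; the factor 2 over the volume of the cube is the inverse of the porosity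
  bound.\<close>

lemma osc_layer_le:
  assumes f: "loc_int f" and \<kappa>: "porosity \<kappa>"
    and y: "y \<in> S" and j: "j = Suc i"
  shows "osc f y (rho j) ennpowr p
    \<le> ennreal (2 / (2 * rho j) ^ CARD('n) * (C0 * 2 ^ CARD('n) * 2 powr (- (real i * \<alpha>))) powr p)
      * (\<integral>\<^sup>+x\<in>cube y (rho j). sup_osc f x ennpowr p * indicator (layer S \<kappa> j) x \<partial>lborel)"
    (is "_ \<le> ennreal (?a * ?B powr p) * ?I")
proof -
  note [measurable] = loc_intD[OF f]
  have [measurable]: "nbhd S t \<in> sets borel" for t by (intro borel_closed nbhd_closed closed_S)
  have [measurable]: "layer S \<kappa> j \<in> sets borel" unfolding layer_def by measurable
  let ?\<Gamma> = "cube y (rho j) - nbhd S (rho (j + \<kappa>))"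
  have B: "0 \<le> ?B" using C0_ge_1 by simp
  have a: "0 < ?a" by simp
  have pt: "osc f y (rho j) ennpowr p \<le> ennreal (?B powr p) * sup_osc f x ennpowr p" if "x \<in> cube y (rho j)" for x
  proof -
    have "cube y (rho j) \<subseteq> cube x (rho i)"
      using that by (intro cube_subset[of _ _ "rho j"]) (auto simp: cube_sym j rho_Suc(1))
    from osc_mono[OF f rho_pos(1) rho_pos(1) this] have "osc f y (rho j) \<le> ennreal (C0 * 2 ^ CARD('n)) * osc f x (rho i)"
      by (simp add: j rho_Suc(1))
    also have "\<dots> \<le> ennreal (C0 * 2 ^ CARD('n)) * (ennreal (2 powr (- (real i * \<alpha>))) * sup_osc f x)"
      by (intro mult_left_mono osc_le_sup_osc) auto
    also have "\<dots> = ennreal ?B * sup_osc f x"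
      using C0_ge_1 by (simp add: mult.assoc[symmetric] ennreal_mult'[symmetric])
    finally have "osc f y (rho j) ennpowr p \<le> (ennreal ?B * sup_osc f x) ennpowr p"
      using p by (intro ennpowr_mono) auto
    then show ?thesis using B by (simp add: ennpowr_mult ennpowr_ennreal)
  qed
  have "ennreal ((2 * rho j) ^ CARD('n) / 2) * osc f y (rho j) ennpowr p \<le> emeasure lborel ?\<Gamma> * osc f y (rho j) ennpowr p"
    using \<kappa> y unfolding porosity_def by (intro mult_right_mono) auto
  also have "\<dots> = (\<integral>\<^sup>+x. osc f y (rho j) ennpowr p * indicator ?\<Gamma> x \<partial>lborel)"
    by (simp add: nn_integral_cmult_indicator mult.commute)
  also have "\<dots> \<le> (\<integral>\<^sup>+x. ennreal (?B powr p) * ((sup_osc f x ennpowr p * indicator (layer S \<kappa> j) x) * indicator (cube y (rho j)) x) \<partial>lborel)"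
  proof (intro nn_integral_mono)
    fix x
    show "osc f y (rho j) ennpowr p * indicator ?\<Gamma> x
      \<le> ennreal (?B powr p) * ((sup_osc f x ennpowr p * indicator (layer S \<kappa> j) x) * indicator (cube y (rho j)) x)"
    proof (cases "x \<in> ?\<Gamma>")
      case True
      then have "x \<in> nbhd S (rho j)" using y by (auto simp: nbhd_def)
      with True pt[of x] show ?thesis by (simp add: layer_def)
    qed simp
  qed
  also have "\<dots> = ennreal (?B powr p) * ?I"
    by (rule nn_integral_cmult) measurable
  finally have "ennreal ?a * (ennreal ((2 * rho j) ^ CARD('n) / 2) * osc f y (rho j) ennpowr p) \<le> ennreal ?a * (ennreal (?B powr p) * ?I)"
    by (intro mult_left_mono) auto
  moreover have "ennreal ?a * (ennreal ((2 * rho j) ^ CARD('n) / 2) * osc f y (rho j) ennpowr p) = osc f y (rho j) ennpowr p"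
    by (simp add: mult.assoc[symmetric] ennreal_mult'[symmetric])
  ultimately show ?thesis by (simp only: ennreal_mult'[OF less_imp_le[OF a]] mult.assoc)
qed

text \<open>The exponent count that dictates \<open>beta\<close>: weight
  \<open>j * beta * p\<close>, averaging \<open>j * n\<close>, smoothness
  \<open>- i * \<alpha> * p\<close> and mass \<open>- j * d\<close>, with
  \<open>n = CARD('n)\<close>. As \<open>beta * p = \<alpha> * p - (n - d)\<close>, all dependence
  on \<open>j\<close> cancels and only the shift \<open>j = Suc i\<close> leaves the factor
  \<open>2 powr (\<alpha> * p)\<close>.\<close>

lemma layer_constant:
  assumes "j = Suc i"
  shows "(2 powr (real j * beta)) powr p
     * (2 / (2 * rho j) ^ CARD('n) * (C0 * 2 ^ CARD('n) * 2 powr (- (real i * \<alpha>))) powr p * (c2 * 2 powr d * rho j powr d))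
    = 2 * (C0 * 2 ^ CARD('n)) powr p * c2 * 2 powr (\<alpha> * p)"
proof -
  let ?N = "real CARD('n)"
  have "2 * rho j = (1 / 2) ^ j" by (simp add: rho_def)
  then have r2: "2 * rho j = 2 powr (- real j)"
    by (simp only: powr_minus powr_realpow[OF zero_less_numeral] power_one_over inverse_eq_divide)
  have "(2 * rho j) ^ CARD('n) = 2 powr (- real j * ?N)"
    unfolding r2 by (simp add: powr_power mult.commute)
  then have e1: "2 / (2 * rho j) ^ CARD('n) = 2 * 2 powr (real j * ?N)"
    by (simp add: powr_minus divide_inverse)
  have e2: "rho j powr d = 2 powr (- real (Suc j) * d)"
    by (simp add: rho_eq_powr powr_powr del: of_nat_Suc)
  have e3: "(C0 * 2 ^ CARD('n) * 2 powr (- (real i * \<alpha>))) powr p = (C0 * 2 ^ CARD('n)) powr p * 2 powr (- (real i * \<alpha>) * p)"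
    using C0_ge_1 by (simp add: powr_mult powr_powr)
  have e4: "(2 powr (real j * beta)) powr p = 2 powr (real j * beta * p)"
    by (simp add: powr_powr)
  have bp: "beta * p = \<alpha> * p - (?N - d)" using p by (simp add: beta_def field_simps)
  have ex: "real j * beta * p + (real j * ?N + (- (real i * \<alpha>) * p + (d + - real (Suc j) * d))) = \<alpha> * p"
    unfolding mult.assoc bp assms by (simp add: algebra_simps)
  have prod: "2 powr (real j * beta * p) * (2 powr (real j * ?N) * (2 powr (- (real i * \<alpha>) * p) * (2 powr d * 2 powr (- real (Suc j) * d)))) = 2 powr (\<alpha> * p)"
    unfolding powr_add[symmetric] ex ..
  have "e * (2 * b * (g * c) * (h * q * r)) = 2 * g * h * (e * (b * (c * (q * r))))" for e b g c h q r :: real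
    by algebra
  then show ?thesis
    unfolding e1 e2 e3 e4 by (simp only: prod)
qed

text \<open>Integrating \<open>osc_layer_le\<close> over the measure and exchanging integrations
  gives each scale the same constant times the integral of \<open>sup_osc f x ennpowr p\<close> over
  its layer. The sum over the scales then costs only the overlap \<open>\<kappa>\<close>.\<close>

lemma besov_mass_ex: "\<exists>C\<ge>0. \<forall>f. loc_int f \<longrightarrow> (\<integral>\<^sup>+y. besov_sum f y \<partial>\<nu>) \<le> ennreal C * (Lp_mass f + osc_mass f)"
proof -
  obtain \<kappa> where \<kappa>: "porosity \<kappa>" using porous by blast
  obtain CA where CA: "0 \<le> CA" "\<And>f. loc_int f \<Longrightarrow> (\<integral>\<^sup>+y. cube_L1 f y (rho 0) ennpowr p \<partial>\<nu>) \<le> ennreal CA * Lp_mass f"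
    using cube_L1_mass_ex by blast
  have [measurable]: "nbhd S t \<in> sets borel" for t by (intro borel_closed nbhd_closed closed_S)
  let ?CB = "2 * (C0 * 2 ^ CARD('n)) powr p * c2 * 2 powr (\<alpha> * p)"
  have CB: "0 \<le> ?CB" using c2 by simp
  let ?C = "C0 powr p * CA + ?CB * real \<kappa>"
  have C: "0 \<le> ?C" using CA CB by simp
  show ?thesis
  proof (intro exI conjI allI impI, rule C)
    fix f :: "real^'n \<Rightarrow> real" assume f: "loc_int f"
    note [measurable] = loc_intD[OF f]
    have [measurable]: "layer S \<kappa> j \<in> sets borel" for j unfolding layer_def by measurable
    define u where "u j x = sup_osc f x ennpowr p * indicator (layer S \<kappa> j) x" for j x
    have [measurable]: "u j \<in> borel_measurable borel" for j unfolding u_def[abs_def] by measurable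
    let ?t = "\<lambda>j y. (ennreal ((1 / theta) ^ j) * osc f y (rho j)) ennpowr p"
    have layer: "(\<integral>\<^sup>+y. ?t j y \<partial>\<nu>) \<le> ennreal ?CB * (\<integral>\<^sup>+x. u j x \<partial>lborel)" if j: "j = Suc i" for i j
    proof -
      let ?w = "(2 powr (real j * beta)) powr p"
      let ?q = "2 / (2 * rho j) ^ CARD('n) * (C0 * 2 ^ CARD('n) * 2 powr (- (real i * \<alpha>))) powr p"
      let ?v = "c2 * 2 powr d * rho j powr d"
      have v: "0 \<le> ?v" using c2 by simp
      have "(\<integral>\<^sup>+y. ?t j y \<partial>\<nu>) \<le> (\<integral>\<^sup>+y. ennreal (?w * ?q) * (\<integral>\<^sup>+x\<in>cube y (rho j). u j x \<partial>lborel) \<partial>\<nu>)"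
      proof (rule nn_integral_mono_AE)
        show "AE y in \<nu>. ?t j y \<le> ennreal (?w * ?q) * (\<integral>\<^sup>+x\<in>cube y (rho j). u j x \<partial>lborel)"
          using AE_in_S
        proof eventually_elim
          fix y assume y: "y \<in> S"
          have "?t j y = ennreal ?w * osc f y (rho j) ennpowr p"
            by (simp add: inverse_theta_power ennpowr_mult ennpowr_ennreal)
          also have "\<dots> \<le> ennreal ?w * (ennreal ?q * (\<integral>\<^sup>+x\<in>cube y (rho j). u j x \<partial>lborel))"
            unfolding u_def by (intro mult_left_mono osc_layer_le f \<kappa> y j) auto
          finally show "?t j y \<le> ennreal (?w * ?q) * (\<integral>\<^sup>+x\<in>cube y (rho j). u j x \<partial>lborel)"
            by (simp only: ennreal_mult'[OF powr_ge_zero] mult.assoc)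
        qed
      qed
      also have "\<dots> = (\<integral>\<^sup>+x. u j x * (\<integral>\<^sup>+y\<in>cube x (rho j). ennreal (?w * ?q) \<partial>\<nu>) \<partial>lborel)"
        by (rule nn_integral_cube_swap) (auto intro: sigma_finite_nu sigma_finite_lborel)
      also have "\<dots> \<le> (\<integral>\<^sup>+x. u j x * ennreal (?w * (?q * ?v)) \<partial>lborel)"
      proof (intro nn_integral_mono mult_left_mono)
        fix x
        have "(\<integral>\<^sup>+y\<in>cube x (rho j). ennreal (?w * ?q) \<partial>\<nu>) = ennreal (?w * ?q) * emeasure \<nu> (cube x (rho j))"
          by (simp add: nn_integral_cmult_indicator)
        also have "\<dots> \<le> ennreal (?w * ?q) * ennreal ?v"
          by (intro mult_left_mono upper_anywhere rho_pos(1) rho_le_half) auto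
        also have "\<dots> = ennreal (?w * (?q * ?v))"
          using v by (simp only: ennreal_mult''[symmetric] mult.assoc)
        finally show "(\<integral>\<^sup>+y\<in>cube x (rho j). ennreal (?w * ?q) \<partial>\<nu>) \<le> ennreal (?w * (?q * ?v))" .
      qed auto
      also have "\<dots> = ennreal ?CB * (\<integral>\<^sup>+x. u j x \<partial>lborel)"
        unfolding layer_constant[OF j] by (simp add: nn_integral_multc mult.commute)
      finally show ?thesis .
    qed
    \<comment> \<open>There is no coarser scale to compare with, so the first term is charged to the
      norm of \<open>f\<close> itself.\<close>
    have zero: "(\<integral>\<^sup>+y. ?t 0 y \<partial>\<nu>) \<le> ennreal (C0 powr p * CA) * Lp_mass f"
    proof -
      have "?t 0 y \<le> ennreal (C0 powr p) * cube_L1 f y (rho 0) ennpowr p" for y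
      proof -
        have "?t 0 y \<le> (ennreal C0 * cube_L1 f y (rho 0)) ennpowr p"
          using p osc_le_cube_L1[OF f rho_pos(1)] by (intro ennpowr_mono) auto
        then show ?thesis using C0_ge_1 by (simp add: ennpowr_mult ennpowr_ennreal)
      qed
      then have "(\<integral>\<^sup>+y. ?t 0 y \<partial>\<nu>) \<le> (\<integral>\<^sup>+y. ennreal (C0 powr p) * cube_L1 f y (rho 0) ennpowr p \<partial>\<nu>)"
        by (intro nn_integral_mono)
      also have "\<dots> = ennreal (C0 powr p) * (\<integral>\<^sup>+y. cube_L1 f y (rho 0) ennpowr p \<partial>\<nu>)"
        by (rule nn_integral_cmult) measurable
      also have "\<dots> \<le> ennreal (C0 powr p) * (ennreal CA * Lp_mass f)"
        by (intro mult_left_mono CA f) auto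
      finally show ?thesis by (simp add: ennreal_mult' mult.assoc)
    qed
    have "(\<integral>\<^sup>+y. besov_sum f y \<partial>\<nu>) = (\<Sum>j. \<integral>\<^sup>+y. ?t j y \<partial>\<nu>)"
      unfolding besov_sum_def by (rule nn_integral_suminf) measurable
    also have "\<dots> = (\<Sum>i. \<integral>\<^sup>+y. ?t (Suc i) y \<partial>\<nu>) + (\<integral>\<^sup>+y. ?t 0 y \<partial>\<nu>)"
      using suminf_offset[of "\<lambda>j. \<integral>\<^sup>+y. ?t j y \<partial>\<nu>" 1] by simp
    also have "\<dots> \<le> (\<Sum>i. ennreal ?CB * (\<integral>\<^sup>+x. u (Suc i) x \<partial>lborel)) + ennreal (C0 powr p * CA) * Lp_mass f"
      by (intro add_mono zero suminf_le layer) auto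
    also have "(\<Sum>i. ennreal ?CB * (\<integral>\<^sup>+x. u (Suc i) x \<partial>lborel)) = ennreal ?CB * (\<Sum>i. \<integral>\<^sup>+x. u (Suc i) x \<partial>lborel)"
      by (rule ennreal_suminf_cmult)
    also have "(\<Sum>i. \<integral>\<^sup>+x. u (Suc i) x \<partial>lborel) \<le> (\<Sum>i. \<integral>\<^sup>+x. u i x \<partial>lborel)"
      using suminf_offset[of "\<lambda>j. \<integral>\<^sup>+x. u j x \<partial>lborel" 1] by simp
    also have "(\<Sum>i. \<integral>\<^sup>+x. u i x \<partial>lborel) = (\<integral>\<^sup>+x. (\<Sum>i. u i x) \<partial>lborel)"
      by (rule nn_integral_suminf[symmetric]) measurable
    also have "\<dots> \<le> (\<integral>\<^sup>+x. sup_osc f x ennpowr p * of_nat \<kappa> \<partial>lborel)"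
      unfolding u_def by (intro nn_integral_mono) (auto intro!: mult_left_mono sum_layers_le)
    also have "\<dots> = of_nat \<kappa> * osc_mass f"
      unfolding osc_mass_def mult.commute[of _ "of_nat \<kappa>"] by (rule nn_integral_cmult) measurable
    finally have "(\<integral>\<^sup>+y. besov_sum f y \<partial>\<nu>) \<le> ennreal ?CB * (of_nat \<kappa> * osc_mass f) + ennreal (C0 powr p * CA) * Lp_mass f"
      by (simp add: mult_left_mono add_right_mono)
    also have "ennreal ?CB * (of_nat \<kappa> * osc_mass f) = ennreal (?CB * real \<kappa>) * osc_mass f"
      unfolding ennreal_mult'[OF CB] ennreal_of_nat_eq_real_of_nat by (simp only: mult.assoc)
    also have "ennreal (?CB * real \<kappa>) * osc_mass f + ennreal (C0 powr p * CA) * Lp_mass f \<le> ennreal ?C * osc_mass f + ennreal ?C * Lp_mass f"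
      using CA CB by (intro add_mono mult_right_mono ennreal_leI) auto
    finally show "(\<integral>\<^sup>+y. besov_sum f y \<partial>\<nu>) \<le> ennreal ?C * (Lp_mass f + osc_mass f)"
      by (simp add: distrib_left add.commute)
  qed
qed

text \<open>Averaging over cubes is bounded on the \<open>p\<close>-th power integrals uniformly in
  \<open>r\<close>, by Jensen's inequality and an exchange of integrations; the lower mass bound
  replaces the true mass in the normalisation.\<close>

lemma average_mass_le:
  assumes v[measurable]: "v \<in> borel_measurable borel" and r: "0 < r" "r \<le> 1"
  shows "(\<integral>\<^sup>+w. (ennreal (1 / (c1 * r powr d)) * (\<integral>\<^sup>+y\<in>cube w r. v y \<partial>\<nu>)) ennpowr p \<partial>\<nu>)
    \<le> ennreal ((c2 / c1) powr p) * (\<integral>\<^sup>+y. v y ennpowr p \<partial>\<nu>)"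
proof -
  let ?B = "c2 * r powr d"
  let ?a = "(1 / (c1 * r powr d)) powr p"
  have B: "0 < ?B" using c2 r by simp
  have "(\<integral>\<^sup>+w. (ennreal (1 / (c1 * r powr d)) * (\<integral>\<^sup>+y\<in>cube w r. v y \<partial>\<nu>)) ennpowr p \<partial>\<nu>)
     \<le> (\<integral>\<^sup>+w. ennreal (?a * ?B powr (p - 1)) * (\<integral>\<^sup>+y\<in>cube w r. v y ennpowr p \<partial>\<nu>) \<partial>\<nu>)"
  proof (rule nn_integral_mono_AE)
    show "AE w in \<nu>. (ennreal (1 / (c1 * r powr d)) * (\<integral>\<^sup>+y\<in>cube w r. v y \<partial>\<nu>)) ennpowr p
        \<le> ennreal (?a * ?B powr (p - 1)) * (\<integral>\<^sup>+y\<in>cube w r. v y ennpowr p \<partial>\<nu>)"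
      using AE_in_S
    proof eventually_elim
      fix w assume w: "w \<in> S"
      have "(ennreal (1 / (c1 * r powr d)) * (\<integral>\<^sup>+y\<in>cube w r. v y \<partial>\<nu>)) ennpowr p
          = ennreal ?a * (\<integral>\<^sup>+y\<in>cube w r. v y \<partial>\<nu>) ennpowr p"
        using c1 by (simp add: ennpowr_mult ennpowr_ennreal)
      also have "\<dots> \<le> ennreal ?a * (ennreal (?B powr (p - 1)) * (\<integral>\<^sup>+y\<in>cube w r. v y ennpowr p \<partial>\<nu>))"
        by (intro mult_left_mono nn_integral_cube_ennpowr_le upper w r B p) auto
      finally show "(ennreal (1 / (c1 * r powr d)) * (\<integral>\<^sup>+y\<in>cube w r. v y \<partial>\<nu>)) ennpowr p
        \<le> ennreal (?a * ?B powr (p - 1)) * (\<integral>\<^sup>+y\<in>cube w r. v y ennpowr p \<partial>\<nu>)"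
        by (simp add: ennreal_mult' mult.assoc)
    qed
  qed
  also have "\<dots> = (\<integral>\<^sup>+y. v y ennpowr p * (\<integral>\<^sup>+w\<in>cube y r. ennreal (?a * ?B powr (p - 1)) \<partial>\<nu>) \<partial>\<nu>)"
    by (rule nn_integral_cube_swap) (auto intro: sigma_finite_nu)
  also have "\<dots> \<le> (\<integral>\<^sup>+y. v y ennpowr p * ennreal ((c2 / c1) powr p) \<partial>\<nu>)"
  proof (rule nn_integral_mono_AE)
    \<comment> \<open>\<open>upper_anywhere\<close> is restricted to radii at most 1/2, whereas
      \<open>r\<close> may be up to 1; the bound \<open>upper\<close> applies since almost every
      \<open>y\<close> lies in \<open>S\<close>.\<close>
    show "AE y in \<nu>. v y ennpowr p * (\<integral>\<^sup>+w\<in>cube y r. ennreal (?a * ?B powr (p - 1)) \<partial>\<nu>)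
        \<le> v y ennpowr p * ennreal ((c2 / c1) powr p)"
      using AE_in_S
    proof eventually_elim
      fix y assume y: "y \<in> S"
      have "(\<integral>\<^sup>+w\<in>cube y r. ennreal (?a * ?B powr (p - 1)) \<partial>\<nu>) = ennreal (?a * ?B powr (p - 1)) * emeasure \<nu> (cube y r)"
        by (simp add: nn_integral_cmult_indicator)
      also have "\<dots> \<le> ennreal (?a * ?B powr (p - 1)) * ennreal ?B"
        using y r by (intro mult_left_mono upper) auto
      also have "\<dots> = ennreal (?a * ?B powr (p - 1) * ?B)"
        using B by (intro ennreal_mult''[symmetric]) simp
      also have "?a * ?B powr (p - 1) * ?B = ?a * ?B powr p"
        using B by (simp add: powr_diff)
      also have "\<dots> = (1 / (c1 * r powr d) * ?B) powr p"
        using c1 B by (subst powr_mult) auto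
      also have "1 / (c1 * r powr d) * ?B = c2 / c1" using r by simp
      finally show "v y ennpowr p * (\<integral>\<^sup>+w\<in>cube y r. ennreal (?a * ?B powr (p - 1)) \<partial>\<nu>)
        \<le> v y ennpowr p * ennreal ((c2 / c1) powr p)"
        by (rule mult_left_mono) simp
    qed
  qed
  also have "\<dots> = ennreal ((c2 / c1) powr p) * (\<integral>\<^sup>+y. v y ennpowr p \<partial>\<nu>)"
    by (simp add: nn_integral_multc mult.commute)
  finally show ?thesis .
qed

end

section \<open>From pointwise bounds to approximation errors on the set\<close>

lemma borel_measurable_cube_integral:
  fixes \<mu> :: "(real^'n) measure"
  assumes [measurable_cong]: "sets \<mu> = sets borel" and sf: "sigma_finite_measure \<mu>"
    and v[measurable]: "v \<in> borel_measurable borel"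
  shows "(\<lambda>w. \<integral>\<^sup>+x\<in>cube w r. v x \<partial>\<mu>) \<in> borel_measurable borel"
proof -
  interpret sigma_finite_measure \<mu> by (rule sf)
  have "(\<lambda>p. if snd p \<in> cube (fst p) r then v (snd p) else 0) \<in> borel_measurable (borel \<Otimes>\<^sub>M borel :: ((real^'n) \<times> (real^'n)) measure)"
    by measurable
  then have "(\<lambda>(w, x). v x * indicator (cube w r) x) \<in> borel_measurable (borel \<Otimes>\<^sub>M \<mu>)"
    using sets_pair_measure_cong[OF refl assms(1), of "borel :: (real^'n) measure"]
    by (simp add: case_prod_unfold indicator_def if_distrib cong: if_cong measurable_cong_sets)
  then show ?thesis by (rule borel_measurable_nn_integral)
qed

text \<open>The pointwise bound is split into a part \<open>v\<close> that varies with
  \<open>y\<close> and is averaged, and a number \<open>b\<close>, attached to the cube, whose mean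
  is again \<open>b\<close>. The latter uses that the mass of the cube is neither 0 nor
  infinite.\<close>

lemma approx_on_le:
  fixes S :: "(real^'n) set"
  assumes dset: "d_set d S" and reg: "regular_measure (trace_measure d S) S d c1 c2"
    and w: "w \<in> S" and r: "0 < r" "r \<le> 1" and P: "P \<in> polys_below k"
    and v[measurable]: "v \<in> borel_measurable borel"
    and le: "\<And>y. y \<in> cube w r \<Longrightarrow> ennreal \<bar>g y - P y\<bar> \<le> v y + b"
  shows "approx_on d S k g (cube w r)
    \<le> ennreal (1 / (c1 * r powr d)) * (\<integral>\<^sup>+y\<in>cube w r. v y \<partial>trace_measure d S) + b"
proof -
  interpret regular_measure "trace_measure d S" S d c1 c2 by (rule reg)
  let ?\<nu> = "trace_measure d S" and ?Q = "cube w r" and ?I = "\<integral>\<^sup>+y\<in>cube w r. v y \<partial>trace_measure d S"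
  define e where "e = emeasure ?\<nu> ?Q"
  have e: "e = emeasure (hausdorff_measure d) (?Q \<inter> S)"
    unfolding e_def by (rule emeasure_trace_measure[OF dset]) simp
  have lo: "ennreal (c1 * r powr d) \<le> e" unfolding e_def by (rule lower[OF w r])
  have "e \<le> ennreal (c2 * r powr d)" unfolding e_def by (rule upper[OF w r])
  then have fin: "e \<noteq> top" by (auto simp: top_unique)
  have pos: "0 < c1 * r powr d" using c1 r by simp
  with lo have e0: "e \<noteq> 0" by (auto simp: ennreal_eq_0_iff)
  have "approx_on d S k g ?Q \<le> (\<integral>\<^sup>+y\<in>?Q \<inter> S. ennreal \<bar>g y - P y\<bar> \<partial>hausdorff_measure d) / e"
    unfolding approx_on_def local_approx_def e by (rule INF_lower[OF P])
  also have "\<dots> \<le> (\<integral>\<^sup>+y\<in>?Q. v y + b \<partial>?\<nu>) / e"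
    by (intro divide_right_mono_ennreal nn_integral_hausdorff_le[OF dset] le) auto
  also have "(\<integral>\<^sup>+y\<in>?Q. v y + b \<partial>?\<nu>) = ?I + b * e"
    unfolding e_def distrib_right by (subst nn_integral_add) (auto simp: nn_integral_cmult_indicator)
  also have "(?I + b * e) / e = ?I / e + b"
    by (simp add: add_divide_distrib_ennreal ennreal_mult_divide_eq e0 fin)
  also have "?I / e \<le> ?I / ennreal (c1 * r powr d)"
  proof -
    obtain e' where e': "e = ennreal e'" "c1 * r powr d \<le> e'"
      using fin lo pos by (cases e) (auto simp: ennreal_le_iff2)
    then have "ennreal (inverse e') \<le> ennreal (inverse (c1 * r powr d))"
      using pos by (intro ennreal_leI le_imp_inverse_le)
    moreover have "ennreal (inverse e') = inverse e" "ennreal (inverse (c1 * r powr d)) = inverse (ennreal (c1 * r powr d))"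
      using e' pos inverse_ennreal[of e'] by (simp_all only: inverse_ennreal)
    ultimately have "inverse e \<le> inverse (ennreal (c1 * r powr d))" by simp
    then show ?thesis unfolding divide_ennreal_def by (rule mult_left_mono) simp
  qed
  also have "?I / ennreal (c1 * r powr d) = ennreal (1 / (c1 * r powr d)) * ?I"
    using pos by (simp add: divide_ennreal_def inverse_ennreal mult.commute inverse_eq_divide)
  finally show ?thesis by (simp add: add_right_mono)
qed

context trace_setting begin

text \<open>The untruncated sum is the term \<open>i = 0\<close> of Hardy's inequality for
  tails.\<close>

lemma osc_sum_ennpowr_le:
  "(\<Sum>j. osc f y (rho j)) ennpowr p \<le> ennreal ((1 / (1 - theta)) powr p) * besov_sum f y"
proof -
  let ?t = "\<lambda>i. (ennreal ((1 / theta) ^ i) * (\<Sum>j. osc f y (rho (i + j)))) ennpowr p"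
  have "(\<Sum>j. osc f y (rho j)) ennpowr p = sum ?t {0}" by simp
  also have "\<dots> \<le> suminf ?t" by (rule sum_le_suminf) auto
  also have "\<dots> \<le> ennreal ((1 / (1 - theta)) powr p) * besov_sum f y"
    unfolding besov_sum_def using weighted_hardy_tail[OF theta p, of "\<lambda>j. osc f y (rho j)"] by simp
  finally show ?thesis .
qed

lemma osc_tails_le:
  "(\<Sum>i. (ennreal ((1 / theta) ^ i) * (\<Sum>j. osc f y (rho (Suc i + j)))) ennpowr p)
    \<le> ennreal ((1 / (1 - theta)) powr p) * besov_sum f y"
proof -
  let ?t = "\<lambda>i. (ennreal ((1 / theta) ^ i) * osc f y (rho i)) ennpowr p"
  have "(\<Sum>i. (ennreal ((1 / theta) ^ i) * (\<Sum>j. osc f y (rho (Suc i + j)))) ennpowr p)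
      \<le> ennreal ((1 / (1 - theta)) powr p) * (\<Sum>i. (ennreal ((1 / theta) ^ i) * osc f y (rho (Suc i))) ennpowr p)"
    using weighted_hardy_tail[OF theta p, of "\<lambda>j. osc f y (rho (Suc j))"] by simp
  also have "(\<Sum>i. (ennreal ((1 / theta) ^ i) * osc f y (rho (Suc i))) ennpowr p) \<le> (\<Sum>i. ?t (Suc i))"
  proof (rule suminf_le)
    fix i
    have "(1 / theta) ^ i \<le> (1 / theta) ^ Suc i" using theta by (intro power_increasing) auto
    then show "(ennreal ((1 / theta) ^ i) * osc f y (rho (Suc i))) ennpowr p \<le> ?t (Suc i)"
      using p by (intro ennpowr_mono mult_right_mono ennreal_leI) auto
  qed auto
  also have "\<dots> \<le> besov_sum f y"
    unfolding besov_sum_def using suminf_offset[of ?t 1] by simp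
  finally show ?thesis by (simp add: mult_left_mono)
qed

text \<open>The part of the bound in \<open>trace_local_poly_le\<close> that depends only on the
  centre \<open>w\<close>, up to the factor \<open>C1 k\<close>.\<close>

definition poly_error :: "nat \<Rightarrow> (real^'n \<Rightarrow> real) \<Rightarrow> nat \<Rightarrow> real^'n \<Rightarrow> ennreal" where
  "poly_error k f i w = (\<Sum>l\<le>i. ennreal (((1 / 2) ^ k) ^ (i - l)) * osc f w (rho l))
      + ennreal (((1 / 2) ^ k) ^ i) * cube_L1 f w (rho 0)"

lemma measurable_poly_error [measurable]:
  assumes [measurable]: "f \<in> borel_measurable borel"
  shows "poly_error k f i \<in> borel_measurable borel"
  unfolding poly_error_def[abs_def] by measurable

text \<open>As \<open>k > \<alpha> > beta\<close>, the decay \<open>(1 / 2) ^ k\<close> is smaller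
  than \<open>theta\<close>, so Hardy's inequality for heads applies to the oscillations, and the
  remaining term sums as a geometric series of ratio \<open>s\<close>.\<close>

lemma poly_errors_le_ex:
  assumes k: "\<alpha> < real k"
  shows "\<exists>C<\<infinity>. \<forall>f w. (\<Sum>i. (ennreal ((1 / theta) ^ i) * poly_error k f i w) ennpowr p)
     \<le> C * (besov_sum f w + cube_L1 f w (rho 0) ennpowr p)"
proof -
  let ?\<kappa> = "(1 / 2 :: real) ^ k"
  have "?\<kappa> = 2 powr (- real k)"
    by (simp only: powr_minus powr_realpow[OF zero_less_numeral] power_one_over inverse_eq_divide)
  then have \<kappa>: "0 < ?\<kappa>" "?\<kappa> < theta"
    using beta_less k by (auto simp: theta_def)
  define s where "s = (?\<kappa> / theta) powr p"
  have "(?\<kappa> / theta) powr p < 1 powr p"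
    using \<kappa> theta p by (intro powr_less_mono2) auto
  then have s: "0 \<le> s" "s < 1" by (simp_all add: s_def)
  let ?H = "ennreal ((1 / (1 - ?\<kappa> / theta)) powr p)"
  let ?C = "ennreal (2 powr p) * (?H + ennreal (1 / (1 - s)))"
  show ?thesis
  proof (intro exI conjI allI)
    show "?C < \<infinity>" by (simp add: ennreal_mult_less_top)
    fix f :: "real^'n \<Rightarrow> real" and w
    let ?A = "cube_L1 f w (rho 0)" and ?w = "\<lambda>i. ennreal ((1 / theta) ^ i)"
    let ?S = "\<lambda>i. \<Sum>l\<le>i. ennreal (?\<kappa> ^ (i - l)) * osc f w (rho l)"
    have geo: "(?w i * (ennreal (?\<kappa> ^ i) * ?A)) ennpowr p = ennreal (s ^ i) * ?A ennpowr p" for i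
    proof -
      have "(1 / theta) ^ i * ?\<kappa> ^ i = (?\<kappa> / theta) ^ i"
        unfolding power_mult_distrib[symmetric] by simp
      moreover have "ennreal ((1 / theta) ^ i * ?\<kappa> ^ i) = ?w i * ennreal (?\<kappa> ^ i)"
        using theta by (intro ennreal_mult') simp
      ultimately have "?w i * (ennreal (?\<kappa> ^ i) * ?A) = ennreal ((?\<kappa> / theta) ^ i) * ?A"
        by (simp only: mult.assoc)
      moreover have "((?\<kappa> / theta) ^ i) powr p = s ^ i"
      proof -
        have x: "0 < ?\<kappa> / theta" using \<kappa> theta by simp
        have "((?\<kappa> / theta) ^ i) powr p = (?\<kappa> / theta) powr (real i * p)"
          by (simp only: powr_realpow[OF x, symmetric] powr_powr)
        also have "\<dots> = s ^ i" using less_imp_neq[OF x] by (simp only: s_def powr_power)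
        finally show ?thesis .
      qed
      ultimately show ?thesis using \<kappa> theta by (simp add: ennpowr_mult ennpowr_ennreal)
    qed
    have "(\<Sum>i. (?w i * poly_error k f i w) ennpowr p)
        \<le> (\<Sum>i. ennreal (2 powr p) * ((?w i * ?S i) ennpowr p + ennreal (s ^ i) * ?A ennpowr p))"
      unfolding poly_error_def distrib_left geo[symmetric] using p
      by (intro suminf_le order_trans[OF ennpowr_add_le]) (auto simp: distrib_left)
    also have "\<dots> = ennreal (2 powr p) * ((\<Sum>i. (?w i * ?S i) ennpowr p) + (\<Sum>i. ennreal (s ^ i)) * ?A ennpowr p)"
      by (simp add: suminf_add[symmetric])
    also have "(\<Sum>i. ennreal (s ^ i)) = ennreal (1 / (1 - s))"
      using s geometric_sums[of s] by (intro suminf_ennreal_eq) auto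
    also have "(\<Sum>i. (?w i * ?S i) ennpowr p) \<le> ?H * besov_sum f w"
      unfolding besov_sum_def by (rule weighted_hardy_head[OF theta(1) \<kappa> p])
    finally have "(\<Sum>i. (?w i * poly_error k f i w) ennpowr p)
        \<le> ennreal (2 powr p) * (?H * besov_sum f w + ennreal (1 / (1 - s)) * ?A ennpowr p)"
      by (simp add: mult_left_mono add_right_mono)
    also have "\<dots> \<le> ennreal (2 powr p) * ((?H + ennreal (1 / (1 - s))) * besov_sum f w + (?H + ennreal (1 / (1 - s))) * ?A ennpowr p)"
      by (intro mult_left_mono add_mono mult_right_mono) auto
    finally show "(\<Sum>i. (?w i * poly_error k f i w) ennpowr p) \<le> ?C * (besov_sum f w + ?A ennpowr p)"
      by (simp only: distrib_left[symmetric] mult.assoc)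
  qed
qed

text \<open>A Borel majorant of the absolute value of the trace, valid at every point.\<close>

definition trace_bound :: "nat \<Rightarrow> (real^'n \<Rightarrow> real) \<Rightarrow> real^'n \<Rightarrow> ennreal" where
  "trace_bound k f y = ennreal (C1 k) * ((\<Sum>j. osc f y (rho j)) + cube_L1 f y (rho 0))"

lemma measurable_trace_bound [measurable]:
  assumes [measurable]: "f \<in> borel_measurable borel"
  shows "trace_bound k f \<in> borel_measurable borel"
  unfolding trace_bound_def[abs_def] by measurable

lemma trace_bound_mass_ex:
  "\<exists>C<\<infinity>. \<forall>f. loc_int f \<longrightarrow> (\<integral>\<^sup>+y. trace_bound k f y ennpowr p \<partial>\<nu>) \<le> C * (Lp_mass f + osc_mass f)"
proof -
  obtain CA where CA: "\<And>f. loc_int f \<Longrightarrow> (\<integral>\<^sup>+y. cube_L1 f y (rho 0) ennpowr p \<partial>\<nu>) \<le> ennreal CA * Lp_mass f"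
    using cube_L1_mass_ex by blast
  obtain CB where CB: "\<And>f. loc_int f \<Longrightarrow> (\<integral>\<^sup>+y. besov_sum f y \<partial>\<nu>) \<le> ennreal CB * (Lp_mass f + osc_mass f)"
    using besov_mass_ex by blast
  let ?h = "ennreal ((1 / (1 - theta)) powr p)"
  let ?C = "ennreal (C1 k powr p) * (ennreal (2 powr p) * (?h * ennreal CB + ennreal CA))"
  show ?thesis
  proof (intro exI conjI allI impI)
    show "?C < \<infinity>" by (simp add: ennreal_mult_less_top)
    fix f :: "real^'n \<Rightarrow> real" assume f: "loc_int f"
    note [measurable] = loc_intD[OF f]
    let ?A = "\<lambda>y. cube_L1 f y (rho 0) ennpowr p" and ?F = "Lp_mass f + osc_mass f"
    have pt: "trace_bound k f y ennpowr p \<le> ennreal (C1 k powr p) * (ennreal (2 powr p) * (?h * besov_sum f y + ?A y))" for y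
    proof -
      have "trace_bound k f y ennpowr p = ennreal (C1 k powr p) * ((\<Sum>j. osc f y (rho j)) + cube_L1 f y (rho 0)) ennpowr p"
        using C1_ge(1)[of k] by (simp add: trace_bound_def ennpowr_mult ennpowr_ennreal)
      also have "\<dots> \<le> ennreal (C1 k powr p) * (ennreal (2 powr p) * (?h * besov_sum f y + ?A y))"
        using p by (intro mult_left_mono ennpowr_add_le_mono[OF _ order_refl] osc_sum_ennpowr_le) auto
      finally show ?thesis .
    qed
    have "(\<integral>\<^sup>+y. trace_bound k f y ennpowr p \<partial>\<nu>) \<le> (\<integral>\<^sup>+y. ennreal (C1 k powr p) * (ennreal (2 powr p) * (?h * besov_sum f y + ?A y)) \<partial>\<nu>)"
      by (intro nn_integral_mono pt)
    also have "\<dots> = ennreal (C1 k powr p) * (ennreal (2 powr p) * (?h * (\<integral>\<^sup>+y. besov_sum f y \<partial>\<nu>) + (\<integral>\<^sup>+y. ?A y \<partial>\<nu>)))"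
      by (simp add: nn_integral_cmult nn_integral_add)
    also have "\<dots> \<le> ennreal (C1 k powr p) * (ennreal (2 powr p) * (?h * (ennreal CB * ?F) + ennreal CA * ?F))"
      by (intro mult_left_mono add_mono CB f order_trans[OF CA[OF f]]) auto
    also have "\<dots> = ?C * ?F" by (simp only: distrib_right mult.assoc)
    finally show "(\<integral>\<^sup>+y. trace_bound k f y ennpowr p \<partial>\<nu>) \<le> ?C * ?F" .
  qed
qed

end

section \<open>Approximation of the trace in the mean\<close>

locale d_set_setting = trace_setting m \<Phi> K "trace_measure d S" S d c1 c2 p \<alpha>
  for m :: nat and \<Phi> :: "('n::finite \<Rightarrow> nat) \<Rightarrow> real^'n \<Rightarrow> real" and K :: real
    and S :: "(real^'n) set" and d c1 c2 p \<alpha> :: real +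
  assumes dset: "d_set d S"
begin

abbreviation "HS \<equiv> restrict_space (hausdorff_measure d) S"
abbreviation "\<nu> \<equiv> trace_measure d S"

lemma measurable_cube_average [measurable]:
  "v \<in> borel_measurable borel \<Longrightarrow> (\<lambda>w. \<integral>\<^sup>+x\<in>cube w r. v x \<partial>\<nu>) \<in> borel_measurable borel"
  by (rule borel_measurable_cube_integral[OF sets_nu sigma_finite_nu])

text \<open>Meant for the radii 1 and 1/2, which \<open>approx_local_le\<close> does not reach; the
  zero polynomial serves as competitor.\<close>

lemma approx_mass_crude:
  assumes f: "loc_int f" and r: "0 < r" "r \<le> 1"
  shows "(\<integral>\<^sup>+w. approx_on d S k (pointwise_trace f) (cube w r) ennpowr p \<partial>HS)
    \<le> ennreal ((c2 / c1) powr p) * (\<integral>\<^sup>+y. trace_bound k f y ennpowr p \<partial>\<nu>)"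
proof -
  note [measurable] = loc_intD[OF f]
  have "(\<integral>\<^sup>+w. approx_on d S k (pointwise_trace f) (cube w r) ennpowr p \<partial>HS)
     \<le> (\<integral>\<^sup>+w. (ennreal (1 / (c1 * r powr d)) * (\<integral>\<^sup>+y\<in>cube w r. trace_bound k f y \<partial>\<nu>)) ennpowr p \<partial>\<nu>)"
  proof (rule nn_integral_restrict_le[OF dset])
    fix w assume w: "w \<in> S"
    have "approx_on d S k (pointwise_trace f) (cube w r)
        \<le> ennreal (1 / (c1 * r powr d)) * (\<integral>\<^sup>+y\<in>cube w r. trace_bound k f y \<partial>\<nu>) + 0"
      using trace_le[OF f m_pos, of _ k]
      by (intro approx_on_le[OF dset regular_measure_axioms w r zero_in_polys]) (auto simp: trace_bound_def)
    then show "approx_on d S k (pointwise_trace f) (cube w r) ennpowr p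
        \<le> (ennreal (1 / (c1 * r powr d)) * (\<integral>\<^sup>+y\<in>cube w r. trace_bound k f y \<partial>\<nu>)) ennpowr p"
      using p by (intro ennpowr_mono) auto
  qed measurable
  also have "\<dots> \<le> ennreal ((c2 / c1) powr p) * (\<integral>\<^sup>+y. trace_bound k f y ennpowr p \<partial>\<nu>)"
    using r by (intro average_mass_le) auto
  finally show ?thesis .
qed

text \<open>The competitor is the projection at the doubled radius \<open>rho i\<close>, truncated
  to degree below \<open>k\<close>.\<close>

lemma approx_local_le:
  assumes f: "loc_int f" and k: "k \<le> m" and w: "w \<in> S"
  shows "approx_on d S k (pointwise_trace f) (cube w (rho (Suc i)))
    \<le> ennreal (C1 k) * (ennreal (1 / (c1 * rho (Suc i) powr d)) * (\<integral>\<^sup>+y\<in>cube w (rho (Suc i)). (\<Sum>j. osc f y (rho (Suc i + j))) \<partial>\<nu>)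
        + poly_error k f i w)"
proof -
  note [measurable] = loc_intD[OF f]
  let ?r = "rho (Suc i)" and ?V = "\<lambda>y. \<Sum>j. osc f y (rho (Suc i + j))"
  let ?T = "\<lambda>y. poly_below k (coef f w (rho i)) ((1 / rho i) *\<^sub>R (y - w))"
  have "poly_below k (coef f w (rho i)) \<in> polys_below k" by (simp add: polys_below_eq)
  from polys_below_affine[OF this, of "- (1 / rho i) *\<^sub>R w" "1 / rho i"]
  have T: "?T \<in> polys_below k" by (simp add: algebra_simps)
  have "approx_on d S k (pointwise_trace f) (cube w ?r)
      \<le> ennreal (1 / (c1 * ?r powr d)) * (\<integral>\<^sup>+y\<in>cube w ?r. ennreal (C1 k) * ?V y \<partial>\<nu>) + ennreal (C1 k) * poly_error k f i w"
  proof (rule approx_on_le[OF dset regular_measure_axioms w _ _ T])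
    show "?r \<le> 1" using rho_le_half[of "Suc i"] by simp
    show "ennreal \<bar>pointwise_trace f y - ?T y\<bar> \<le> ennreal (C1 k) * ?V y + ennreal (C1 k) * poly_error k f i w"
      if "y \<in> cube w ?r" for y
      unfolding poly_error_def by (rule trace_local_poly_le[OF f m_pos k that])
  qed auto
  also have "(\<integral>\<^sup>+y\<in>cube w ?r. ennreal (C1 k) * ?V y \<partial>\<nu>) = ennreal (C1 k) * (\<integral>\<^sup>+y\<in>cube w ?r. ?V y \<partial>\<nu>)"
    unfolding mult.assoc by (rule nn_integral_cmult) measurable
  finally show ?thesis by (simp add: distrib_left mult.left_commute)
qed

text \<open>After raising \<open>approx_local_le\<close> to the power \<open>p\<close>, the averages
  are removed scale by scale. The sum over the scales is then taken under the integral, so that the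
  Hardy inequalities apply at each point: the one for tails to the averaged part, the one for heads
  to the error at the centre.\<close>

lemma approx_mass_ex:
  assumes k: "k \<le> m" "\<alpha> < real k"
  shows "\<exists>C<\<infinity>. \<forall>f. loc_int f \<longrightarrow>
    (\<Sum>i. ennreal ((2 powr (real i * beta)) powr p)
      * (\<integral>\<^sup>+w. approx_on d S k (pointwise_trace f) (cube w (2 powr (- real i))) ennpowr p \<partial>HS))
    \<le> C * (Lp_mass f + osc_mass f)"
    (is "\<exists>C<_. \<forall>f. _ \<longrightarrow> (\<Sum>i. ?q i * ?E f i) \<le> _")
proof -
  obtain CA where CA: "\<And>f. loc_int f \<Longrightarrow> (\<integral>\<^sup>+y. cube_L1 f y (rho 0) ennpowr p \<partial>\<nu>) \<le> ennreal CA * Lp_mass f"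
    using cube_L1_mass_ex by blast
  obtain CB where CB: "\<And>f. loc_int f \<Longrightarrow> (\<integral>\<^sup>+y. besov_sum f y \<partial>\<nu>) \<le> ennreal CB * (Lp_mass f + osc_mass f)"
    using besov_mass_ex by blast
  obtain CT where CT: "CT < \<infinity>" "\<And>f. loc_int f \<Longrightarrow> (\<integral>\<^sup>+y. trace_bound k f y ennpowr p \<partial>\<nu>) \<le> CT * (Lp_mass f + osc_mass f)"
    using trace_bound_mass_ex by blast
  obtain CE where CE: "CE < \<infinity>" "\<And>f w. (\<Sum>i. (ennreal ((1 / theta) ^ i) * poly_error k f i w) ennpowr p)
     \<le> CE * (besov_sum f w + cube_L1 f w (rho 0) ennpowr p)"
    using poly_errors_le_ex[OF k(2)] by blast
  let ?h = "ennreal ((1 / (1 - theta)) powr p)" and ?cc = "ennreal ((c2 / c1) powr p)"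
  let ?W = "ennreal ((2 powr beta) powr p)"
  \<comment> \<open>Two factors \<open>?W\<close> pay for the shift of the index by two; the others
    come from \<open>C1 k\<close> and from splitting the power of a sum.\<close>
  define D where "D = ?W * ?W * (ennreal (C1 k powr p) * ennreal (2 powr p))"
  define C where "C = (?cc * CT + ?W * (?cc * CT)) + D * (?cc * (?h * ennreal CB) + CE * (ennreal CB + ennreal CA))"
  show ?thesis
  proof (intro exI conjI allI impI)
    show "C < \<infinity>" using CT(1) CE(1) by (simp add: C_def D_def ennreal_mult_less_top)
    fix f :: "real^'n \<Rightarrow> real" assume f: "loc_int f"
    note [measurable] = loc_intD[OF f]
    let ?F = "Lp_mass f + osc_mass f"
    let ?w = "\<lambda>i. ennreal ((1 / theta) ^ i)"
    define E where "E i = ?E f i" for i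
    define q where "q i = ?q i" for i
    define V where "V i y = (\<Sum>j. osc f y (rho (Suc i + j)))" for i y
    define Z where "Z i = poly_error k f i" for i
    have [measurable]: "V i \<in> borel_measurable borel" "Z i \<in> borel_measurable borel" for i
      unfolding V_def[abs_def] Z_def by measurable
    have A_le: "(\<integral>\<^sup>+y. cube_L1 f y (rho 0) ennpowr p \<partial>\<nu>) \<le> ennreal CA * ?F"
      by (rule order_trans[OF CA[OF f]]) (auto intro: mult_left_mono)
    have crude: "E i \<le> ?cc * CT * ?F" for i
    proof -
      have "E i \<le> ?cc * (\<integral>\<^sup>+y. trace_bound k f y ennpowr p \<partial>\<nu>)"
        unfolding E_def using powr_mono[of "- real i" 0 2] by (intro approx_mass_crude f) auto
      also have "\<dots> \<le> ?cc * (CT * ?F)" by (intro mult_left_mono CT f) auto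
      finally show ?thesis by (simp add: mult.assoc)
    qed
    have step: "q (i + 2) * E (i + 2) \<le> D * (?cc * (\<integral>\<^sup>+y. (?w i * V i y) ennpowr p \<partial>\<nu>) + (\<integral>\<^sup>+y. (?w i * Z i y) ennpowr p \<partial>\<nu>))" for i
    proof -
      let ?r = "rho (Suc i)"
      let ?a = "\<lambda>w. ennreal (1 / (c1 * ?r powr d)) * (\<integral>\<^sup>+y\<in>cube w ?r. V i y \<partial>\<nu>)"
      \<comment> \<open>The shift by two: \<open>rho\<close> starts at 1/2, and the competing
        polynomial stems from the next larger radius.\<close>
      have r: "2 powr (- real (i + 2)) = ?r" by (simp add: rho_eq_powr)
      have q: "q (i + 2) = ?W * ?W * ?w i ennpowr p"
      proof -
        have "2 powr (real (i + 2) * beta) = 2 powr beta * 2 powr beta * 2 powr (real i * beta)"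
          by (simp add: powr_add[symmetric] algebra_simps)
        then show ?thesis
          by (simp add: q_def inverse_theta_power ennpowr_ennreal powr_mult ennreal_mult')
      qed
      have "E (i + 2) \<le> (\<integral>\<^sup>+w. ennreal (C1 k powr p) * (ennreal (2 powr p) * (?a w ennpowr p + Z i w ennpowr p)) \<partial>\<nu>)"
        unfolding E_def r
      proof (rule nn_integral_restrict_le[OF dset])
        fix w assume w: "w \<in> S"
        have "approx_on d S k (pointwise_trace f) (cube w ?r) ennpowr p \<le> (ennreal (C1 k) * (?a w + Z i w)) ennpowr p"
          using p approx_local_le[OF f k(1) w, of i] by (intro ennpowr_mono) (auto simp: V_def Z_def)
        also have "\<dots> = ennreal (C1 k powr p) * (?a w + Z i w) ennpowr p"
          using C1_ge(1)[of k] by (simp add: ennpowr_mult ennpowr_ennreal)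
        also have "\<dots> \<le> ennreal (C1 k powr p) * (ennreal (2 powr p) * (?a w ennpowr p + Z i w ennpowr p))"
          using p by (intro mult_left_mono ennpowr_add_le) auto
        finally show "approx_on d S k (pointwise_trace f) (cube w ?r) ennpowr p
          \<le> ennreal (C1 k powr p) * (ennreal (2 powr p) * (?a w ennpowr p + Z i w ennpowr p))" .
      qed measurable
      also have "\<dots> = ennreal (C1 k powr p) * (ennreal (2 powr p) * ((\<integral>\<^sup>+w. ?a w ennpowr p \<partial>\<nu>) + (\<integral>\<^sup>+w. Z i w ennpowr p \<partial>\<nu>)))"
        by (simp add: nn_integral_cmult nn_integral_add)
      also have "\<dots> \<le> ennreal (C1 k powr p) * (ennreal (2 powr p) * (?cc * (\<integral>\<^sup>+y. V i y ennpowr p \<partial>\<nu>) + (\<integral>\<^sup>+w. Z i w ennpowr p \<partial>\<nu>)))"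
        using rho_le_half[of "Suc i"] by (intro mult_left_mono add_right_mono average_mass_le) auto
      finally have "q (i + 2) * E (i + 2) \<le> (?W * ?W * ?w i ennpowr p) *
          (ennreal (C1 k powr p) * (ennreal (2 powr p) * (?cc * (\<integral>\<^sup>+y. V i y ennpowr p \<partial>\<nu>) + (\<integral>\<^sup>+w. Z i w ennpowr p \<partial>\<nu>))))"
        unfolding q by (rule mult_left_mono) simp
      also have "\<dots> = D * (?cc * (?w i ennpowr p * (\<integral>\<^sup>+y. V i y ennpowr p \<partial>\<nu>)) + ?w i ennpowr p * (\<integral>\<^sup>+w. Z i w ennpowr p \<partial>\<nu>))"
        unfolding D_def by (simp only: distrib_left mult_ac)
      also have "\<dots> = D * (?cc * (\<integral>\<^sup>+y. (?w i * V i y) ennpowr p \<partial>\<nu>) + (\<integral>\<^sup>+y. (?w i * Z i y) ennpowr p \<partial>\<nu>))"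
        by (simp add: ennpowr_mult nn_integral_cmult)
      finally show ?thesis .
    qed
    have "(\<Sum>i. q (i + 2) * E (i + 2))
        \<le> (\<Sum>i. D * (?cc * (\<integral>\<^sup>+y. (?w i * V i y) ennpowr p \<partial>\<nu>) + (\<integral>\<^sup>+y. (?w i * Z i y) ennpowr p \<partial>\<nu>)))"
      by (intro suminf_le step) auto
    also have "\<dots> = D * (?cc * (\<Sum>i. \<integral>\<^sup>+y. (?w i * V i y) ennpowr p \<partial>\<nu>) + (\<Sum>i. \<integral>\<^sup>+y. (?w i * Z i y) ennpowr p \<partial>\<nu>))"
      by (simp add: suminf_add[symmetric])
    also have "(\<Sum>i. \<integral>\<^sup>+y. (?w i * V i y) ennpowr p \<partial>\<nu>) = (\<integral>\<^sup>+y. (\<Sum>i. (?w i * V i y) ennpowr p) \<partial>\<nu>)"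
      by (rule nn_integral_suminf[symmetric]) measurable
    also have "(\<Sum>i. \<integral>\<^sup>+y. (?w i * Z i y) ennpowr p \<partial>\<nu>) = (\<integral>\<^sup>+y. (\<Sum>i. (?w i * Z i y) ennpowr p) \<partial>\<nu>)"
      by (rule nn_integral_suminf[symmetric]) measurable
    also have "D * (?cc * (\<integral>\<^sup>+y. (\<Sum>i. (?w i * V i y) ennpowr p) \<partial>\<nu>) + (\<integral>\<^sup>+y. (\<Sum>i. (?w i * Z i y) ennpowr p) \<partial>\<nu>))
       \<le> D * (?cc * (\<integral>\<^sup>+y. ?h * besov_sum f y \<partial>\<nu>) + (\<integral>\<^sup>+y. CE * (besov_sum f y + cube_L1 f y (rho 0) ennpowr p) \<partial>\<nu>))"
      unfolding V_def Z_def by (intro mult_left_mono add_mono nn_integral_mono osc_tails_le CE) auto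
    also have "\<dots> = D * (?cc * (?h * (\<integral>\<^sup>+y. besov_sum f y \<partial>\<nu>)) + CE * ((\<integral>\<^sup>+y. besov_sum f y \<partial>\<nu>) + (\<integral>\<^sup>+y. cube_L1 f y (rho 0) ennpowr p \<partial>\<nu>)))"
      by (simp add: nn_integral_cmult nn_integral_add)
    also have "\<dots> \<le> D * (?cc * (?h * (ennreal CB * ?F)) + CE * (ennreal CB * ?F + ennreal CA * ?F))"
      by (intro mult_left_mono add_mono CB f A_le) auto
    also have "\<dots> = D * (?cc * (?h * ennreal CB) + CE * (ennreal CB + ennreal CA)) * ?F"
      by (simp only: distrib_right mult.assoc)
    finally have tail: "(\<Sum>i. q (i + 2) * E (i + 2)) \<le> D * (?cc * (?h * ennreal CB) + CE * (ennreal CB + ennreal CA)) * ?F" .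
    \<comment> \<open>The terms 0 and 1 belong to the radii 1 and 1/2 and are bounded
      crudely.\<close>
    have "(\<Sum>i. q i * E i) = (\<Sum>i. q (i + 2) * E (i + 2)) + (\<Sum>i<2. q i * E i)"
      by (rule suminf_offset) simp
    also have "(\<Sum>i<2. q i * E i) = E 0 + ?W * E 1"
      by (simp add: q_def numeral_2_eq_2)
    also have "(\<Sum>i. q (i + 2) * E (i + 2)) + (E 0 + ?W * E 1)
        \<le> D * (?cc * (?h * ennreal CB) + CE * (ennreal CB + ennreal CA)) * ?F + (?cc * CT * ?F + ?W * (?cc * CT * ?F))"
      by (intro add_mono tail crude mult_left_mono) auto
    also have "\<dots> = C * ?F"
      unfolding C_def by (simp only: distrib_right mult.assoc add.commute)
    finally show "(\<Sum>i. ?q i * ?E f i) \<le> C * ?F" unfolding q_def E_def .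
  qed
qed

lemma trace_mass_ex:
  "\<exists>C<\<infinity>. \<forall>f. loc_int f \<longrightarrow> (\<integral>\<^sup>+y. ennreal \<bar>pointwise_trace f y\<bar> ennpowr p \<partial>HS) \<le> C * (Lp_mass f + osc_mass f)"
proof -
  \<comment> \<open>The index of \<open>trace_bound\<close> affects only its constant; 0 is an
    arbitrary choice.\<close>
  obtain CT where CT: "CT < \<infinity>" "\<And>f. loc_int f \<Longrightarrow> (\<integral>\<^sup>+y. trace_bound 0 f y ennpowr p \<partial>\<nu>) \<le> CT * (Lp_mass f + osc_mass f)"
    using trace_bound_mass_ex by blast
  have "(\<integral>\<^sup>+y. ennreal \<bar>pointwise_trace f y\<bar> ennpowr p \<partial>HS) \<le> (\<integral>\<^sup>+y. trace_bound 0 f y ennpowr p \<partial>\<nu>)" if f: "loc_int f" for f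
  proof (rule nn_integral_restrict_le[OF dset])
    note [measurable] = loc_intD[OF f]
    show "(\<lambda>y. trace_bound 0 f y ennpowr p) \<in> borel_measurable borel" by measurable
    show "ennreal \<bar>pointwise_trace f y\<bar> ennpowr p \<le> trace_bound 0 f y ennpowr p" for y
      using p trace_le[OF f m_pos, of y 0] by (intro ennpowr_mono) (auto simp: trace_bound_def)
  qed
  with CT show ?thesis by (meson order_trans)
qed

end

section \<open>Comparison with the Triebel-Lizorkin function\<close>

lemma approx_Rn_eq_lborel: "Q \<in> sets borel \<Longrightarrow> approx_Rn m f Q = local_approx m lborel f Q"
  by (simp add: approx_Rn_def local_approx_def nn_integral_completion)

context coefficient_kernel begin

text \<open>The constant must not depend on \<open>q\<close>. One factor
  \<open>C0 * 2 ^ CARD('n)\<close> passes to a radius \<open>t\<close> between \<open>rho i\<close>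
  and \<open>2 * rho i\<close>, one to best approximation, and the 2 comes from integrating over
  these radii.\<close>

lemma osc_le_TL_function:
  assumes f: "loc_int f" and q: "1 \<le> q" and \<alpha>: "0 < \<alpha>"
  shows "ennreal (2 powr (real i * \<alpha>)) * osc f x (rho i)
    \<le> ennreal (2 * (C0 * 2 ^ CARD('n)) ^ 2) * TL_function m \<alpha> q f x"
proof -
  let ?B = "C0 * 2 ^ CARD('n)" and ?r = "rho i" and ?o = "osc f x (rho i)" and ?T = "TL_function m \<alpha> q f x"
  let ?h = "\<lambda>t. ennreal (t powr (- \<alpha>)) * approx_Rn m f (cube x t)"
  have B: "1 \<le> ?B" using C0_ge_1 mult_mono[of 1 C0 1 "2 ^ CARD('n)"] by simp
  then have B2: "?B \<le> ?B\<^sup>2" "1 \<le> ?B\<^sup>2"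
    by (auto intro: self_le_power one_le_power)
  have "2 * ?r = (1 / 2) ^ i" by (simp add: rho_def)
  then have r2: "2 * ?r = 2 powr (- real i)"
    by (simp only: powr_minus powr_realpow[OF zero_less_numeral] power_one_over inverse_eq_divide)
  \<comment> \<open>The upper end of the interval of radii matches the dyadic weight exactly, so
    \<open>t powr (- \<alpha>)\<close> dominates the weight on the whole interval.\<close>
  have scale: "(2 * ?r) powr (- \<alpha>) = 2 powr (real i * \<alpha>)"
    unfolding r2 by (simp add: powr_powr)
  have oh: "ennreal (2 powr (real i * \<alpha>)) * ?o \<le> ennreal (?B\<^sup>2) * ?h t" if t: "?r \<le> t" "t \<le> 2 * ?r" for t
  proof -
    have t0: "0 < t" using t(1) rho_pos(1)[of i] by linarith
    have "t / ?r \<le> 2" using t by (simp add: field_simps)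
    then have "(t / ?r) ^ CARD('n) \<le> 2 ^ CARD('n)" using t0 by (intro power_mono) auto
    then have "C0 * (t / ?r) ^ CARD('n) \<le> ?B" using C0_ge_1 by (intro mult_left_mono) auto
    then have "?o \<le> ennreal ?B * osc f x t"
      using osc_mono[OF f rho_pos(1) t0 cube_mono[OF t(1)], of x] by (meson ennreal_leI mult_right_mono order_trans zero_le)
    also have "\<dots> \<le> ennreal ?B * (ennreal ?B * approx_Rn m f (cube x t))"
      using osc_le_approx[OF f t0] by (intro mult_left_mono) (auto simp: approx_Rn_eq_lborel)
    also have "\<dots> = ennreal (?B\<^sup>2) * approx_Rn m f (cube x t)"
    proof -
      have "ennreal (?B\<^sup>2) = ennreal ?B * ennreal ?B"
        unfolding power2_eq_square using B by (intro ennreal_mult) auto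
      then show ?thesis by (simp only: mult.assoc)
    qed
    finally have o: "?o \<le> ennreal (?B\<^sup>2) * approx_Rn m f (cube x t)" .
    have "2 powr (real i * \<alpha>) \<le> t powr (- \<alpha>)"
      unfolding scale[symmetric] using t t0 \<alpha> by (intro powr_mono2') auto
    with o have "ennreal (2 powr (real i * \<alpha>)) * ?o \<le> ennreal (t powr (- \<alpha>)) * (ennreal (?B\<^sup>2) * approx_Rn m f (cube x t))"
      by (intro mult_mono ennreal_leI) auto
    then show ?thesis by (simp only: mult.left_commute)
  qed
  show ?thesis
  proof (cases "q = \<infinity>")
    case True
    have "ennreal (2 powr (real i * \<alpha>)) * ?o \<le> ennreal (?B\<^sup>2) * ?h ?r" by (rule oh) auto
    also have "?h ?r \<le> ?T"
      unfolding TL_function_def using True rho_le_half[of i] by (auto intro!: SUP_upper2[of ?r])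
    also have "ennreal (?B\<^sup>2) * ?T \<le> ennreal (2 * ?B\<^sup>2) * ?T"
      using B2 by (intro mult_right_mono ennreal_leI) auto
    finally show ?thesis by (simp add: mult_left_mono)
  next
    case False
    then obtain q' where q': "q = ennreal q'" "1 \<le> q'"
      using q by (cases q) (auto simp flip: ennreal_1)
    let ?u = "ennreal (1 / ?B\<^sup>2) * (ennreal (2 powr (real i * \<alpha>)) * ?o)"
    have uh: "?u \<le> ?h t" if "?r \<le> t" "t \<le> 2 * ?r" for t
    proof -
      have "?u \<le> ennreal (1 / ?B\<^sup>2) * (ennreal (?B\<^sup>2) * ?h t)"
        by (intro mult_left_mono oh that) auto
      also have "\<dots> = ?h t"
      proof -
        have "ennreal (1 / ?B\<^sup>2) * ennreal (?B\<^sup>2) = 1"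
          using B2 B by (subst ennreal_mult'[symmetric]) auto
        then show ?thesis by (simp add: mult.assoc[symmetric])
      qed
      finally show ?thesis .
    qed
    \<comment> \<open>On this interval, of length \<open>?r\<close>, the weight \<open>1 / t\<close>
      is at least \<open>1 / (2 * ?r)\<close>, giving mass at least 1/2. The interval lies in
      \<open>{0<..1}\<close> because \<open>rho i \<le> 1 / 2\<close>.\<close>
    have "ennreal (1 / 2) * ?u ennpowr q' = (\<integral>\<^sup>+t\<in>{?r..2 * ?r}. ?u ennpowr q' * ennreal (1 / (2 * ?r)) \<partial>lborel)"
    proof -
      have "(\<integral>\<^sup>+t\<in>{?r..2 * ?r}. ?u ennpowr q' * ennreal (1 / (2 * ?r)) \<partial>lborel)
          = ?u ennpowr q' * ennreal (1 / (2 * ?r)) * emeasure lborel {?r..2 * ?r}"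
        by (rule nn_integral_cmult_indicator) simp
      also have "emeasure lborel {?r..2 * ?r} = ennreal ?r" by simp
      also have "?u ennpowr q' * ennreal (1 / (2 * ?r)) * ennreal ?r = ?u ennpowr q' * ennreal (1 / 2)"
        unfolding mult.assoc by (subst ennreal_mult'[symmetric]) auto
      finally show ?thesis by (simp only: mult.commute)
    qed
    also have "\<dots> \<le> (\<integral>\<^sup>+t\<in>{0<..1}. ?h t ennpowr q' * ennreal (1 / t) \<partial>lborel)"
    proof (intro nn_integral_mono)
      fix t
      show "?u ennpowr q' * ennreal (1 / (2 * ?r)) * indicator {?r..2 * ?r} t \<le> ?h t ennpowr q' * ennreal (1 / t) * indicator {0<..1} t"
      proof (cases "t \<in> {?r..2 * ?r}")
        case True
        then have t: "?r \<le> t" "t \<le> 2 * ?r" by auto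
        have t01: "0 < t" "t \<le> 1" using t rho_le_half[of i] rho_pos(1)[of i] by linarith+
        have "?u ennpowr q' * ennreal (1 / (2 * ?r)) \<le> ?h t ennpowr q' * ennreal (1 / t)"
          using t t01 q' by (intro mult_mono ennpowr_mono[OF uh[OF t]]) (auto intro!: ennreal_leI divide_left_mono)
        with True t01 show ?thesis by simp
      qed simp
    qed
    finally have "(ennreal (1 / 2) * ?u ennpowr q') ennpowr (1 / q') \<le> ?T"
      unfolding TL_function_def using q' by (auto intro!: ennpowr_mono)
    moreover have "(ennreal (1 / 2) * ?u ennpowr q') ennpowr (1 / q') = ennreal ((1 / 2) powr (1 / q')) * ?u"
      unfolding ennpowr_mult[of "ennreal (1 / 2)"] ennpowr_ennpowr using q' by (subst ennpowr_ennreal) simp_all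
    \<comment> \<open>Here \<open>q' \<ge> 1\<close> removes \<open>q\<close> from the
      constant.\<close>
    moreover have "(1 / 2) powr 1 \<le> (1 / 2 :: real) powr (1 / q')"
      using q' by (intro powr_mono') auto
    then have "ennreal (1 / 2) * ?u \<le> ennreal ((1 / 2) powr (1 / q')) * ?u"
      by (intro mult_right_mono ennreal_leI) auto
    ultimately have "ennreal (1 / 2) * ?u \<le> ?T" by simp
    then have "ennreal (2 * ?B\<^sup>2) * (ennreal (1 / 2) * ?u) \<le> ennreal (2 * ?B\<^sup>2) * ?T"
      by (intro mult_left_mono) auto
    moreover have "ennreal (2 * ?B\<^sup>2) * (ennreal (1 / 2) * ?u) = ennreal (2 powr (real i * \<alpha>)) * ?o"
    proof -
      have "ennreal (2 * ?B\<^sup>2) * (ennreal (1 / 2) * ennreal (1 / ?B\<^sup>2)) = ennreal (2 * ?B\<^sup>2 * (1 / 2 * (1 / ?B\<^sup>2)))"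
        by (simp only: ennreal_mult'[symmetric] zero_le_mult_iff zero_le_divide_iff zero_le_power2 zero_le_numeral zero_le_one simp_thms)
      also have "2 * ?B\<^sup>2 * (1 / 2 * (1 / ?B\<^sup>2)) = 1" using B2(2) by (auto simp: divide_simps)
      finally show ?thesis by (simp only: mult.assoc[symmetric] ennreal_1 mult_1_left)
    qed
    ultimately show ?thesis by simp
  qed
qed

end

section \<open>Passage to a Borel representative\<close>

lemma local_approx_cong_AE:
  assumes "AE x in lborel. f x = g x"
  shows "local_approx m lborel f Q = local_approx m lborel g Q"
proof -
  have "(\<integral>\<^sup>+y\<in>Q. ennreal \<bar>f y - P y\<bar> \<partial>lborel) = (\<integral>\<^sup>+y\<in>Q. ennreal \<bar>g y - P y\<bar> \<partial>lborel)" for P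
    using assms by (intro nn_integral_cong_AE) auto
  then show ?thesis by (simp add: local_approx_def)
qed

lemma TL_function_cong_AE:
  assumes "AE x in lborel. f x = g x"
  shows "TL_function m \<alpha> q f = TL_function m \<alpha> q g"
proof -
  have "approx_Rn m f (cube x t) = approx_Rn m g (cube x t)" for x t
    using local_approx_cong_AE[OF assms] by (simp add: approx_Rn_eq_lborel)
  then show ?thesis by (simp add: TL_function_def fun_eq_iff)
qed

text \<open>The trace is built from averages, so the equality holds at every point and therefore
  also on Lebesgue null sets.\<close>

lemma pointwise_trace_cong_AE:
  assumes ae: "AE x in lborel. f x = g x"
    and [measurable]: "f \<in> borel_measurable lebesgue" "g \<in> borel_measurable lebesgue"
  shows "pointwise_trace f = pointwise_trace g"
proof -
  have "(LINT y:cube x r|lebesgue. f y) = (LINT y:cube x r|lebesgue. g y)" for x r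
    unfolding set_lebesgue_integral_def
  proof (rule integral_cong_AE)
    show "AE y in lebesgue. indicator (cube x r) y *\<^sub>R f y = indicator (cube x r) y *\<^sub>R g y"
      using AE_completion[OF ae] by eventually_elim simp
    have [measurable]: "cube x r \<in> sets lebesgue" by simp
    show "(\<lambda>y. indicator (cube x r) y *\<^sub>R f y) \<in> borel_measurable lebesgue" by measurable
    show "(\<lambda>y. indicator (cube x r) y *\<^sub>R g y) \<in> borel_measurable lebesgue" by measurable
  qed
  then have "cube_average f = cube_average g" by (simp add: cube_average_def fun_eq_iff)
  then show ?thesis by (simp only: pointwise_trace_def[abs_def])
qed

text \<open>Everything that occurs in the theorem sees \<open>f\<close> only through integrals and
  does not notice the change.\<close>

lemma TL_space_borel_representative:
  assumes "f \<in> TL_space m \<alpha> p q"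
  obtains g where "loc_int g" "pointwise_trace f = pointwise_trace g"
    "TL_function m \<alpha> q f = TL_function m \<alpha> q g"
    "(\<integral>\<^sup>+x. ennreal \<bar>f x\<bar> ennpowr p \<partial>lebesgue) = (\<integral>\<^sup>+x. ennreal \<bar>g x\<bar> ennpowr p \<partial>lborel)"
proof -
  have f: "f \<in> borel_measurable lebesgue" and L1: "L1_loc f" using assms by (auto simp: TL_space_def)
  obtain g where g[measurable]: "g \<in> borel_measurable borel" and ae: "AE x in lborel. f x = g x"
    using completion_ex_borel_measurable_real[OF f] by auto
  have "loc_int g"
    unfolding loc_int_def
  proof (intro conjI g allI impI)
    fix y :: "real^'a" and r :: real
    have "set_integrable lebesgue (cube y r) f" using L1 by (simp add: L1_loc_def)
    then have "(\<integral>\<^sup>+x. ennreal (norm (indicator (cube y r) x *\<^sub>R f x)) \<partial>lebesgue) < \<infinity>"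
      by (simp add: set_integrable_def integrable_iff_bounded)
    also have "(\<integral>\<^sup>+x. ennreal (norm (indicator (cube y r) x *\<^sub>R f x)) \<partial>lebesgue) = (\<integral>\<^sup>+x\<in>cube y r. ennreal \<bar>g x\<bar> \<partial>lborel)"
      unfolding nn_integral_completion using ae
      by (intro nn_integral_cong_AE) (auto simp: indicator_def)
    finally show "(\<integral>\<^sup>+x\<in>cube y r. ennreal \<bar>g x\<bar> \<partial>lborel) < \<infinity>" .
  qed
  moreover have "pointwise_trace f = pointwise_trace g"
    using g by (intro pointwise_trace_cong_AE[OF ae f]) (simp add: measurable_completion)
  moreover have "(\<integral>\<^sup>+x. ennreal \<bar>f x\<bar> ennpowr p \<partial>lebesgue) = (\<integral>\<^sup>+x. ennreal \<bar>g x\<bar> ennpowr p \<partial>lborel)"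
    unfolding nn_integral_completion using ae by (intro nn_integral_cong_AE) auto
  ultimately show ?thesis using that TL_function_cong_AE[OF ae] by blast
qed

text \<open>More competitors give a smaller infimum; this makes the constant of the theorem
  independent of \<open>k\<close>.\<close>

lemma local_approx_antimono: "k \<le> l \<Longrightarrow> local_approx l M f A \<le> local_approx k M f A"
  unfolding local_approx_def by (rule INF_superset_mono[OF polys_below_mono]) auto

lemma Lp_norm_ennpowr: "0 < p \<Longrightarrow> Lp_norm M p u ennpowr p = (\<integral>\<^sup>+x. u x ennpowr p \<partial>M)"
  by (simp add: Lp_norm_def ennpowr_ennpowr)

lemma (in trace_setting) osc_mass_le:
  assumes f: "loc_int f" and q: "1 \<le> q" and [measurable]: "TL_function m \<alpha> q f \<in> borel_measurable lebesgue"
  shows "osc_mass f \<le> ennreal ((2 * (C0 * 2 ^ CARD('n)) ^ 2) powr p) * (\<integral>\<^sup>+x. TL_function m \<alpha> q f x ennpowr p \<partial>lebesgue)"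
proof -
  let ?B = "2 * (C0 * 2 ^ CARD('n)) ^ 2"
  have \<alpha>: "0 < \<alpha>" using beta_pos beta_less by simp
  have "sup_osc f x ennpowr p \<le> ennreal (?B powr p) * TL_function m \<alpha> q f x ennpowr p" for x
  proof -
    have "sup_osc f x \<le> ennreal ?B * TL_function m \<alpha> q f x"
      unfolding sup_osc_def by (intro SUP_least osc_le_TL_function f q \<alpha>)
    then have "sup_osc f x ennpowr p \<le> (ennreal ?B * TL_function m \<alpha> q f x) ennpowr p"
      using p by (intro ennpowr_mono) auto
    also have "\<dots> = ennreal (?B powr p) * TL_function m \<alpha> q f x ennpowr p"
      unfolding ennpowr_mult by (subst ennpowr_ennreal) auto
    finally show ?thesis .
  qed
  then have "osc_mass f \<le> (\<integral>\<^sup>+x. ennreal (?B powr p) * TL_function m \<alpha> q f x ennpowr p \<partial>lebesgue)"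
    unfolding osc_mass_def by (subst nn_integral_completion[of lborel, symmetric]) (intro nn_integral_mono)
  also have "\<dots> = ennreal (?B powr p) * (\<integral>\<^sup>+x. TL_function m \<alpha> q f x ennpowr p \<partial>lebesgue)"
    by (rule nn_integral_cmult) measurable
  finally show ?thesis .
qed

theorem theorem4p8:
  fixes S :: "(real^'n) set" and d p \<alpha> :: real and m :: nat
  assumes "d_set d S"
    and "real CARD('n) - 1 < d" and "d < real CARD('n)"
    and "1 < p"
    and "\<alpha> > (real CARD('n) - d) / p"
    and "real m > \<alpha>"
  shows "\<exists>c::real. c > 0 \<and>
    (\<forall>(q::ennreal) (k::nat) (f :: real^'n \<Rightarrow> real).
       1 \<le> q \<longrightarrow> real k > \<alpha> \<longrightarrow> f \<in> TL_space m \<alpha> p q \<longrightarrow>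
       (\<Sum>i::nat. (ennreal (2 powr (real i * (\<alpha> - (real CARD('n) - d) / p))) *
            Lp_norm (restrict_space (hausdorff_measure d) S) p
              (\<lambda>x. approx_on d S k (pointwise_trace f) (cube x (2 powr (- real i))))) ennpowr p) ennpowr (1 / p)
       + Lp_norm (restrict_space (hausdorff_measure d) S) p (\<lambda>x. ennreal \<bar>pointwise_trace f x\<bar>)
       \<le> ennreal c * TL_norm m \<alpha> p q f)"
proof -
  note dset = assms(1) and p = assms(4)
  have "0 < (real CARD('n) - d) / p" using assms by simp
  then have \<alpha>: "0 < \<alpha>" using assms(5) by linarith
  then have m: "0 < m" using assms(6) by (metis less_trans of_nat_0_less_iff)
  obtain \<Phi> :: "('n \<Rightarrow> nat) \<Rightarrow> real^'n \<Rightarrow> real" and K where "coefficient_kernel m \<Phi> K"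
    using coefficient_kernel_ex[of m] unfolding coefficient_kernel_def by blast
  then interpret coefficient_kernel m \<Phi> K .
  obtain c1 c2 where "regular_measure (trace_measure d S) S d c1 c2"
    using d_set_regular_measure[OF dset assms(3)] by blast
  then interpret regular_measure "trace_measure d S" S d c1 c2 .
  interpret d_set_setting m \<Phi> K S d c1 c2 p \<alpha>
    by unfold_locales (use assms m in auto)
  \<comment> \<open>The least integer above \<open>\<alpha>\<close>: it is at most \<open>m\<close>
    and at most every admissible \<open>k\<close>, and it is the only degree for which the estimate
    is carried out.\<close>
  define k0 where "k0 = nat \<lfloor>\<alpha>\<rfloor> + 1"
  have k0: "\<alpha> < real k0" "\<And>k. \<alpha> < real k \<Longrightarrow> k0 \<le> k"
    using \<alpha> unfolding k0_def by linarith+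
  have k0m: "k0 \<le> m" using k0(2) assms(6) by simp
  obtain CE where CE: "CE < \<infinity>" "\<And>f. loc_int f \<Longrightarrow>
    (\<Sum>i. ennreal ((2 powr (real i * beta)) powr p) * (\<integral>\<^sup>+w. approx_on d S k0 (pointwise_trace f) (cube w (2 powr (- real i))) ennpowr p \<partial>HS))
    \<le> CE * (Lp_mass f + osc_mass f)"
    using approx_mass_ex[OF k0m k0(1)] by blast
  obtain CT where CT: "CT < \<infinity>" "\<And>f. loc_int f \<Longrightarrow>
    (\<integral>\<^sup>+y. ennreal \<bar>pointwise_trace f y\<bar> ennpowr p \<partial>HS) \<le> CT * (Lp_mass f + osc_mass f)"
    using trace_mass_ex by blast
  define B where "B = ennreal ((2 * (C0 * 2 ^ CARD('n)) ^ 2) powr p)"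
  \<comment> \<open>The factor \<open>1 + B\<close> compares the two masses with those of
    \<open>f\<close> and of its Triebel-Lizorkin function; \<open>2 powr (1 / p)\<close> is the
    price of taking the root of their sum termwise.\<close>
  define R where "R = ennreal (2 powr (1 / p)) * (1 + B) ennpowr (1 / p)"
  define cc where "cc = CE ennpowr (1 / p) * R + CT ennpowr (1 / p) * R"
  have fin_powr: "x ennpowr (1 / p) < \<infinity>" if "x < \<infinity>" for x
    using that by (cases x) (auto simp: ennpowr_ennreal)
  have "cc < \<infinity>"
    using CE(1) CT(1) unfolding cc_def R_def B_def
    by (auto simp: ennreal_mult_less_top intro!: fin_powr[simplified])
  then obtain c where c: "cc = ennreal c" "0 \<le> c" by (cases cc) auto
  have main: "(\<Sum>i::nat. (ennreal (2 powr (real i * (\<alpha> - (real CARD('n) - d) / p))) *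
            Lp_norm HS p (\<lambda>x. approx_on d S k (pointwise_trace f) (cube x (2 powr (- real i))))) ennpowr p) ennpowr (1 / p)
       + Lp_norm HS p (\<lambda>x. ennreal \<bar>pointwise_trace f x\<bar>) \<le> ennreal (c + 1) * TL_norm m \<alpha> p q f"
    if q: "1 \<le> q" and k: "\<alpha> < real k" and f: "f \<in> TL_space m \<alpha> p q" for q k and f :: "real^'n \<Rightarrow> real"
  proof -
    obtain g where g: "loc_int g" "pointwise_trace f = pointwise_trace g"
      "TL_function m \<alpha> q f = TL_function m \<alpha> q g"
      "(\<integral>\<^sup>+x. ennreal \<bar>f x\<bar> ennpowr p \<partial>lebesgue) = (\<integral>\<^sup>+x. ennreal \<bar>g x\<bar> ennpowr p \<partial>lborel)"
      by (rule TL_space_borel_representative[OF f])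
    let ?t = "\<lambda>i. (ennreal (2 powr (real i * (\<alpha> - (real CARD('n) - d) / p))) *
            Lp_norm HS p (\<lambda>x. approx_on d S k (pointwise_trace f) (cube x (2 powr (- real i))))) ennpowr p"
    let ?s = "\<lambda>k i. ennreal ((2 powr (real i * beta)) powr p) * (\<integral>\<^sup>+w. approx_on d S k (pointwise_trace g) (cube w (2 powr (- real i))) ennpowr p \<partial>HS)"
    let ?F = "\<integral>\<^sup>+x. ennreal \<bar>f x\<bar> ennpowr p \<partial>lebesgue"
    let ?G = "\<integral>\<^sup>+x. TL_function m \<alpha> q f x ennpowr p \<partial>lebesgue"
    have osc: "osc_mass g \<le> B * ?G"
      unfolding g(3) B_def using f g(3) by (intro osc_mass_le g(1) q) (simp add: TL_space_def)
    have mass: "Lp_mass g + osc_mass g \<le> (1 + B) * (?F + ?G)"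
      unfolding Lp_mass_def g(4)[symmetric] distrib_left[of "1 + B"]
    proof (rule add_mono)
      show "?F \<le> (1 + B) * ?F" using mult_right_mono[of 1 "1 + B" ?F] by simp
      show "osc_mass g \<le> (1 + B) * ?G" using osc by (rule order_trans) (auto intro: mult_right_mono)
    qed
    have root: "x ennpowr (1 / p) \<le> C ennpowr (1 / p) * R * TL_norm m \<alpha> p q f"
      if "x \<le> C * (Lp_mass g + osc_mass g)" for x C
    proof -
      have "x \<le> C * ((1 + B) * (?F + ?G))"
        using that mass by (meson mult_left_mono order_trans zero_le)
      then have "x ennpowr (1 / p) \<le> (C * ((1 + B) * (?F + ?G))) ennpowr (1 / p)"
        using p by (intro ennpowr_mono) auto
      also have "\<dots> = C ennpowr (1 / p) * ((1 + B) ennpowr (1 / p) * (?F + ?G) ennpowr (1 / p))"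
        by (simp add: ennpowr_mult)
      also have "\<dots> \<le> C ennpowr (1 / p) * ((1 + B) ennpowr (1 / p) * (ennreal (2 powr (1 / p)) * (?F ennpowr (1 / p) + ?G ennpowr (1 / p))))"
        using p by (intro mult_left_mono ennpowr_add_le) auto
      also have "\<dots> = C ennpowr (1 / p) * R * TL_norm m \<alpha> p q f"
        unfolding R_def TL_norm_def Lp_norm_def by (simp only: mult_ac)
      finally show ?thesis .
    qed
    have "(\<Sum>i. ?t i) \<le> (\<Sum>i. ?s k0 i)"
    proof (rule suminf_le)
      fix i
      have "?t i = ?s k i"
        using p by (simp add: ennpowr_mult ennpowr_ennreal Lp_norm_ennpowr beta_def g(2))
      also have "\<dots> \<le> ?s k0 i"
        using p k0(2)[OF k] unfolding approx_on_def
        by (intro mult_left_mono nn_integral_mono ennpowr_mono local_approx_antimono) auto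
      finally show "?t i \<le> ?s k0 i" .
    qed auto
    also note CE(2)[OF g(1)]
    finally have 1: "(\<Sum>i. ?t i) ennpowr (1 / p) \<le> CE ennpowr (1 / p) * R * TL_norm m \<alpha> p q f"
      by (rule root)
    have "Lp_norm HS p (\<lambda>x. ennreal \<bar>pointwise_trace f x\<bar>) \<le> CT ennpowr (1 / p) * R * TL_norm m \<alpha> p q f"
      unfolding Lp_norm_def[of HS] g(2) by (rule root[OF CT(2)[OF g(1)]])
    from add_mono[OF 1 this] have "(\<Sum>i. ?t i) ennpowr (1 / p)
       + Lp_norm HS p (\<lambda>x. ennreal \<bar>pointwise_trace f x\<bar>) \<le> cc * TL_norm m \<alpha> p q f"
      unfolding cc_def distrib_right .
    also have "\<dots> \<le> ennreal (c + 1) * TL_norm m \<alpha> p q f"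
      unfolding c(1) by (intro mult_right_mono ennreal_leI) auto
    finally show ?thesis .
  qed
  \<comment> \<open>Passing to \<open>c + 1\<close> makes the constant positive even if
    \<open>c\<close> is 0.\<close>
  show ?thesis
    using main c(2) by (intro exI[of _ "c + 1"]) auto
qed

end
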